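(* Let $k$ be a commutative ring and let $A$ be a $k$-algebra that is finitely generated projective as a $k$-module, with finite dual basis $\sum_i a_i^*\otimes a_i\in A^*\otimes A$. Let $f_i\in\mathrm{End}_k(A)$ be given by $f_i(x)=\langle a_i^*,x\rangle 1$. Then the category of left $\mathrm{End}_k(A)$-modules is a braided monoidal category, with the following structure. The tensor product is the tensor product over $A$, where a left $\mathrm{End}_k(A)$-module is an $A$-bimodule by restriction of scalars via $F:A\otimes A^{\rm op}\to\mathrm{End}_k(A)$, $F(a\otimes b)(x)=axb$. The left $\mathrm{End}_k(A)$-action on $V\otimes_A W$ is given by $$f\cdot(v\otimes_A w)=\sum_i f_i\cdot v\otimes_A f(a_i-)\cdot w=\sum_j f(-a_j)\cdot v\otimes_A f_j\cdot w$$ for all $f\in\mathrm{End}_k(A)$, $v\in V$, $w\in W$. The unit object is $A$ with $\mathrm{End}_k(A)$-action $f\cdot a=f(a)$. The braiding is given by $$c_{V,W}:V\otimes_A W\to W\otimes_A V,\qquad c_{V,W}(v\otimes_A w)=\sum_i f_i\cdot w\otimes_A v\,a_i.$$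
   Context: Conventions: $\otimes=\otimes_k$, $A^*=\mathrm{Hom}_k(A,k)$; algebras are associative and unital; multiplication in $\mathrm{End}_k(A)$ is composition. A finite dual basis is an element $\sum_i a_i^*\otimes a_i$ with $\sum_i\langle a_i^*,x\rangle a_i=x$ for all $x\in A$. For $f\in\mathrm{End}_k(A)$ and $a\in A$, $f(a-)$ and $f(-a)$ denote the endomorphisms $x\mapsto f(ax)$ and $x\mapsto f(xa)$. The bimodule structure via $F$ is $av=F(a\otimes 1)\cdot v$, $va=F(1\otimes a)\cdot v$. The associativity and unit constraints are the usual ones for $\otimes_A$. A braiding is a natural isomorphism $c_{U,V}:U\otimes V\to V\otimes U$ satisfying $c_{U,V\otimes W}=(V\otimes c_{U,W})\circ(c_{U,V}\otimes W)$ and $c_{U\otimes V,W}=(c_{U,W}\otimes V)\circ(U\otimes c_{V,W})$ (here with $\otimes$ meaning the monoidal product $\otimes_A$). *)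

theory Defs
  imports "HOL-Algebra.Module" "HOL-Algebra.Free_Abelian_Groups"
    "HOL-Library.Infinite_Typeclass"
begin

section \<open>Braided monoidal categories\<close>

record ('o, 'm) category_data =
  Obj :: "'o set"
  Arr :: "'m set"
  Src :: "'m \<Rightarrow> 'o"
  Tgt :: "'m \<Rightarrow> 'o"
  Idt :: "'o \<Rightarrow> 'm"
  Cmp :: "'m \<Rightarrow> 'm \<Rightarrow> 'm"  (infixr \<open>\<bullet>\<index>\<close> 65)

record ('o, 'm) monoidal_data = "('o, 'm) category_data" +
  TensO :: "'o \<Rightarrow> 'o \<Rightarrow> 'o"  (infixr \<open>\<boxtimes>\<index>\<close> 75)
  TensA :: "'m \<Rightarrow> 'm \<Rightarrow> 'm"  (infixr \<open>\<star>\<index>\<close> 75)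
  UnitO :: "'o"
  Assoc :: "'o \<Rightarrow> 'o \<Rightarrow> 'o \<Rightarrow> 'm"
  LUnit :: "'o \<Rightarrow> 'm"
  RUnit :: "'o \<Rightarrow> 'm"

record ('o, 'm) braided_data = "('o, 'm) monoidal_data" +
  Braid :: "'o \<Rightarrow> 'o \<Rightarrow> 'm"

definition Homs :: "('o, 'm, 'z) category_data_scheme \<Rightarrow> 'o \<Rightarrow> 'o \<Rightarrow> 'm set"
  where "Homs C X Y = {f \<in> Arr C. Src C f = X \<and> Tgt C f = Y}"

definition inverse_arrows :: "('o, 'm, 'z) category_data_scheme \<Rightarrow> 'm \<Rightarrow> 'm \<Rightarrow> bool"
  where "inverse_arrows C f g \<longleftrightarrow>
    f \<in> Arr C \<and> g \<in> Homs C (Tgt C f) (Src C f) \<and>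
    Cmp C g f = Idt C (Src C f) \<and> Cmp C f g = Idt C (Tgt C f)"

definition iso_arrow :: "('o, 'm, 'z) category_data_scheme \<Rightarrow> 'm \<Rightarrow> bool"
  where "iso_arrow C f \<longleftrightarrow> (\<exists>g. inverse_arrows C f g)"

definition inv_arrow :: "('o, 'm, 'z) category_data_scheme \<Rightarrow> 'm \<Rightarrow> 'm"
  where "inv_arrow C f = (THE g. inverse_arrows C f g)"

locale category =
  fixes C (structure)
  assumes Src_Obj: "f \<in> Arr C \<Longrightarrow> Src C f \<in> Obj C"
    and Tgt_Obj: "f \<in> Arr C \<Longrightarrow> Tgt C f \<in> Obj C"
    and Idt_Homs: "X \<in> Obj C \<Longrightarrow> Idt C X \<in> Homs C X X"
    and Cmp_Homs: "\<lbrakk>f \<in> Homs C X Y; g \<in> Homs C Y Z\<rbrakk> \<Longrightarrow> g \<bullet> f \<in> Homs C X Z"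
    and Cmp_Idt_left: "f \<in> Homs C X Y \<Longrightarrow> Idt C Y \<bullet> f = f"
    and Cmp_Idt_right: "f \<in> Homs C X Y \<Longrightarrow> f \<bullet> Idt C X = f"
    and Cmp_assoc: "\<lbrakk>f \<in> Homs C W X; g \<in> Homs C X Y; h \<in> Homs C Y Z\<rbrakk>
      \<Longrightarrow> (h \<bullet> g) \<bullet> f = h \<bullet> (g \<bullet> f)"

locale monoidal_category = category C for C (structure) +
  assumes TensO_Obj: "\<lbrakk>X \<in> Obj C; Y \<in> Obj C\<rbrakk> \<Longrightarrow> X \<boxtimes> Y \<in> Obj C"
    and TensA_Homs: "\<lbrakk>f \<in> Homs C X X'; g \<in> Homs C Y Y'\<rbrakk>
      \<Longrightarrow> f \<star> g \<in> Homs C (X \<boxtimes> Y) (X' \<boxtimes> Y')"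
    and TensA_Idt: "\<lbrakk>X \<in> Obj C; Y \<in> Obj C\<rbrakk> \<Longrightarrow> Idt C X \<star> Idt C Y = Idt C (X \<boxtimes> Y)"
    and TensA_Cmp: "\<lbrakk>f \<in> Homs C X X'; f' \<in> Homs C X' X''; g \<in> Homs C Y Y'; g' \<in> Homs C Y' Y''\<rbrakk>
      \<Longrightarrow> (f' \<bullet> f) \<star> (g' \<bullet> g) = (f' \<star> g') \<bullet> (f \<star> g)"
    and UnitO_Obj: "UnitO C \<in> Obj C"
    and Assoc_Homs: "\<lbrakk>X \<in> Obj C; Y \<in> Obj C; Z \<in> Obj C\<rbrakk>
      \<Longrightarrow> Assoc C X Y Z \<in> Homs C ((X \<boxtimes> Y) \<boxtimes> Z) (X \<boxtimes> (Y \<boxtimes> Z))"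
    and Assoc_iso: "\<lbrakk>X \<in> Obj C; Y \<in> Obj C; Z \<in> Obj C\<rbrakk> \<Longrightarrow> iso_arrow C (Assoc C X Y Z)"
    and Assoc_natural: "\<lbrakk>f \<in> Homs C X X'; g \<in> Homs C Y Y'; h \<in> Homs C Z Z'\<rbrakk>
      \<Longrightarrow> Assoc C X' Y' Z' \<bullet> ((f \<star> g) \<star> h) = (f \<star> (g \<star> h)) \<bullet> Assoc C X Y Z"
    and LUnit_Homs: "X \<in> Obj C \<Longrightarrow> LUnit C X \<in> Homs C (UnitO C \<boxtimes> X) X"
    and LUnit_iso: "X \<in> Obj C \<Longrightarrow> iso_arrow C (LUnit C X)"
    and LUnit_natural: "f \<in> Homs C X Y
      \<Longrightarrow> LUnit C Y \<bullet> (Idt C (UnitO C) \<star> f) = f \<bullet> LUnit C X"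
    and RUnit_Homs: "X \<in> Obj C \<Longrightarrow> RUnit C X \<in> Homs C (X \<boxtimes> UnitO C) X"
    and RUnit_iso: "X \<in> Obj C \<Longrightarrow> iso_arrow C (RUnit C X)"
    and RUnit_natural: "f \<in> Homs C X Y
      \<Longrightarrow> RUnit C Y \<bullet> (f \<star> Idt C (UnitO C)) = f \<bullet> RUnit C X"
    and pentagon: "\<lbrakk>W \<in> Obj C; X \<in> Obj C; Y \<in> Obj C; Z \<in> Obj C\<rbrakk>
      \<Longrightarrow> Assoc C W X (Y \<boxtimes> Z) \<bullet> Assoc C (W \<boxtimes> X) Y Z
        = (Idt C W \<star> Assoc C X Y Z) \<bullet> Assoc C W (X \<boxtimes> Y) Z \<bullet> (Assoc C W X Y \<star> Idt C Z)"
    and triangle: "\<lbrakk>X \<in> Obj C; Y \<in> Obj C\<rbrakk>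
      \<Longrightarrow> (Idt C X \<star> LUnit C Y) \<bullet> Assoc C X (UnitO C) Y = RUnit C X \<star> Idt C Y"

locale braided_monoidal_category = monoidal_category C for C (structure) +
  assumes Braid_Homs: "\<lbrakk>X \<in> Obj C; Y \<in> Obj C\<rbrakk> \<Longrightarrow> Braid C X Y \<in> Homs C (X \<boxtimes> Y) (Y \<boxtimes> X)"
    and Braid_iso: "\<lbrakk>X \<in> Obj C; Y \<in> Obj C\<rbrakk> \<Longrightarrow> iso_arrow C (Braid C X Y)"
    and Braid_natural: "\<lbrakk>f \<in> Homs C X X'; g \<in> Homs C Y Y'\<rbrakk>
      \<Longrightarrow> Braid C X' Y' \<bullet> (f \<star> g) = (g \<star> f) \<bullet> Braid C X Y"
    and hexagon1: "\<lbrakk>X \<in> Obj C; Y \<in> Obj C; Z \<in> Obj C\<rbrakk>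
      \<Longrightarrow> Assoc C Y Z X \<bullet> Braid C X (Y \<boxtimes> Z) \<bullet> Assoc C X Y Z
        = (Idt C Y \<star> Braid C X Z) \<bullet> Assoc C Y X Z \<bullet> (Braid C X Y \<star> Idt C Z)"
    and hexagon2: "\<lbrakk>X \<in> Obj C; Y \<in> Obj C; Z \<in> Obj C\<rbrakk>
      \<Longrightarrow> inv_arrow C (Assoc C Z X Y) \<bullet> Braid C (X \<boxtimes> Y) Z \<bullet> inv_arrow C (Assoc C X Y Z)
        = (Braid C X Z \<star> Idt C Y) \<bullet> inv_arrow C (Assoc C X Z Y) \<bullet> (Idt C X \<star> Braid C Y Z)"

section \<open>Modules over a noncommutative ring, algebras, dual bases\<close>

text \<open>The library's \<^locale>\<open>Module.module\<close> requires a commutative ring of scalars and its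
  \<^locale>\<open>algebra\<close> a commutative algebra. As in the library, modules are carried by the record type
  \<^type>\<open>module_ext\<close>, whose ring multiplication and one play no role.\<close>

locale left_module = R?: ring R + M?: abelian_group M for R (structure) and M (structure) +
  assumes smult_closed: "\<lbrakk>r \<in> carrier R; x \<in> carrier M\<rbrakk> \<Longrightarrow> r \<odot>\<^bsub>M\<^esub> x \<in> carrier M"
    and smult_l_distr: "\<lbrakk>r \<in> carrier R; s \<in> carrier R; x \<in> carrier M\<rbrakk>
      \<Longrightarrow> (r \<oplus>\<^bsub>R\<^esub> s) \<odot>\<^bsub>M\<^esub> x = r \<odot>\<^bsub>M\<^esub> x \<oplus>\<^bsub>M\<^esub> s \<odot>\<^bsub>M\<^esub> x"
    and smult_r_distr: "\<lbrakk>r \<in> carrier R; x \<in> carrier M; y \<in> carrier M\<rbrakk>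
      \<Longrightarrow> r \<odot>\<^bsub>M\<^esub> (x \<oplus>\<^bsub>M\<^esub> y) = r \<odot>\<^bsub>M\<^esub> x \<oplus>\<^bsub>M\<^esub> r \<odot>\<^bsub>M\<^esub> y"
    and smult_assoc: "\<lbrakk>r \<in> carrier R; s \<in> carrier R; x \<in> carrier M\<rbrakk>
      \<Longrightarrow> (r \<otimes>\<^bsub>R\<^esub> s) \<odot>\<^bsub>M\<^esub> x = r \<odot>\<^bsub>M\<^esub> (s \<odot>\<^bsub>M\<^esub> x)"
    and smult_one: "x \<in> carrier M \<Longrightarrow> \<one>\<^bsub>R\<^esub> \<odot>\<^bsub>M\<^esub> x = x"

locale k_algebra = K?: Module.module K A + A?: ring A for K (structure) and A (structure) +
  assumes smult_mult_left: "\<lbrakk>r \<in> carrier K; x \<in> carrier A; y \<in> carrier A\<rbrakk>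
      \<Longrightarrow> (r \<odot>\<^bsub>A\<^esub> x) \<otimes>\<^bsub>A\<^esub> y = r \<odot>\<^bsub>A\<^esub> (x \<otimes>\<^bsub>A\<^esub> y)"
    and smult_mult_right: "\<lbrakk>r \<in> carrier K; x \<in> carrier A; y \<in> carrier A\<rbrakk>
      \<Longrightarrow> x \<otimes>\<^bsub>A\<^esub> (r \<odot>\<^bsub>A\<^esub> y) = r \<odot>\<^bsub>A\<^esub> (x \<otimes>\<^bsub>A\<^esub> y)"

text \<open>Linear maps are functions on the carrier, extended by \<^const>\<open>undefined\<close> outside it so that
  equality of maps is equality of HOL functions.\<close>

definition mod_homs ::
  "('r, 'x) ring_scheme \<Rightarrow> ('r, 'm, 'y) module_scheme \<Rightarrow> ('r, 'n, 'z) module_scheme \<Rightarrow> ('m \<Rightarrow> 'n) set"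
  where "mod_homs R M N = {h \<in> extensional (carrier M) \<inter> hom (add_monoid M) (add_monoid N).
    \<forall>r \<in> carrier R. \<forall>x \<in> carrier M. h (r \<odot>\<^bsub>M\<^esub> x) = r \<odot>\<^bsub>N\<^esub> h x}"

definition regular_module :: "('r, 'x) ring_scheme \<Rightarrow> ('r, 'r) module"
  where "regular_module R = \<lparr>carrier = carrier R, monoid.mult = monoid.mult R, monoid.one = \<one>\<^bsub>R\<^esub>,
    ring.zero = \<zero>\<^bsub>R\<^esub>, add = add R, smult = monoid.mult R\<rparr>"

definition End_ring :: "('k, 'x) ring_scheme \<Rightarrow> ('k, 'u, 'y) module_scheme \<Rightarrow> ('u \<Rightarrow> 'u) ring"
  where "End_ring K A = \<lparr>carrier = mod_homs K A A,
    monoid.mult = (\<lambda>f g. compose (carrier A) f g), monoid.one = (\<lambda>x\<in>carrier A. x),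
    ring.zero = (\<lambda>x\<in>carrier A. \<zero>\<^bsub>A\<^esub>), add = (\<lambda>f g. \<lambda>x\<in>carrier A. f x \<oplus>\<^bsub>A\<^esub> g x)\<rparr>"

text \<open>The element \<open>\<Sum>\<^sub>i as i \<otimes> a i\<close> is given by the finite families \<open>as\<close> in the dual and \<open>a\<close> in \<open>A\<close>.
  By the dual basis lemma, one exists if and only if \<open>A\<close> is finitely generated projective over \<open>K\<close>.\<close>

definition finite_dual_basis ::
  "('k, 'x) ring_scheme \<Rightarrow> ('k, 'u, 'y) module_scheme \<Rightarrow> 'i set \<Rightarrow> ('i \<Rightarrow> 'u \<Rightarrow> 'k) \<Rightarrow> ('i \<Rightarrow> 'u) \<Rightarrow> bool"
  where "finite_dual_basis K A I as a \<longleftrightarrow> finite I \<and>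
    as \<in> I \<rightarrow> mod_homs K A (regular_module K) \<and> a \<in> I \<rightarrow> carrier A \<and>
    (\<forall>x \<in> carrier A. (\<Oplus>\<^bsub>A\<^esub>i\<in>I. as i x \<odot>\<^bsub>A\<^esub> a i) = x)"

definition dual_one :: "('k, 'u, 'y) module_scheme \<Rightarrow> ('i \<Rightarrow> 'u \<Rightarrow> 'k) \<Rightarrow> 'i \<Rightarrow> 'u \<Rightarrow> 'u"
  where "dual_one A as i = (\<lambda>x\<in>carrier A. as i x \<odot>\<^bsub>A\<^esub> \<one>\<^bsub>A\<^esub>)"

definition pre_left :: "('k, 'u, 'y) module_scheme \<Rightarrow> ('u \<Rightarrow> 'u) \<Rightarrow> 'u \<Rightarrow> 'u \<Rightarrow> 'u"
  where "pre_left A f b = (\<lambda>x\<in>carrier A. f (b \<otimes>\<^bsub>A\<^esub> x))"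

definition pre_right :: "('k, 'u, 'y) module_scheme \<Rightarrow> ('u \<Rightarrow> 'u) \<Rightarrow> 'u \<Rightarrow> 'u \<Rightarrow> 'u"
  where "pre_right A f b = (\<lambda>x\<in>carrier A. f (x \<otimes>\<^bsub>A\<^esub> b))"

section \<open>The underlying bimodule and the tensor product over A\<close>

text \<open>The value of \<open>F\<close> at the pure tensor of \<open>b\<close> and \<open>c\<close>.\<close>

definition F_pure :: "('k, 'u, 'y) module_scheme \<Rightarrow> 'u \<Rightarrow> 'u \<Rightarrow> 'u \<Rightarrow> 'u"
  where "F_pure A b c = (\<lambda>x\<in>carrier A. b \<otimes>\<^bsub>A\<^esub> x \<otimes>\<^bsub>A\<^esub> c)"

definition lact :: "('k, 'u, 'y) module_scheme \<Rightarrow> ('u \<Rightarrow> 'u, 'v) module \<Rightarrow> 'u \<Rightarrow> 'v \<Rightarrow> 'v"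
  where "lact A V b v = F_pure A b \<one>\<^bsub>A\<^esub> \<odot>\<^bsub>V\<^esub> v"

definition ract :: "('k, 'u, 'y) module_scheme \<Rightarrow> ('u \<Rightarrow> 'u, 'v) module \<Rightarrow> 'v \<Rightarrow> 'u \<Rightarrow> 'v"
  where "ract A V v b = F_pure A \<one>\<^bsub>A\<^esub> b \<odot>\<^bsub>V\<^esub> v"

text \<open>Bimodules over a \<open>K\<close>-algebra are \<open>K\<close>-central: they are the modules over the enveloping algebra.\<close>

locale bimodule = A?: k_algebra K A + M?: abelian_group M
  for K (structure) and A (structure) and M (structure) +
  fixes l :: "'a \<Rightarrow> 'm \<Rightarrow> 'm" and r :: "'m \<Rightarrow> 'a \<Rightarrow> 'm"
  constrains A :: "('k, 'a, 'y) module_scheme" and M :: "('m, 'z) ring_scheme"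
  assumes l_closed: "\<lbrakk>b \<in> carrier A; v \<in> carrier M\<rbrakk> \<Longrightarrow> l b v \<in> carrier M"
    and r_closed: "\<lbrakk>b \<in> carrier A; v \<in> carrier M\<rbrakk> \<Longrightarrow> r v b \<in> carrier M"
    and l_add: "\<lbrakk>b \<in> carrier A; v \<in> carrier M; w \<in> carrier M\<rbrakk>
      \<Longrightarrow> l b (v \<oplus>\<^bsub>M\<^esub> w) = l b v \<oplus>\<^bsub>M\<^esub> l b w"
    and r_add: "\<lbrakk>b \<in> carrier A; v \<in> carrier M; w \<in> carrier M\<rbrakk>
      \<Longrightarrow> r (v \<oplus>\<^bsub>M\<^esub> w) b = r v b \<oplus>\<^bsub>M\<^esub> r w b"
    and add_l: "\<lbrakk>b \<in> carrier A; c \<in> carrier A; v \<in> carrier M\<rbrakk>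
      \<Longrightarrow> l (b \<oplus>\<^bsub>A\<^esub> c) v = l b v \<oplus>\<^bsub>M\<^esub> l c v"
    and add_r: "\<lbrakk>b \<in> carrier A; c \<in> carrier A; v \<in> carrier M\<rbrakk>
      \<Longrightarrow> r v (b \<oplus>\<^bsub>A\<^esub> c) = r v b \<oplus>\<^bsub>M\<^esub> r v c"
    and mult_l: "\<lbrakk>b \<in> carrier A; c \<in> carrier A; v \<in> carrier M\<rbrakk>
      \<Longrightarrow> l (b \<otimes>\<^bsub>A\<^esub> c) v = l b (l c v)"
    and mult_r: "\<lbrakk>b \<in> carrier A; c \<in> carrier A; v \<in> carrier M\<rbrakk>
      \<Longrightarrow> r v (b \<otimes>\<^bsub>A\<^esub> c) = r (r v b) c"
    and one_l: "v \<in> carrier M \<Longrightarrow> l \<one>\<^bsub>A\<^esub> v = v"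
    and one_r: "v \<in> carrier M \<Longrightarrow> r v \<one>\<^bsub>A\<^esub> = v"
    and l_r: "\<lbrakk>b \<in> carrier A; c \<in> carrier A; v \<in> carrier M\<rbrakk> \<Longrightarrow> r (l b v) c = l b (r v c)"
    and central: "\<lbrakk>s \<in> carrier K; v \<in> carrier M\<rbrakk>
      \<Longrightarrow> l (s \<odot>\<^bsub>A\<^esub> \<one>\<^bsub>A\<^esub>) v = r v (s \<odot>\<^bsub>A\<^esub> \<one>\<^bsub>A\<^esub>)"

definition tens_rels ::
  "('k, 'u, 'y) module_scheme \<Rightarrow> ('u \<Rightarrow> 'u, 'v) module \<Rightarrow> ('u \<Rightarrow> 'u, 'w) module \<Rightarrow> ('v \<times> 'w \<Rightarrow>\<^sub>0 int) set"
  where "tens_rels A V W =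
    {frag_of (v \<oplus>\<^bsub>V\<^esub> v', w) - frag_of (v, w) - frag_of (v', w) | v v' w.
      v \<in> carrier V \<and> v' \<in> carrier V \<and> w \<in> carrier W} \<union>
    {frag_of (v, w \<oplus>\<^bsub>W\<^esub> w') - frag_of (v, w) - frag_of (v, w') | v w w'.
      v \<in> carrier V \<and> w \<in> carrier W \<and> w' \<in> carrier W} \<union>
    {frag_of (ract A V v b, w) - frag_of (v, lact A W b w) | v b w.
      v \<in> carrier V \<and> b \<in> carrier A \<and> w \<in> carrier W}"

definition tens_subgroup ::
  "('k, 'u, 'y) module_scheme \<Rightarrow> ('u \<Rightarrow> 'u, 'v) module \<Rightarrow> ('u \<Rightarrow> 'u, 'w) module \<Rightarrow> ('v \<times> 'w \<Rightarrow>\<^sub>0 int) set"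
  where "tens_subgroup A V W =
    generate (free_Abelian_group (carrier V \<times> carrier W)) (tens_rels A V W)"

definition tens_group ::
  "('k, 'u, 'y) module_scheme \<Rightarrow> ('u \<Rightarrow> 'u, 'v) module \<Rightarrow> ('u \<Rightarrow> 'u, 'w) module \<Rightarrow> ('v \<times> 'w \<Rightarrow>\<^sub>0 int) set monoid"
  where "tens_group A V W =
    free_Abelian_group (carrier V \<times> carrier W) Mod tens_subgroup A V W"

text \<open>For the modules to form one category closed under tensor products, their carriers are
  subsets of one type \<open>'u\<close>, an arbitrary infinite type that serves as the universe.
  The tensor product group of two such modules has no more elements than \<open>'u\<close>
  (lemma \<open>inj_on_tens_code\<close> below), so a copy of it with carrier in \<open>'u\<close> is obtained along a
  chosen injection.\<close>

definition tens_code ::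
  "('k, 'u, 'y) module_scheme \<Rightarrow> ('u \<Rightarrow> 'u, 'u) module \<Rightarrow> ('u \<Rightarrow> 'u, 'u) module
    \<Rightarrow> ('u \<times> 'u \<Rightarrow>\<^sub>0 int) set \<Rightarrow> 'u"
  where "tens_code A V W = (SOME \<phi>. inj_on \<phi> (carrier (tens_group A V W)))"

lemma inj_list_universe: "\<exists>c :: 'u::infinite list \<Rightarrow> 'u. inj c"
proof -
  have inf: "infinite (UNIV :: 'u set)" by (rule infinite_UNIV)
  have "|UNIV \<times> UNIV :: ('u \<times> 'u) set| \<le>o |UNIV :: 'u set|"
    using card_of_Times_same_infinite[OF inf] ordIso_iff_ordLeq by blast
  then obtain p :: "'u \<times> 'u \<Rightarrow> 'u" where p: "inj p"
    using card_of_ordLeq[of "UNIV \<times> UNIV :: ('u \<times> 'u) set" "UNIV :: 'u set"] by auto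
  obtain n :: "nat \<Rightarrow> 'u" where n: "inj n"
    using arb_countable_map[of "{}"] by auto
  \<comment> \<open>tag the empty list and the conses differently\<close>
  define c where "c = rec_list (p (n 0, n 0)) (\<lambda>x xs y. p (n 1, p (x, y)))"
  have c_simps: "c [] = p (n 0, n 0)" "\<And>x xs. c (x # xs) = p (n 1, p (x, c xs))"
    by (simp_all add: c_def)
  have n01: "n 0 \<noteq> n 1" using n by (auto dest: injD)
  have "c xs = c ys \<Longrightarrow> xs = ys" for xs ys
  proof (induction xs arbitrary: ys)
    case Nil
    then show ?case using n01 by (cases ys) (auto simp: c_simps dest!: injD[OF p])
  next
    case (Cons x xs)
    then show ?case using n01 by (cases ys) (auto simp: c_simps dest!: injD[OF p])
  qed
  then have "inj c" by (rule injI)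
  then show ?thesis by blast
qed

lemma inj_frag_universe: "\<exists>c :: ('u::infinite \<times> 'u \<Rightarrow>\<^sub>0 int) \<Rightarrow> 'u. inj c"
proof -
  obtain l :: "'u list \<Rightarrow> 'u" where l: "inj l" using inj_list_universe by blast
  obtain n :: "nat \<Rightarrow> 'u" where n: "inj n"
    using arb_countable_map[of "{}"] by auto
  define z where "z = (\<lambda>k :: int. n (to_nat k))"
  have z: "inj z" unfolding z_def by (intro injI) (auto dest!: injD[OF n])
  define e where "e = (\<lambda>(q :: ('u \<times> 'u) \<times> int). l [fst (fst q), snd (fst q), z (snd q)])"
  have e: "inj e" unfolding e_def
    by (intro injI) (auto dest!: injD[OF l] injD[OF z] simp: prod_eq_iff)
  define g where "g = (\<lambda>f :: 'u \<times> 'u \<Rightarrow>\<^sub>0 int. (\<lambda>x. (x, Poly_Mapping.lookup f x)) ` Poly_Mapping.keys f)"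
  have g: "inj g"
  proof (rule injI)
    fix f h assume gh: "g f = g h"
    have lk: "(x, k) \<in> g f' \<longleftrightarrow> k = Poly_Mapping.lookup f' x \<and> k \<noteq> 0" for x k f'
      by (auto simp: g_def in_keys_iff)
    have "Poly_Mapping.lookup f x = Poly_Mapping.lookup h x" for x
      using lk[of x "Poly_Mapping.lookup f x" f] lk[of x "Poly_Mapping.lookup f x" h]
        lk[of x "Poly_Mapping.lookup h x" f] lk[of x "Poly_Mapping.lookup h x" h] gh by metis
    then show "f = h" by (rule poly_mapping_eqI)
  qed
  have fin: "finite (g f)" for f by (simp add: g_def)
  define s where "s = (\<lambda>f. SOME xs. set xs = g f)"
  have s: "set (s f) = g f" for f
    unfolding s_def by (rule someI_ex) (use finite_list[OF fin] in blast)
  have "inj (\<lambda>f. l (map e (s f)))"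
  proof (rule injI)
    fix f h assume "l (map e (s f)) = l (map e (s h))"
    then have "s f = s h" using injD[OF l] inj_map_eq_map[OF e] by blast
    then have "g f = g h" using s by metis
    then show "f = h" by (rule injD[OF g])
  qed
  then show ?thesis by blast
qed

lemma inj_on_tens_code:
  fixes A :: "('k, 'u::infinite, 'y) module_scheme"
  shows "inj_on (tens_code A V W) (carrier (tens_group A V W))"
proof -
  obtain c :: "('u \<times> 'u \<Rightarrow>\<^sub>0 int) \<Rightarrow> 'u" where c: "inj c" using inj_frag_universe by blast
  let ?G = "free_Abelian_group (carrier V \<times> carrier W)"
  let ?Q = "carrier (tens_group A V W)"
  define s where "s = (\<lambda>X. SOME x. x \<in> carrier ?G \<and> X = r_coset ?G (tens_subgroup A V W) x)"
  have s: "X = r_coset ?G (tens_subgroup A V W) (s X)" if "X \<in> ?Q" for X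
  proof -
    have "\<exists>x. x \<in> carrier ?G \<and> X = r_coset ?G (tens_subgroup A V W) x"
      using that unfolding tens_group_def carrier_FactGroup by blast
    from someI_ex[OF this] show ?thesis unfolding s_def by blast
  qed
  have "inj_on (\<lambda>X. c (s X)) ?Q"
  proof (rule inj_onI)
    fix X Y assume X: "X \<in> ?Q" and Y: "Y \<in> ?Q" and "c (s X) = c (s Y)"
    then have "s X = s Y" using injD[OF c] by blast
    then show "X = Y" using s[OF X] s[OF Y] by simp
  qed
  then show ?thesis unfolding tens_code_def by (rule someI[of "\<lambda>\<phi>. inj_on \<phi> ?Q"])
qed

definition tens_ab ::
  "('k, 'u, 'y) module_scheme \<Rightarrow> ('u \<Rightarrow> 'u, 'u) module \<Rightarrow> ('u \<Rightarrow> 'u, 'u) module \<Rightarrow> 'u ring"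
  where "tens_ab A V W =
    (let Q = tens_group A V W; \<phi> = tens_code A V W; \<psi> = inv_into (carrier Q) \<phi> in
     \<lparr>carrier = \<phi> ` carrier Q, monoid.mult = undefined, monoid.one = undefined,
      ring.zero = \<phi> \<one>\<^bsub>Q\<^esub>, add = (\<lambda>x y. \<phi> (\<psi> x \<otimes>\<^bsub>Q\<^esub> \<psi> y))\<rparr>)"

definition ptens ::
  "('k, 'u, 'y) module_scheme \<Rightarrow> ('u \<Rightarrow> 'u, 'u) module \<Rightarrow> ('u \<Rightarrow> 'u, 'u) module \<Rightarrow> 'u \<Rightarrow> 'u \<Rightarrow> 'u"
  where "ptens A V W v w = tens_code A V W
    (r_coset (free_Abelian_group (carrier V \<times> carrier W)) (tens_subgroup A V W) (frag_of (v, w)))"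

text \<open>Here and below, a map out of a tensor product is defined as the unique additive, respectively
  linear, map with the prescribed values on pure tensors; that it exists is part of the
  assertions proved about it.\<close>

definition tens ::
  "('k, 'u, 'y) module_scheme \<Rightarrow> 'i set \<Rightarrow> ('i \<Rightarrow> 'u \<Rightarrow> 'k) \<Rightarrow> ('i \<Rightarrow> 'u)
    \<Rightarrow> ('u \<Rightarrow> 'u, 'u) module \<Rightarrow> ('u \<Rightarrow> 'u, 'u) module \<Rightarrow> ('u \<Rightarrow> 'u, 'u) module"
  where "tens A I as a V W =
    (let T = tens_ab A V W in
     \<lparr>carrier = carrier T, monoid.mult = undefined, monoid.one = undefined,
      ring.zero = \<zero>\<^bsub>T\<^esub>, add = add T,
      smult = (\<lambda>f. THE h. h \<in> extensional (carrier T) \<inter> hom (add_monoid T) (add_monoid T) \<and>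
        (\<forall>v \<in> carrier V. \<forall>w \<in> carrier W. h (ptens A V W v w) =
          (\<Oplus>\<^bsub>T\<^esub>i\<in>I. ptens A V W (dual_one A as i \<odot>\<^bsub>V\<^esub> v) (pre_left A f (a i) \<odot>\<^bsub>W\<^esub> w))))\<rparr>)"

definition unit_module :: "('k, 'u, 'y) module_scheme \<Rightarrow> ('u \<Rightarrow> 'u, 'u) module"
  where "unit_module A = \<lparr>carrier = carrier A, monoid.mult = monoid.mult A, monoid.one = \<one>\<^bsub>A\<^esub>,
    ring.zero = \<zero>\<^bsub>A\<^esub>, add = add A, smult = (\<lambda>f x. f x)\<rparr>"

section \<open>The category of left modules over the endomorphism ring\<close>

text \<open>An arrow is a linear map together with its source and target.\<close>

type_synonym 'u emod = "('u \<Rightarrow> 'u, 'u) module"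
type_synonym 'u earr = "'u emod \<times> ('u \<Rightarrow> 'u) \<times> 'u emod"

definition arr_fun :: "'u earr \<Rightarrow> 'u \<Rightarrow> 'u"
  where "arr_fun = (\<lambda>(V, h, W). h)"

definition tens_arr ::
  "('k, 'x) ring_scheme \<Rightarrow> ('k, 'u, 'y) module_scheme \<Rightarrow> 'i set \<Rightarrow> ('i \<Rightarrow> 'u \<Rightarrow> 'k) \<Rightarrow> ('i \<Rightarrow> 'u)
    \<Rightarrow> 'u earr \<Rightarrow> 'u earr \<Rightarrow> 'u earr"
  where "tens_arr K A I as a = (\<lambda>(V, g, V') (W, h, W').
    (tens A I as a V W,
     THE m. m \<in> mod_homs (End_ring K A) (tens A I as a V W) (tens A I as a V' W') \<and>
       (\<forall>v \<in> carrier V. \<forall>w \<in> carrier W. m (ptens A V W v w) = ptens A V' W' (g v) (h w)),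
     tens A I as a V' W'))"

definition assoc_arr ::
  "('k, 'x) ring_scheme \<Rightarrow> ('k, 'u, 'y) module_scheme \<Rightarrow> 'i set \<Rightarrow> ('i \<Rightarrow> 'u \<Rightarrow> 'k) \<Rightarrow> ('i \<Rightarrow> 'u)
    \<Rightarrow> 'u emod \<Rightarrow> 'u emod \<Rightarrow> 'u emod \<Rightarrow> 'u earr"
  where "assoc_arr K A I as a U V W =
    (let T = tens A I as a in
     (T (T U V) W,
      THE m. m \<in> mod_homs (End_ring K A) (T (T U V) W) (T U (T V W)) \<and>
        (\<forall>u \<in> carrier U. \<forall>v \<in> carrier V. \<forall>w \<in> carrier W.
          m (ptens A (T U V) W (ptens A U V u v) w) = ptens A U (T V W) u (ptens A V W v w)),
      T U (T V W)))"

definition lunit_arr ::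
  "('k, 'x) ring_scheme \<Rightarrow> ('k, 'u, 'y) module_scheme \<Rightarrow> 'i set \<Rightarrow> ('i \<Rightarrow> 'u \<Rightarrow> 'k) \<Rightarrow> ('i \<Rightarrow> 'u)
    \<Rightarrow> 'u emod \<Rightarrow> 'u earr"
  where "lunit_arr K A I as a V =
    (tens A I as a (unit_module A) V,
     THE m. m \<in> mod_homs (End_ring K A) (tens A I as a (unit_module A) V) V \<and>
       (\<forall>b \<in> carrier A. \<forall>v \<in> carrier V. m (ptens A (unit_module A) V b v) = lact A V b v),
     V)"

definition runit_arr ::
  "('k, 'x) ring_scheme \<Rightarrow> ('k, 'u, 'y) module_scheme \<Rightarrow> 'i set \<Rightarrow> ('i \<Rightarrow> 'u \<Rightarrow> 'k) \<Rightarrow> ('i \<Rightarrow> 'u)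
    \<Rightarrow> 'u emod \<Rightarrow> 'u earr"
  where "runit_arr K A I as a V =
    (tens A I as a V (unit_module A),
     THE m. m \<in> mod_homs (End_ring K A) (tens A I as a V (unit_module A)) V \<and>
       (\<forall>v \<in> carrier V. \<forall>b \<in> carrier A. m (ptens A V (unit_module A) v b) = ract A V v b),
     V)"

definition braid_arr ::
  "('k, 'x) ring_scheme \<Rightarrow> ('k, 'u, 'y) module_scheme \<Rightarrow> 'i set \<Rightarrow> ('i \<Rightarrow> 'u \<Rightarrow> 'k) \<Rightarrow> ('i \<Rightarrow> 'u)
    \<Rightarrow> 'u emod \<Rightarrow> 'u emod \<Rightarrow> 'u earr"
  where "braid_arr K A I as a V W =
    (let T = tens A I as a in
     (T V W,
      THE m. m \<in> mod_homs (End_ring K A) (T V W) (T W V) \<and>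
        (\<forall>v \<in> carrier V. \<forall>w \<in> carrier W. m (ptens A V W v w) =
          (\<Oplus>\<^bsub>T W V\<^esub>i\<in>I. ptens A W V (dual_one A as i \<odot>\<^bsub>W\<^esub> w) (ract A V v (a i)))),
      T W V))"

definition EndMod ::
  "('k, 'x) ring_scheme \<Rightarrow> ('k, 'u, 'y) module_scheme \<Rightarrow> 'i set \<Rightarrow> ('i \<Rightarrow> 'u \<Rightarrow> 'k) \<Rightarrow> ('i \<Rightarrow> 'u)
    \<Rightarrow> ('u emod, 'u earr) braided_data"
  where "EndMod K A I as a = \<lparr>
    Obj = {V. left_module (End_ring K A) V},
    Arr = {(V, h, W). left_module (End_ring K A) V \<and> left_module (End_ring K A) W \<and>
            h \<in> mod_homs (End_ring K A) V W},
    Src = (\<lambda>(V, h, W). V),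
    Tgt = (\<lambda>(V, h, W). W),
    Idt = (\<lambda>V. (V, \<lambda>x\<in>carrier V. x, V)),
    Cmp = (\<lambda>(V', g, W) (U, f, V). (U, compose (carrier U) g f, W)),
    TensO = tens A I as a,
    TensA = tens_arr K A I as a,
    UnitO = unit_module A,
    Assoc = assoc_arr K A I as a,
    LUnit = lunit_arr K A I as a,
    RUnit = runit_arr K A I as a,
    Braid = braid_arr K A I as a\<rparr>"

end

theory Submission
  imports Defs
begin

text \<open>Write \<open>E = End(A)\<close> and call \<open>v\<close> in an \<open>E\<close>-module \<open>V\<close> invariant if \<open>f \<cdot> v = f(1) v\<close> for all
  \<open>f\<close>. Every \<open>f\<^sub>i \<cdot> v\<close> is invariant and \<open>v = \<Sum>\<^sub>i a\<^sub>i (f\<^sub>i \<cdot> v)\<close>, so \<open>V\<close> is additively spanned by the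
  elements \<open>b v\<close> with \<open>b \<in> A\<close> and \<open>v\<close> invariant, on which \<open>f \<cdot> (b v) = f(b) v\<close> and \<open>b v = v b\<close>.
  For invariant \<open>v\<close> the action formula becomes \<open>f \<cdot> (v \<otimes> w) = v \<otimes> f \<cdot> w\<close>, so that \<open>v \<otimes> w\<close> is
  invariant if both \<open>v\<close> and \<open>w\<close> are, and the braiding becomes \<open>v \<otimes> w \<mapsto> w \<otimes> v\<close>. An \<open>E\<close>-linear map is
  determined by its values on invariant pure tensors, and there all coherence laws are obvious.\<close>

section \<open>The endomorphism ring\<close>

text \<open>Two facts lie behind the spanning statement. Since \<open>f_i\<close> has values in the
  multiples of 1, \<open>f\<close> after \<open>f_i\<close> is \<open>f_i\<close> followed by left
  multiplication with \<open>f(1)\<close>; and the dual basis identity says that the sum of the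
  \<open>a_i f_i\<close> is the identity of \<open>A\<close>. Evaluation at 1 identifies the
  invariants of \<open>V\<close> with the \<open>E\<close>-linear maps from \<open>A\<close> to
  \<open>V\<close>, so the argument is Morita theory in elementary form.

  The obstacle is that every map out of a tensor product, the action of \<open>f\<close> included,
  is a definite description prescribed on all pure tensors. Invariants do not define it directly:
  they span only after multiplication with elements of \<open>A\<close>, and such expressions are
  not unique. Hence each formula must be balanced on arbitrary elements, and invariants serve to
  verify the balancing identity. This is why there are two comparison principles: one for additive
  maps, which keeps coefficients from \<open>A\<close> and works before the tensor product is known
  to be a module, and one for \<open>E\<close>-linear maps, where the coefficients drop out.\<close>

definition additive_map :: "('a, 'm) ring_scheme \<Rightarrow> ('b, 'n) ring_scheme \<Rightarrow> ('a \<Rightarrow> 'b) \<Rightarrow> bool"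
  where "additive_map M N m \<longleftrightarrow> m \<in> carrier M \<rightarrow> carrier N \<and>
    (\<forall>x \<in> carrier M. \<forall>y \<in> carrier M. m (x \<oplus>\<^bsub>M\<^esub> y) = m x \<oplus>\<^bsub>N\<^esub> m y)"

lemma additiveI:
  assumes "\<And>x. x \<in> carrier M \<Longrightarrow> m x \<in> carrier N"
    and "\<And>x y. \<lbrakk>x \<in> carrier M; y \<in> carrier M\<rbrakk> \<Longrightarrow> m (x \<oplus>\<^bsub>M\<^esub> y) = m x \<oplus>\<^bsub>N\<^esub> m y"
  shows "additive_map M N m"
  using assms by (simp add: additive_map_def)

lemma additive_closed: "\<lbrakk>additive_map M N m; x \<in> carrier M\<rbrakk> \<Longrightarrow> m x \<in> carrier N"
  by (auto simp: additive_map_def)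

lemma additive_add:
  "\<lbrakk>additive_map M N m; x \<in> carrier M; y \<in> carrier M\<rbrakk> \<Longrightarrow> m (x \<oplus>\<^bsub>M\<^esub> y) = m x \<oplus>\<^bsub>N\<^esub> m y"
  by (auto simp: additive_map_def)

lemma hom_add_monoid_iff: "m \<in> hom (add_monoid M) (add_monoid N) \<longleftrightarrow> additive_map M N m"
  by (auto simp: additive_map_def hom_def)

lemma additive_zero:
  assumes "abelian_group M" "abelian_group N" "additive_map M N m"
  shows "m \<zero>\<^bsub>M\<^esub> = \<zero>\<^bsub>N\<^esub>"
proof -
  interpret M: abelian_group M by fact
  interpret N: abelian_group N by fact
  have "m \<zero>\<^bsub>M\<^esub> \<oplus>\<^bsub>N\<^esub> m \<zero>\<^bsub>M\<^esub> = m \<zero>\<^bsub>M\<^esub>"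
    using additive_add[OF assms(3), of "\<zero>\<^bsub>M\<^esub>" "\<zero>\<^bsub>M\<^esub>"] by simp
  then show ?thesis using additive_closed[OF assms(3), of "\<zero>\<^bsub>M\<^esub>"]
    by (simp add: N.add.l_cancel_one)
qed

lemma additive_finsum:
  assumes "abelian_group M" "abelian_group N" "additive_map M N m" "finite I" "g \<in> I \<rightarrow> carrier M"
  shows "m (\<Oplus>\<^bsub>M\<^esub>i\<in>I. g i) = (\<Oplus>\<^bsub>N\<^esub>i\<in>I. m (g i))"
proof -
  interpret M: abelian_group M by fact
  interpret N: abelian_group N by fact
  from assms(4,5) show ?thesis
  proof (induction I)
    case empty
    then show ?case by (simp add: additive_zero[OF assms(1-3)])
  next
    case (insert i I)
    then have "g i \<in> carrier M" "g \<in> I \<rightarrow> carrier M" by auto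
    moreover have "(\<lambda>i. m (g i)) \<in> I \<rightarrow> carrier N" "m (g i) \<in> carrier N"
      using calculation additive_closed[OF assms(3)] by auto
    ultimately show ?case using insert
      by (simp add: additive_add[OF assms(3)])
  qed
qed

lemma additive_comp:
  "\<lbrakk>additive_map M N m; additive_map N P n\<rbrakk> \<Longrightarrow> additive_map M P (\<lambda>x. n (m x))"
  by (auto simp: additive_map_def Pi_iff)

lemma mod_homs_iff:
  "h \<in> mod_homs R M N \<longleftrightarrow> h \<in> extensional (carrier M) \<and> additive_map M N h \<and>
    (\<forall>r \<in> carrier R. \<forall>x \<in> carrier M. h (r \<odot>\<^bsub>M\<^esub> x) = r \<odot>\<^bsub>N\<^esub> h x)"
  by (auto simp: mod_homs_def hom_add_monoid_iff)

text \<open>The elements of \<open>A\<close> have the universe type \<open>'u\<close> of all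
  modules, so that \<open>A\<close> itself can be the unit object.\<close>

locale dual_basis_algebra = k_algebra K A
  for K :: "('k, 'x) ring_scheme" (structure) and A :: "('k, 'u::infinite, 'y) module_scheme" (structure) +
  fixes I :: "'i set" and as :: "'i \<Rightarrow> 'u \<Rightarrow> 'k" and a :: "'i \<Rightarrow> 'u"
  assumes fdb: "finite_dual_basis K A I as a"
begin

abbreviation E where "E \<equiv> End_ring K A"

lemma finite_I [simp]: "finite I"
  and a_in_A [simp]: "i \<in> I \<Longrightarrow> a i \<in> carrier A"
  and as_in_dual: "i \<in> I \<Longrightarrow> as i \<in> mod_homs K A (regular_module K)"
  and dual_basis: "x \<in> carrier A \<Longrightarrow> (\<Oplus>\<^bsub>A\<^esub>i\<in>I. as i x \<odot>\<^bsub>A\<^esub> a i) = x"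
  using fdb by (auto simp: finite_dual_basis_def)

lemma as_closed [simp]: "\<lbrakk>i \<in> I; x \<in> carrier A\<rbrakk> \<Longrightarrow> as i x \<in> carrier K"
  and as_add: "\<lbrakk>i \<in> I; x \<in> carrier A; y \<in> carrier A\<rbrakk> \<Longrightarrow> as i (x \<oplus>\<^bsub>A\<^esub> y) = as i x \<oplus>\<^bsub>K\<^esub> as i y"
  and as_smult: "\<lbrakk>i \<in> I; s \<in> carrier K; x \<in> carrier A\<rbrakk> \<Longrightarrow> as i (s \<odot>\<^bsub>A\<^esub> x) = s \<otimes>\<^bsub>K\<^esub> as i x"
  using as_in_dual[of i] by (auto simp: mod_homs_iff additive_map_def regular_module_def)

lemma E_eqI: "\<lbrakk>f \<in> carrier E; g \<in> carrier E; \<And>x. x \<in> carrier A \<Longrightarrow> f x = g x\<rbrakk> \<Longrightarrow> f = g"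
  by (auto simp: End_ring_def mod_homs_def intro: extensionalityI)

lemma E_I:
  assumes "f \<in> extensional (carrier A)" "\<And>x. x \<in> carrier A \<Longrightarrow> f x \<in> carrier A"
    and "\<And>x y. \<lbrakk>x \<in> carrier A; y \<in> carrier A\<rbrakk> \<Longrightarrow> f (x \<oplus>\<^bsub>A\<^esub> y) = f x \<oplus>\<^bsub>A\<^esub> f y"
    and "\<And>s x. \<lbrakk>s \<in> carrier K; x \<in> carrier A\<rbrakk> \<Longrightarrow> f (s \<odot>\<^bsub>A\<^esub> x) = s \<odot>\<^bsub>A\<^esub> f x"
  shows "f \<in> carrier E"
  using assms by (simp add: End_ring_def mod_homs_iff additive_map_def)

lemma E_closed [simp]: "\<lbrakk>f \<in> carrier E; x \<in> carrier A\<rbrakk> \<Longrightarrow> f x \<in> carrier A"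
  and E_add: "\<lbrakk>f \<in> carrier E; x \<in> carrier A; y \<in> carrier A\<rbrakk> \<Longrightarrow> f (x \<oplus>\<^bsub>A\<^esub> y) = f x \<oplus>\<^bsub>A\<^esub> f y"
  and E_smult: "\<lbrakk>f \<in> carrier E; s \<in> carrier K; x \<in> carrier A\<rbrakk> \<Longrightarrow> f (s \<odot>\<^bsub>A\<^esub> x) = s \<odot>\<^bsub>A\<^esub> f x"
  by (auto simp: End_ring_def mod_homs_iff additive_map_def)

lemma End_ring_sel:
  "f \<otimes>\<^bsub>E\<^esub> g = compose (carrier A) f g" "\<one>\<^bsub>E\<^esub> = (\<lambda>x\<in>carrier A. x)"
  "\<zero>\<^bsub>E\<^esub> = (\<lambda>x\<in>carrier A. \<zero>\<^bsub>A\<^esub>)" "f \<oplus>\<^bsub>E\<^esub> g = (\<lambda>x\<in>carrier A. f x \<oplus>\<^bsub>A\<^esub> g x)"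
  by (simp_all add: End_ring_def)

lemma E_mult_eval [simp]: "x \<in> carrier A \<Longrightarrow> (f \<otimes>\<^bsub>E\<^esub> g) x = f (g x)"
  and E_one_eval [simp]: "x \<in> carrier A \<Longrightarrow> \<one>\<^bsub>E\<^esub> x = x"
  and E_zero_eval [simp]: "x \<in> carrier A \<Longrightarrow> \<zero>\<^bsub>E\<^esub> x = \<zero>\<^bsub>A\<^esub>"
  and E_add_eval [simp]: "x \<in> carrier A \<Longrightarrow> (f \<oplus>\<^bsub>E\<^esub> g) x = f x \<oplus>\<^bsub>A\<^esub> g x"
  by (simp_all add: End_ring_sel compose_def)

lemma E_mult_closed [simp]: "\<lbrakk>f \<in> carrier E; g \<in> carrier E\<rbrakk> \<Longrightarrow> f \<otimes>\<^bsub>E\<^esub> g \<in> carrier E"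
  by (rule E_I) (simp_all add: E_add E_smult, simp add: End_ring_sel)

lemma E_one_closed [simp]: "\<one>\<^bsub>E\<^esub> \<in> carrier E"
  by (rule E_I) (simp_all add: End_ring_sel)

lemma E_zero_closed [simp]: "\<zero>\<^bsub>E\<^esub> \<in> carrier E"
  by (rule E_I) (simp_all add: End_ring_sel)

lemma E_add_closed [simp]: "\<lbrakk>f \<in> carrier E; g \<in> carrier E\<rbrakk> \<Longrightarrow> f \<oplus>\<^bsub>E\<^esub> g \<in> carrier E"
  by (rule E_I) (simp_all add: E_add E_smult M.a_ac smult_r_distr, simp add: End_ring_sel)

lemma ring_E: "ring E"
proof (rule ringI)
  show "abelian_group E"
  proof (rule abelian_groupI)
    fix f assume f: "f \<in> carrier E"
    let ?g = "\<lambda>x\<in>carrier A. \<ominus>\<^bsub>A\<^esub> f x"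
    have "?g \<in> carrier E"
      by (rule E_I) (use f in \<open>simp_all add: E_add E_smult M.minus_add smult_r_minus\<close>)
    moreover have "?g \<oplus>\<^bsub>E\<^esub> f = \<zero>\<^bsub>E\<^esub>"
      by (rule E_eqI) (use f calculation in \<open>simp_all add: M.l_neg\<close>)
    ultimately show "\<exists>g \<in> carrier E. g \<oplus>\<^bsub>E\<^esub> f = \<zero>\<^bsub>E\<^esub>" by blast
  qed (simp_all, (rule E_eqI; simp add: M.a_ac)+)
  show "Group.monoid E"
    by (rule monoidI) (simp_all, (rule E_eqI; simp)+)
qed (rule E_eqI; simp add: E_add)+

text \<open>Evaluation at \<open>x\<close> is an additive map from \<open>E\<close> to
  \<open>A\<close>. This links the dual basis identity in \<open>A\<close> to an identity between
  elements of \<open>E\<close>.\<close>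

lemma E_finsum_eval:
  assumes "finite J" "g \<in> J \<rightarrow> carrier E" "x \<in> carrier A"
  shows "(\<Oplus>\<^bsub>E\<^esub>i\<in>J. g i) x = (\<Oplus>\<^bsub>A\<^esub>i\<in>J. g i x)"
proof -
  interpret ER: ring E by (rule ring_E)
  have "additive_map E A (\<lambda>f. f x)" using assms(3) by (intro additiveI) simp_all
  from additive_finsum[OF ER.abelian_group_axioms M.abelian_group_axioms this assms(1,2)]
  show ?thesis by simp
qed

lemma F_pure_closed [simp]: "\<lbrakk>b \<in> carrier A; c \<in> carrier A\<rbrakk> \<Longrightarrow> F_pure A b c \<in> carrier E"
  by (rule E_I)
    (simp_all add: F_pure_def A.l_distr A.r_distr smult_mult_left smult_mult_right)

lemma F_pure_eval [simp]: "x \<in> carrier A \<Longrightarrow> F_pure A b c x = b \<otimes>\<^bsub>A\<^esub> x \<otimes>\<^bsub>A\<^esub> c"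
  by (simp add: F_pure_def)

abbreviation fd where "fd \<equiv> dual_one A as"

lemma dual_one_closed [simp]: "i \<in> I \<Longrightarrow> fd i \<in> carrier E"
  by (rule E_I) (simp_all add: dual_one_def as_add as_smult smult_l_distr smult_assoc1)

lemma dual_one_eval [simp]: "x \<in> carrier A \<Longrightarrow> fd i x = as i x \<odot>\<^bsub>A\<^esub> \<one>\<^bsub>A\<^esub>"
  by (simp add: dual_one_def)

text \<open>Once \<open>f(b-)\<close> and \<open>f(-b)\<close> are products in \<open>E\<close>,
  associativity of the module turns the factors of the action formulas into \<open>f\<close> applied
  to \<open>b w\<close> and to \<open>v b\<close>.\<close>

lemma pre_left_eq: "\<lbrakk>f \<in> carrier E; b \<in> carrier A\<rbrakk> \<Longrightarrow> pre_left A f b = f \<otimes>\<^bsub>E\<^esub> F_pure A b \<one>\<^bsub>A\<^esub>"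
  by (auto simp: pre_left_def End_ring_sel compose_def)

lemma pre_right_eq: "\<lbrakk>f \<in> carrier E; b \<in> carrier A\<rbrakk> \<Longrightarrow> pre_right A f b = f \<otimes>\<^bsub>E\<^esub> F_pure A \<one>\<^bsub>A\<^esub> b"
  by (auto simp: pre_right_def End_ring_sel compose_def)

text \<open>The second arguments multiply in reversed order because \<open>F\<close> is
  multiplicative on \<open>A\<close> tensored with its opposite algebra; this makes
  \<open>ract\<close> a right action.\<close>

lemma F_pure_mult:
  "\<lbrakk>b \<in> carrier A; c \<in> carrier A; b' \<in> carrier A; c' \<in> carrier A\<rbrakk>
    \<Longrightarrow> F_pure A b c \<otimes>\<^bsub>E\<^esub> F_pure A b' c' = F_pure A (b \<otimes>\<^bsub>A\<^esub> b') (c' \<otimes>\<^bsub>A\<^esub> c)"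
  by (rule E_eqI) (simp_all add: A.m_assoc)

lemma F_pure_add_left:
  "\<lbrakk>b \<in> carrier A; c \<in> carrier A; b' \<in> carrier A\<rbrakk>
    \<Longrightarrow> F_pure A (b \<oplus>\<^bsub>A\<^esub> b') c = F_pure A b c \<oplus>\<^bsub>E\<^esub> F_pure A b' c"
  by (rule E_eqI) (simp_all add: A.l_distr)

lemma F_pure_add_right:
  "\<lbrakk>b \<in> carrier A; c \<in> carrier A; c' \<in> carrier A\<rbrakk>
    \<Longrightarrow> F_pure A b (c \<oplus>\<^bsub>A\<^esub> c') = F_pure A b c \<oplus>\<^bsub>E\<^esub> F_pure A b c'"
  by (rule E_eqI) (simp_all add: A.r_distr)

lemma F_pure_one: "F_pure A \<one>\<^bsub>A\<^esub> \<one>\<^bsub>A\<^esub> = \<one>\<^bsub>E\<^esub>"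
  by (rule E_eqI) simp_all

text \<open>Multiplication in \<open>A\<close> is \<open>K\<close>-bilinear, so both sides are
  multiplication by \<open>s\<close>. This yields the centrality clause of
  \<open>bimodule\<close>.\<close>

lemma F_pure_scalar:
  "s \<in> carrier K \<Longrightarrow> F_pure A (s \<odot>\<^bsub>A\<^esub> \<one>\<^bsub>A\<^esub>) \<one>\<^bsub>A\<^esub> = F_pure A \<one>\<^bsub>A\<^esub> (s \<odot>\<^bsub>A\<^esub> \<one>\<^bsub>A\<^esub>)"
  by (rule E_eqI) (simp_all add: smult_mult_left smult_mult_right)

text \<open>\<open>fd i x\<close> is a scalar multiple of 1 and \<open>f\<close> is
  \<open>K\<close>-linear, so \<open>f\<close> can only multiply it by \<open>f(1)\<close>. This is
  the source of invariant elements.\<close>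

lemma mult_dual_one:
  "\<lbrakk>f \<in> carrier E; i \<in> I\<rbrakk> \<Longrightarrow> f \<otimes>\<^bsub>E\<^esub> fd i = F_pure A (f \<one>\<^bsub>A\<^esub>) \<one>\<^bsub>A\<^esub> \<otimes>\<^bsub>E\<^esub> fd i"
  by (rule E_eqI) (simp_all add: E_smult smult_mult_right)

text \<open>The dual basis property read as an equation in \<open>E\<close>, since
  \<open>a i\<close> times \<open>fd i x\<close> is the multiple of \<open>a i\<close> by
  \<open>as i x\<close>. In this form it can be applied to an element of any module.\<close>

lemma dual_one_sum: "(\<Oplus>\<^bsub>E\<^esub>i\<in>I. F_pure A (a i) \<one>\<^bsub>A\<^esub> \<otimes>\<^bsub>E\<^esub> fd i) = \<one>\<^bsub>E\<^esub>"
proof (rule E_eqI)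
  interpret ER: ring E by (rule ring_E)
  show "(\<Oplus>\<^bsub>E\<^esub>i\<in>I. F_pure A (a i) \<one>\<^bsub>A\<^esub> \<otimes>\<^bsub>E\<^esub> fd i) \<in> carrier E" by (simp add: Pi_iff)
  fix x assume x: "x \<in> carrier A"
  have "(\<Oplus>\<^bsub>E\<^esub>i\<in>I. F_pure A (a i) \<one>\<^bsub>A\<^esub> \<otimes>\<^bsub>E\<^esub> fd i) x
      = (\<Oplus>\<^bsub>A\<^esub>i\<in>I. (F_pure A (a i) \<one>\<^bsub>A\<^esub> \<otimes>\<^bsub>E\<^esub> fd i) x)"
    using x by (intro E_finsum_eval) simp_all
  also have "\<dots> = (\<Oplus>\<^bsub>A\<^esub>i\<in>I. as i x \<odot>\<^bsub>A\<^esub> a i)"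
    using x by (intro M.finsum_cong') (simp_all add: smult_mult_right)
  finally show "(\<Oplus>\<^bsub>E\<^esub>i\<in>I. F_pure A (a i) \<one>\<^bsub>A\<^esub> \<otimes>\<^bsub>E\<^esub> fd i) x = \<one>\<^bsub>E\<^esub> x"
    using x by (simp add: dual_basis)
qed simp

section \<open>Modules over the endomorphism ring and their invariants\<close>


lemma emod_abelian_group: "left_module E V \<Longrightarrow> abelian_group V"
  by (simp add: left_module_def)

lemma emod_group_simps [simp]:
  assumes "left_module E V"
  shows "\<zero>\<^bsub>V\<^esub> \<in> carrier V"
    and "\<lbrakk>v \<in> carrier V; w \<in> carrier V\<rbrakk> \<Longrightarrow> v \<oplus>\<^bsub>V\<^esub> w \<in> carrier V"
    and "v \<in> carrier V \<Longrightarrow> v \<oplus>\<^bsub>V\<^esub> \<zero>\<^bsub>V\<^esub> = v"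
    and "v \<in> carrier V \<Longrightarrow> \<zero>\<^bsub>V\<^esub> \<oplus>\<^bsub>V\<^esub> v = v"
proof -
  interpret V: abelian_group V using assms by (rule emod_abelian_group)
  show "\<zero>\<^bsub>V\<^esub> \<in> carrier V"
    and "\<lbrakk>v \<in> carrier V; w \<in> carrier V\<rbrakk> \<Longrightarrow> v \<oplus>\<^bsub>V\<^esub> w \<in> carrier V"
    and "v \<in> carrier V \<Longrightarrow> v \<oplus>\<^bsub>V\<^esub> \<zero>\<^bsub>V\<^esub> = v"
    and "v \<in> carrier V \<Longrightarrow> \<zero>\<^bsub>V\<^esub> \<oplus>\<^bsub>V\<^esub> v = v"
    by simp_all
qed

lemma emod_act_closed [simp]:
    "\<lbrakk>left_module E V; f \<in> carrier E; v \<in> carrier V\<rbrakk> \<Longrightarrow> f \<odot>\<^bsub>V\<^esub> v \<in> carrier V"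
  and emod_act_add: "\<lbrakk>left_module E V; f \<in> carrier E; v \<in> carrier V; w \<in> carrier V\<rbrakk>
    \<Longrightarrow> f \<odot>\<^bsub>V\<^esub> (v \<oplus>\<^bsub>V\<^esub> w) = f \<odot>\<^bsub>V\<^esub> v \<oplus>\<^bsub>V\<^esub> f \<odot>\<^bsub>V\<^esub> w"
  and emod_add_act: "\<lbrakk>left_module E V; f \<in> carrier E; g \<in> carrier E; v \<in> carrier V\<rbrakk>
    \<Longrightarrow> (f \<oplus>\<^bsub>E\<^esub> g) \<odot>\<^bsub>V\<^esub> v = f \<odot>\<^bsub>V\<^esub> v \<oplus>\<^bsub>V\<^esub> g \<odot>\<^bsub>V\<^esub> v"
  and emod_act_act: "\<lbrakk>left_module E V; f \<in> carrier E; g \<in> carrier E; v \<in> carrier V\<rbrakk>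
    \<Longrightarrow> f \<odot>\<^bsub>V\<^esub> (g \<odot>\<^bsub>V\<^esub> v) = (f \<otimes>\<^bsub>E\<^esub> g) \<odot>\<^bsub>V\<^esub> v"
  and emod_one_act [simp]: "\<lbrakk>left_module E V; v \<in> carrier V\<rbrakk> \<Longrightarrow> \<one>\<^bsub>E\<^esub> \<odot>\<^bsub>V\<^esub> v = v"
  by (simp_all add: left_module.smult_closed left_module.smult_r_distr left_module.smult_l_distr
      left_module.smult_assoc left_module.smult_one)

lemma emod_act_additive:
  "\<lbrakk>left_module E V; f \<in> carrier E\<rbrakk> \<Longrightarrow> additive_map V V (\<lambda>v. f \<odot>\<^bsub>V\<^esub> v)"
  by (intro additiveI) (simp_all add: emod_act_add)

lemma lact_closed [simp]: "\<lbrakk>left_module E V; b \<in> carrier A; v \<in> carrier V\<rbrakk> \<Longrightarrow> lact A V b v \<in> carrier V"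
  and ract_closed [simp]: "\<lbrakk>left_module E V; b \<in> carrier A; v \<in> carrier V\<rbrakk> \<Longrightarrow> ract A V v b \<in> carrier V"
  by (simp_all add: lact_def ract_def)

lemma lact_add: "\<lbrakk>left_module E V; b \<in> carrier A; v \<in> carrier V; w \<in> carrier V\<rbrakk>
    \<Longrightarrow> lact A V b (v \<oplus>\<^bsub>V\<^esub> w) = lact A V b v \<oplus>\<^bsub>V\<^esub> lact A V b w"
  and ract_add: "\<lbrakk>left_module E V; b \<in> carrier A; v \<in> carrier V; w \<in> carrier V\<rbrakk>
    \<Longrightarrow> ract A V (v \<oplus>\<^bsub>V\<^esub> w) b = ract A V v b \<oplus>\<^bsub>V\<^esub> ract A V w b"
  and add_lact: "\<lbrakk>left_module E V; b \<in> carrier A; c \<in> carrier A; v \<in> carrier V\<rbrakk>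
    \<Longrightarrow> lact A V (b \<oplus>\<^bsub>A\<^esub> c) v = lact A V b v \<oplus>\<^bsub>V\<^esub> lact A V c v"
  and add_ract: "\<lbrakk>left_module E V; b \<in> carrier A; c \<in> carrier A; v \<in> carrier V\<rbrakk>
    \<Longrightarrow> ract A V v (b \<oplus>\<^bsub>A\<^esub> c) = ract A V v b \<oplus>\<^bsub>V\<^esub> ract A V v c"
  and lact_lact: "\<lbrakk>left_module E V; b \<in> carrier A; c \<in> carrier A; v \<in> carrier V\<rbrakk>
    \<Longrightarrow> lact A V b (lact A V c v) = lact A V (b \<otimes>\<^bsub>A\<^esub> c) v"
  and ract_ract: "\<lbrakk>left_module E V; b \<in> carrier A; c \<in> carrier A; v \<in> carrier V\<rbrakk>
    \<Longrightarrow> ract A V (ract A V v b) c = ract A V v (b \<otimes>\<^bsub>A\<^esub> c)"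
  and one_lact [simp]: "\<lbrakk>left_module E V; v \<in> carrier V\<rbrakk> \<Longrightarrow> lact A V \<one>\<^bsub>A\<^esub> v = v"
  and one_ract [simp]: "\<lbrakk>left_module E V; v \<in> carrier V\<rbrakk> \<Longrightarrow> ract A V v \<one>\<^bsub>A\<^esub> = v"
  and ract_lact: "\<lbrakk>left_module E V; b \<in> carrier A; c \<in> carrier A; v \<in> carrier V\<rbrakk>
    \<Longrightarrow> ract A V (lact A V b v) c = lact A V b (ract A V v c)"
  by (simp_all add: lact_def ract_def emod_act_add emod_add_act emod_act_act F_pure_mult F_pure_one
      F_pure_add_left F_pure_add_right)

lemma bimodule_emod:
  assumes "left_module E V"
  shows "bimodule K A V (lact A V) (ract A V)"
proof (intro bimodule.intro k_algebra_axioms emod_abelian_group assms bimodule_axioms.intro)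
  show "lact A V (s \<odot>\<^bsub>A\<^esub> \<one>\<^bsub>A\<^esub>) v = ract A V v (s \<odot>\<^bsub>A\<^esub> \<one>\<^bsub>A\<^esub>)" if "s \<in> carrier K" for s v
    using that by (simp add: lact_def ract_def F_pure_scalar)
qed (simp_all add: assms lact_add ract_add add_lact add_ract lact_lact ract_ract ract_lact)

text \<open>Equivalently, \<open>b\<close> maps to \<open>b v\<close> is an \<open>E\<close>-linear
  map from the unit object to \<open>V\<close>; so this is the set of such maps, each given by its
  value at 1.\<close>

definition invs :: "('u \<Rightarrow> 'u, 'u) module \<Rightarrow> 'u set"
  where "invs V = {v \<in> carrier V. \<forall>f \<in> carrier E. f \<odot>\<^bsub>V\<^esub> v = lact A V (f \<one>\<^bsub>A\<^esub>) v}"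

lemma invsI:
  "\<lbrakk>v \<in> carrier V; \<And>f. f \<in> carrier E \<Longrightarrow> f \<odot>\<^bsub>V\<^esub> v = lact A V (f \<one>\<^bsub>A\<^esub>) v\<rbrakk> \<Longrightarrow> v \<in> invs V"
  by (simp add: invs_def)

lemma invs_closed [simp]: "v \<in> invs V \<Longrightarrow> v \<in> carrier V"
  by (simp add: invs_def)

lemma invs_act: "\<lbrakk>v \<in> invs V; f \<in> carrier E\<rbrakk> \<Longrightarrow> f \<odot>\<^bsub>V\<^esub> v = lact A V (f \<one>\<^bsub>A\<^esub>) v"
  unfolding invs_def by blast

text \<open>\<open>f\<close> after left multiplication by \<open>b\<close> is an element of
  \<open>E\<close> with value \<open>f(b)\<close> at 1, and the defining condition of an invariant
  applies to it.\<close>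

lemma act_lact_invs:
  assumes "left_module E V" "v \<in> invs V" "f \<in> carrier E" "b \<in> carrier A"
  shows "f \<odot>\<^bsub>V\<^esub> lact A V b v = lact A V (f b) v"
  using assms invs_act[OF assms(2), of "f \<otimes>\<^bsub>E\<^esub> F_pure A b \<one>\<^bsub>A\<^esub>"]
  by (simp add: lact_def[of A V b] emod_act_act)

text \<open>Left and right multiplication by \<open>b\<close> are endomorphisms with the same value
  at 1, and an invariant sees only that value.\<close>

lemma ract_invs: "\<lbrakk>v \<in> invs V; b \<in> carrier A\<rbrakk> \<Longrightarrow> ract A V v b = lact A V b v"
  by (simp add: ract_def invs_act)

lemma dual_one_act_invs:
  assumes "left_module E V" "v \<in> carrier V" "i \<in> I"
  shows "fd i \<odot>\<^bsub>V\<^esub> v \<in> invs V"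
  using assms by (intro invsI) (simp_all add: lact_def emod_act_act flip: mult_dual_one)

lemma emod_finsum_closed [simp]:
  "\<lbrakk>left_module E V; g \<in> J \<rightarrow> carrier V\<rbrakk> \<Longrightarrow> (\<Oplus>\<^bsub>V\<^esub>i\<in>J. g i) \<in> carrier V"
  using abelian_monoid.finsum_closed[of V g J] by (simp add: left_module_def abelian_group_def)

lemma emod_finsum_cong:
  assumes "left_module E V" "\<And>i. i \<in> J \<Longrightarrow> g i = h i" "h \<in> J \<rightarrow> carrier V"
  shows "(\<Oplus>\<^bsub>V\<^esub>i\<in>J. g i) = (\<Oplus>\<^bsub>V\<^esub>i\<in>J. h i)"
proof -
  interpret V: abelian_group V using assms(1) by (rule emod_abelian_group)
  show ?thesis using assms(2,3) by (intro V.finsum_cong') simp_all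
qed

text \<open>Both sides of \<open>dual_one_sum\<close> are applied to \<open>v\<close>. As each
  \<open>fd i\<close> sends \<open>v\<close> to an invariant, this is the explicit expansion behind
  \<open>invs_generates\<close>.\<close>

lemma sum_dual_one_act:
  assumes V: "left_module E V" and v: "v \<in> carrier V"
  shows "(\<Oplus>\<^bsub>V\<^esub>i\<in>I. lact A V (a i) (fd i \<odot>\<^bsub>V\<^esub> v)) = v"
proof -
  interpret ER: ring E by (rule ring_E)
  have "additive_map E V (\<lambda>f. f \<odot>\<^bsub>V\<^esub> v)" using assms by (intro additiveI) (simp_all add: emod_add_act)
  from additive_finsum[OF ER.abelian_group_axioms emod_abelian_group[OF V] this finite_I,
      of "\<lambda>i. F_pure A (a i) \<one>\<^bsub>A\<^esub> \<otimes>\<^bsub>E\<^esub> fd i"]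
  have "v = (\<Oplus>\<^bsub>V\<^esub>i\<in>I. (F_pure A (a i) \<one>\<^bsub>A\<^esub> \<otimes>\<^bsub>E\<^esub> fd i) \<odot>\<^bsub>V\<^esub> v)"
    using assms by (simp add: dual_one_sum)
  also have "\<dots> = (\<Oplus>\<^bsub>V\<^esub>i\<in>I. lact A V (a i) (fd i \<odot>\<^bsub>V\<^esub> v))"
    using assms by (intro emod_finsum_cong) (simp_all add: lact_def emod_act_act)
  finally show ?thesis by simp
qed

lemma finsum_induct:
  assumes "abelian_group V" "finite J" "g \<in> J \<rightarrow> carrier V" "P \<zero>\<^bsub>V\<^esub>"
    and "\<And>x y. \<lbrakk>x \<in> carrier V; y \<in> carrier V; P x; P y\<rbrakk> \<Longrightarrow> P (x \<oplus>\<^bsub>V\<^esub> y)"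
    and "\<And>i. i \<in> J \<Longrightarrow> P (g i)"
  shows "P (\<Oplus>\<^bsub>V\<^esub>i\<in>J. g i)"
proof -
  interpret V: abelian_group V by fact
  from assms(2,3,6) show ?thesis
    by (induction J) (auto simp: assms(4) intro!: assms(5))
qed

text \<open>Additive spanning by the \<open>b g\<close>, phrased as an induction principle over
  closed sets \<open>S\<close>; negatives come along because the negative of \<open>b g\<close> is
  \<open>(- b) g\<close>. \<open>G\<close> is variable because sets smaller than
  \<open>invs V\<close> are wanted: pure tensors of invariants, and 1 alone in the unit
  object.\<close>

definition generates :: "('u \<Rightarrow> 'u, 'u) module \<Rightarrow> 'u set \<Rightarrow> bool"
  where "generates V G \<longleftrightarrow> G \<subseteq> invs V \<and>
    (\<forall>S. \<zero>\<^bsub>V\<^esub> \<in> S \<and> (\<forall>x \<in> carrier V \<inter> S. \<forall>y \<in> carrier V \<inter> S. x \<oplus>\<^bsub>V\<^esub> y \<in> S) \<and>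
      (\<forall>b \<in> carrier A. \<forall>g \<in> G. lact A V b g \<in> S) \<longrightarrow> carrier V \<subseteq> S)"

lemma generates_invs: "\<lbrakk>generates V G; g \<in> G\<rbrakk> \<Longrightarrow> g \<in> invs V"
  by (auto simp: generates_def)

lemma generates_induct:
  assumes "generates V G" "v \<in> carrier V" "P \<zero>\<^bsub>V\<^esub>"
    and "\<And>x y. \<lbrakk>x \<in> carrier V; y \<in> carrier V; P x; P y\<rbrakk> \<Longrightarrow> P (x \<oplus>\<^bsub>V\<^esub> y)"
    and "\<And>b g. \<lbrakk>b \<in> carrier A; g \<in> G\<rbrakk> \<Longrightarrow> P (lact A V b g)"
  shows "P v"
proof -
  from assms(1) have "carrier V \<subseteq> Collect P"
    unfolding generates_def by (elim conjE allE[of _ "Collect P"] impE) (use assms(3-5) in auto)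
  with assms(2) show ?thesis by blast
qed

lemma generatesI:
  assumes "G \<subseteq> invs V"
    and "\<And>P v. \<lbrakk>v \<in> carrier V; P \<zero>\<^bsub>V\<^esub>;
      \<And>x y. \<lbrakk>x \<in> carrier V; y \<in> carrier V; P x; P y\<rbrakk> \<Longrightarrow> P (x \<oplus>\<^bsub>V\<^esub> y);
      \<And>b g. \<lbrakk>b \<in> carrier A; g \<in> G\<rbrakk> \<Longrightarrow> P (lact A V b g)\<rbrakk> \<Longrightarrow> P v"
  shows "generates V G"
  unfolding generates_def
proof (intro conjI allI impI, fact assms(1), rule subsetI)
  fix S v
  assume S: "\<zero>\<^bsub>V\<^esub> \<in> S \<and> (\<forall>x \<in> carrier V \<inter> S. \<forall>y \<in> carrier V \<inter> S. x \<oplus>\<^bsub>V\<^esub> y \<in> S) \<and>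
      (\<forall>b \<in> carrier A. \<forall>g \<in> G. lact A V b g \<in> S)" and v: "v \<in> carrier V"
  show "v \<in> S" by (rule assms(2)[of v "\<lambda>v. v \<in> S"]) (use S v in auto)
qed

lemma invs_generates:
  assumes "left_module E V"
  shows "generates V (invs V)"
proof (rule generatesI)
  fix P v
  assume v: "v \<in> carrier V" and P: "P \<zero>\<^bsub>V\<^esub>"
      "\<And>x y. \<lbrakk>x \<in> carrier V; y \<in> carrier V; P x; P y\<rbrakk> \<Longrightarrow> P (x \<oplus>\<^bsub>V\<^esub> y)"
      "\<And>b g. \<lbrakk>b \<in> carrier A; g \<in> invs V\<rbrakk> \<Longrightarrow> P (lact A V b g)"
  have "P (\<Oplus>\<^bsub>V\<^esub>i\<in>I. lact A V (a i) (fd i \<odot>\<^bsub>V\<^esub> v))"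
    by (rule finsum_induct[OF emod_abelian_group[OF assms] finite_I])
      (use assms v in \<open>simp_all add: P dual_one_act_invs\<close>)
  then show "P v" using assms v by (simp add: sum_dual_one_act)
qed simp

text \<open>For maps that are only additive the coefficient \<open>b\<close> has to stay in the
  hypothesis. This form verifies balancing identities, before any linearity is available.\<close>

lemma additive_eqI:
  assumes "left_module E V" "abelian_group N" "generates V G" "additive_map V N m" "additive_map V N n"
    and "\<And>b g. \<lbrakk>b \<in> carrier A; g \<in> G\<rbrakk> \<Longrightarrow> m (lact A V b g) = n (lact A V b g)"
    and "v \<in> carrier V"
  shows "m v = n v"
proof (rule generates_induct[OF assms(3,7)])
  show "m \<zero>\<^bsub>V\<^esub> = n \<zero>\<^bsub>V\<^esub>"
    using assms(1,2,4,5) by (simp add: additive_zero emod_abelian_group)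
qed (use assms(4-6) in \<open>simp_all add: additive_add[of V N]\<close>)

section \<open>Linear maps and their values on invariants\<close>

lemma mod_homs_act:
  "\<lbrakk>m \<in> mod_homs E V W; f \<in> carrier E; v \<in> carrier V\<rbrakk> \<Longrightarrow> m (f \<odot>\<^bsub>V\<^esub> v) = f \<odot>\<^bsub>W\<^esub> m v"
  unfolding mod_homs_iff by blast

lemma mod_homs_additive: "m \<in> mod_homs E V W \<Longrightarrow> additive_map V W m"
  unfolding mod_homs_iff by blast

lemma mod_homs_closed: "\<lbrakk>m \<in> mod_homs E V W; v \<in> carrier V\<rbrakk> \<Longrightarrow> m v \<in> carrier W"
  by (rule additive_closed[OF mod_homs_additive])

lemma mod_homs_lact:
  "\<lbrakk>m \<in> mod_homs E V W; b \<in> carrier A; v \<in> carrier V\<rbrakk> \<Longrightarrow> m (lact A V b v) = lact A W b (m v)"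
  unfolding lact_def by (rule mod_homs_act) simp_all

lemma mod_homs_ract:
  "\<lbrakk>m \<in> mod_homs E V W; b \<in> carrier A; v \<in> carrier V\<rbrakk> \<Longrightarrow> m (ract A V v b) = ract A W (m v) b"
  unfolding ract_def by (rule mod_homs_act) simp_all

lemma mod_homs_extensional: "m \<in> mod_homs E V W \<Longrightarrow> m \<in> extensional (carrier V)"
  by (simp only: mod_homs_iff)

lemma mod_homs_invs:
  assumes "m \<in> mod_homs E V W" "v \<in> invs V"
  shows "m v \<in> invs W"
proof -
  have "f \<odot>\<^bsub>W\<^esub> m v = lact A W (f \<one>\<^bsub>A\<^esub>) (m v)" if "f \<in> carrier E" for f
  proof -
    have "f \<odot>\<^bsub>W\<^esub> m v = m (lact A V (f \<one>\<^bsub>A\<^esub>) v)"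
      using mod_homs_act[OF assms(1) that invs_closed[OF assms(2)]] invs_act[OF assms(2) that] by simp
    also have "\<dots> = lact A W (f \<one>\<^bsub>A\<^esub>) (m v)"
      by (rule mod_homs_lact[OF assms(1)]) (use that assms(2) in simp_all)
    finally show ?thesis .
  qed
  then show ?thesis using mod_homs_closed[OF assms(1) invs_closed[OF assms(2)]] by (intro invsI)
qed

text \<open>An \<open>E\<close>-linear map commutes with \<open>lact\<close>, so its values on
  \<open>G\<close> determine those on all \<open>b g\<close>. Here the coefficients disappear, in
  contrast to \<open>additive_eqI\<close>.\<close>

lemma mod_homs_eqI:
  fixes V W :: "('u \<Rightarrow> 'u, 'u) module"
  assumes "left_module E V" "left_module E W" "generates V G" "m \<in> mod_homs E V W" "n \<in> mod_homs E V W"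
    and "\<And>g. g \<in> G \<Longrightarrow> m g = n g"
  shows "m = n"
proof (rule extensionalityI)
  show "m \<in> extensional (carrier V)" "n \<in> extensional (carrier V)"
    by (rule mod_homs_extensional, fact)+
  show "m v = n v" if "v \<in> carrier V" for v
  proof (rule additive_eqI[OF assms(1) emod_abelian_group[OF assms(2)] assms(3)
        mod_homs_additive[OF assms(4)] mod_homs_additive[OF assms(5)] _ that])
    show "m (lact A V b g) = n (lact A V b g)" if "b \<in> carrier A" "g \<in> G" for b g
      using that generates_invs[OF assms(3) that(2)]
      by (simp add: assms(6) mod_homs_lact[OF assms(4)] mod_homs_lact[OF assms(5)])
  qed
qed

text \<open>Both sides of the linearity condition are additive; at \<open>b g\<close> both are
  \<open>f(b)\<close> times \<open>m g\<close>, because \<open>g\<close> and its image are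
  invariant. So left \<open>A\<close>-linearity on generators already gives
  \<open>E\<close>-linearity.\<close>

lemma mod_homsI:
  fixes V W :: "('u \<Rightarrow> 'u, 'u) module"
  assumes V: "left_module E V" and W: "left_module E W" and G: "generates V G" and m: "additive_map V W m"
    and inv: "\<And>g. g \<in> G \<Longrightarrow> m g \<in> invs W"
    and lin: "\<And>b g. \<lbrakk>b \<in> carrier A; g \<in> G\<rbrakk> \<Longrightarrow> m (lact A V b g) = lact A W b (m g)"
  shows "restrict m (carrier V) \<in> mod_homs E V W"
proof -
  have "m (f \<odot>\<^bsub>V\<^esub> v) = f \<odot>\<^bsub>W\<^esub> m v" if f: "f \<in> carrier E" and v: "v \<in> carrier V" for f v
  proof (rule additive_eqI[OF V emod_abelian_group[OF W] G
        additive_comp[OF emod_act_additive[OF V f] m] additive_comp[OF m emod_act_additive[OF W f]] _ v])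
    show "m (f \<odot>\<^bsub>V\<^esub> lact A V b g) = f \<odot>\<^bsub>W\<^esub> m (lact A V b g)" if "b \<in> carrier A" "g \<in> G" for b g
      using that f V W generates_invs[OF G] by (simp add: act_lact_invs lin inv)
  qed
  then show ?thesis using m V by (simp add: mod_homs_iff additive_map_def Pi_iff)
qed

end

section \<open>The universal property of the tensor product\<close>

definition balanced ::
  "('k, 'u, 'y) module_scheme \<Rightarrow> ('u \<Rightarrow> 'u, 'v) module \<Rightarrow> ('u \<Rightarrow> 'u, 'w) module
    \<Rightarrow> ('n, 'z) ring_scheme \<Rightarrow> ('v \<Rightarrow> 'w \<Rightarrow> 'n) \<Rightarrow> bool"
  where "balanced A V W M \<beta> \<longleftrightarrow>
    (\<forall>v \<in> carrier V. \<forall>w \<in> carrier W. \<beta> v w \<in> carrier M) \<and>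
    (\<forall>v \<in> carrier V. \<forall>v' \<in> carrier V. \<forall>w \<in> carrier W. \<beta> (v \<oplus>\<^bsub>V\<^esub> v') w = \<beta> v w \<oplus>\<^bsub>M\<^esub> \<beta> v' w) \<and>
    (\<forall>v \<in> carrier V. \<forall>w \<in> carrier W. \<forall>w' \<in> carrier W. \<beta> v (w \<oplus>\<^bsub>W\<^esub> w') = \<beta> v w \<oplus>\<^bsub>M\<^esub> \<beta> v w') \<and>
    (\<forall>v \<in> carrier V. \<forall>b \<in> carrier A. \<forall>w \<in> carrier W. \<beta> (ract A V v b) w = \<beta> v (lact A W b w))"

context dual_basis_algebra
begin

context
  fixes V W :: "('u \<Rightarrow> 'u, 'u) module"
  assumes V: "left_module E V" and W: "left_module E W"
begin

abbreviation (input) free_group where "free_group \<equiv> free_Abelian_group (carrier V \<times> carrier W)"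

text \<open>Class of a formal sum, already transported into the universe. Expressing the group
  structure through it keeps cosets and the chosen injection out of most arguments.\<close>

definition tens_class :: "('u \<times> 'u \<Rightarrow>\<^sub>0 int) \<Rightarrow> 'u"
  where "tens_class x = tens_code A V W (r_coset free_group (tens_subgroup A V W) x)"

lemma tens_rels_subset: "tens_rels A V W \<subseteq> carrier free_group"
proof -
  have "x - y \<in> carrier free_group" if "x \<in> carrier free_group" "y \<in> carrier free_group" for x y
    using that keys_diff[of x y] by auto
  moreover have "frag_of (v, w) \<in> carrier free_group" if "v \<in> carrier V" "w \<in> carrier W" for v w
    using that by simp
  ultimately show ?thesis
    unfolding tens_rels_def using V W by (auto simp del: carrier_free_Abelian_group_iff)
qed

lemma subgroup_tens_subgroup: "subgroup (tens_subgroup A V W) free_group"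
  unfolding tens_subgroup_def
  by (rule group.generate_is_subgroup[OF group_free_Abelian_group tens_rels_subset])

lemma normal_tens_subgroup: "tens_subgroup A V W \<lhd> free_group"
  using comm_group.normal_iff_subgroup[OF abelian_free_Abelian_group] subgroup_tens_subgroup by blast

lemma carrier_tens_group: "carrier (tens_group A V W)
    = r_coset free_group (tens_subgroup A V W) ` carrier free_group"
  by (simp add: tens_group_def carrier_FactGroup)

lemma carrier_tens_ab: "carrier (tens_ab A V W) = tens_class ` carrier free_group"
  by (auto simp: tens_ab_def Let_def carrier_tens_group tens_class_def image_image)

lemma zero_tens_ab: "\<zero>\<^bsub>tens_ab A V W\<^esub> = tens_class 0"
proof -
  have "r_coset free_group (tens_subgroup A V W) \<one>\<^bsub>free_group\<^esub> = tens_subgroup A V W"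
    using subgroup_tens_subgroup group.coset_mult_one[OF group_free_Abelian_group]
      subgroup.subset by blast
  then show ?thesis by (simp add: tens_ab_def Let_def tens_class_def tens_group_def)
qed

lemma add_tens_class:
  assumes "x \<in> carrier free_group" "y \<in> carrier free_group"
  shows "tens_class x \<oplus>\<^bsub>tens_ab A V W\<^esub> tens_class y = tens_class (x + y)"
proof -
  let ?c = "r_coset free_group (tens_subgroup A V W)"
  have "inv_into (carrier (tens_group A V W)) (tens_code A V W) (tens_class z) = ?c z"
    if "z \<in> carrier free_group" for z
    unfolding tens_class_def
    by (rule inv_into_f_f[OF inj_on_tens_code]) (use that in \<open>auto simp: carrier_tens_group\<close>)
  moreover have "?c x \<otimes>\<^bsub>tens_group A V W\<^esub> ?c y = ?c (x + y)"
    using normal.rcos_sum[OF normal_tens_subgroup assms] by (simp add: tens_group_def)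
  ultimately show ?thesis
    using assms by (simp add: tens_ab_def Let_def tens_class_def)
qed

lemma tens_class_eq:
  assumes "x \<in> carrier free_group" "y \<in> carrier free_group" "x - y \<in> tens_subgroup A V W"
  shows "tens_class x = tens_class y"
proof -
  interpret F: group free_group by simp
  have "x \<otimes>\<^bsub>free_group\<^esub> inv\<^bsub>free_group\<^esub> y \<in> tens_subgroup A V W"
    using assms by simp
  then have "x \<in> r_coset free_group (tens_subgroup A V W) y"
    using subgroup.rcos_module[OF subgroup_tens_subgroup group_free_Abelian_group assms(2,1)] by blast
  from F.repr_independence[OF this assms(2) subgroup_tens_subgroup]
  show ?thesis by (simp add: tens_class_def)
qed

lemma abelian_group_tens_ab: "abelian_group (tens_ab A V W)"
proof -
  have add: "x + y \<in> carrier free_group" if "x \<in> carrier free_group" "y \<in> carrier free_group" for x y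
    using that keys_add[of x y] by auto
  have zero: "0 \<in> carrier free_group" by simp
  show ?thesis
  proof (rule abelian_groupI)
    fix t assume "t \<in> carrier (tens_ab A V W)"
    then obtain x where x: "x \<in> carrier free_group" "t = tens_class x" by (auto simp: carrier_tens_ab)
    then have "tens_class (- x) \<oplus>\<^bsub>tens_ab A V W\<^esub> t = \<zero>\<^bsub>tens_ab A V W\<^esub>"
      by (simp add: add_tens_class zero_tens_ab)
    then show "\<exists>s \<in> carrier (tens_ab A V W). s \<oplus>\<^bsub>tens_ab A V W\<^esub> t = \<zero>\<^bsub>tens_ab A V W\<^esub>"
      using x by (auto simp: carrier_tens_ab)
  qed (auto simp: carrier_tens_ab zero_tens_ab add_tens_class add zero ac_simps
        simp del: carrier_free_Abelian_group_iff)
qed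

lemma ptens_class: "ptens A V W v w = tens_class (frag_of (v, w))"
  by (simp add: ptens_def tens_class_def)

lemma ptens_closed_ab: "\<lbrakk>v \<in> carrier V; w \<in> carrier W\<rbrakk> \<Longrightarrow> ptens A V W v w \<in> carrier (tens_ab A V W)"
  by (simp add: ptens_class carrier_tens_ab)

lemma balanced_ptens_ab: "balanced A V W (tens_ab A V W) (ptens A V W)"
  unfolding balanced_def
proof (intro conjI ballI)
  have gen: "r \<in> tens_subgroup A V W" if "r \<in> tens_rels A V W" for r
    using that by (simp add: tens_subgroup_def generate.incl)
  have eq: "tens_class (frag_of x) = tens_class (frag_of y) \<oplus>\<^bsub>tens_ab A V W\<^esub> tens_class (frag_of z)"
    if "x \<in> carrier V \<times> carrier W" "y \<in> carrier V \<times> carrier W" "z \<in> carrier V \<times> carrier W"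
      "frag_of x - frag_of y - frag_of z \<in> tens_rels A V W" for x y z
  proof -
    have "frag_of x - (frag_of y + frag_of z) \<in> tens_subgroup A V W"
      using gen[OF that(4)] by (simp add: diff_diff_eq)
    moreover have "frag_of y + frag_of z \<in> carrier free_group"
      using that keys_add[of "frag_of y" "frag_of z"] by auto
    ultimately have "tens_class (frag_of x) = tens_class (frag_of y + frag_of z)"
      using that by (intro tens_class_eq) simp_all
    then show ?thesis using that by (simp add: add_tens_class)
  qed
  show "ptens A V W (v \<oplus>\<^bsub>V\<^esub> v') w = ptens A V W v w \<oplus>\<^bsub>tens_ab A V W\<^esub> ptens A V W v' w"
    if "v \<in> carrier V" "v' \<in> carrier V" "w \<in> carrier W" for v v' w
    unfolding ptens_class by (rule eq) (use that V in \<open>auto simp: tens_rels_def\<close>)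
  show "ptens A V W v (w \<oplus>\<^bsub>W\<^esub> w') = ptens A V W v w \<oplus>\<^bsub>tens_ab A V W\<^esub> ptens A V W v w'"
    if "v \<in> carrier V" "w \<in> carrier W" "w' \<in> carrier W" for v w w'
    unfolding ptens_class by (rule eq) (use that W in \<open>auto simp: tens_rels_def\<close>)
  show "ptens A V W (ract A V v b) w = ptens A V W v (lact A W b w)"
    if "v \<in> carrier V" "b \<in> carrier A" "w \<in> carrier W" for v b w
    unfolding ptens_class
    by (rule tens_class_eq) (use that V W in \<open>auto intro!: gen simp: tens_rels_def\<close>)
qed (rule ptens_closed_ab)

text \<open>\<open>\<beta>\<close> extends to the free abelian group. The clauses of
  \<open>balanced\<close> say that the extension kills the three families of relators, so it factors
  through the quotient.\<close>

lemma tens_ab_lift: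
  assumes M: "abelian_group M" and \<beta>: "balanced A V W M \<beta>"
  obtains m where "additive_map (tens_ab A V W) M m"
    and "\<And>v w. \<lbrakk>v \<in> carrier V; w \<in> carrier W\<rbrakk> \<Longrightarrow> m (ptens A V W v w) = \<beta> v w"
proof -
  interpret M: abelian_group M by fact
  have "case_prod \<beta> ` (carrier V \<times> carrier W) \<subseteq> carrier (add_monoid M)"
    using \<beta> by (auto simp: balanced_def)
  from comm_group.free_Abelian_group_universal[OF M.a_comm_group this]
  obtain h where h: "h \<in> hom free_group (add_monoid M)"
    and h_frag: "\<And>x. x \<in> carrier V \<times> carrier W \<Longrightarrow> h (frag_of x) = case_prod \<beta> x"
    by metis
  interpret h: group_hom free_group "add_monoid M" h
    by (simp add: group_hom_def group_hom_axioms_def h M.a_group)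
  have h_diff: "h (x - y) = h x \<ominus>\<^bsub>M\<^esub> h y" if "x \<in> carrier free_group" "y \<in> carrier free_group" for x y
    using h.hom_mult[of x "- y"] h.hom_inv[of y] that by (simp add: a_inv_def a_minus_def)
  have diff: "x - y \<in> carrier free_group" if "x \<in> carrier free_group" "y \<in> carrier free_group" for x y
    using that keys_diff[of x y] by auto
  have frag: "frag_of (v, w) \<in> carrier free_group" if "v \<in> carrier V" "w \<in> carrier W" for v w
    using that by simp
  have "r \<in> kernel free_group (add_monoid M) h" if "r \<in> tens_rels A V W" for r
  proof -
    \<comment> \<open>The first two families of relators become \<open>x + y - x - y\<close> in
      \<open>M\<close>, the third becomes \<open>x - x\<close>.\<close>
    have sum: "x \<oplus>\<^bsub>M\<^esub> y \<ominus>\<^bsub>M\<^esub> x \<ominus>\<^bsub>M\<^esub> y = \<zero>\<^bsub>M\<^esub>" if "x \<in> carrier M" "y \<in> carrier M" for x y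
    proof -
      have "x \<oplus>\<^bsub>M\<^esub> y \<ominus>\<^bsub>M\<^esub> x \<ominus>\<^bsub>M\<^esub> y = (x \<oplus>\<^bsub>M\<^esub> y) \<oplus>\<^bsub>M\<^esub> \<ominus>\<^bsub>M\<^esub> (x \<oplus>\<^bsub>M\<^esub> y)"
        using that by (simp add: a_minus_def M.minus_add M.a_assoc)
      then show ?thesis using that by (simp add: M.r_neg)
    qed
    have self: "x \<ominus>\<^bsub>M\<^esub> x = \<zero>\<^bsub>M\<^esub>" if "x \<in> carrier M" for x
      using that by (simp add: a_minus_def M.r_neg)
    have "h r = \<zero>\<^bsub>M\<^esub>"
      using that V W \<beta> unfolding tens_rels_def
      by (auto simp: h_diff diff frag h_frag balanced_def sum self
          simp del: carrier_free_Abelian_group_iff)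
    then show ?thesis using that tens_rels_subset by (auto simp: kernel_def simp del: carrier_free_Abelian_group_iff)
  qed
  then have "tens_subgroup A V W \<subseteq> kernel free_group (add_monoid M) h"
    unfolding tens_subgroup_def
    by (intro group.generate_subgroup_incl h.subgroup_kernel) auto
  from h.FactGroup_universal_kernel[OF normal_tens_subgroup this]
  obtain g where g: "g \<in> hom (tens_group A V W) (add_monoid M)"
    and g_coset: "\<And>x. x \<in> carrier free_group \<Longrightarrow> g (r_coset free_group (tens_subgroup A V W) x) = h x"
    unfolding tens_group_def by metis
  \<comment> \<open>The factored map lives on cosets, so an element of the universe is decoded
    first.\<close>
  define m where "m = (\<lambda>t. g (inv_into (carrier (tens_group A V W)) (tens_code A V W) t))"
  have m: "m (tens_class x) = h x" if "x \<in> carrier free_group" for x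
  proof -
    have "inv_into (carrier (tens_group A V W)) (tens_code A V W) (tens_class x)
        = r_coset free_group (tens_subgroup A V W) x"
      unfolding tens_class_def
      by (rule inv_into_f_f[OF inj_on_tens_code]) (use that in \<open>auto simp: carrier_tens_group\<close>)
    then show ?thesis using that by (simp add: m_def g_coset)
  qed
  show ?thesis
  proof (rule that)
    show "additive_map (tens_ab A V W) M m"
    proof (rule additiveI)
      fix s t assume "s \<in> carrier (tens_ab A V W)" "t \<in> carrier (tens_ab A V W)"
      then obtain x y where xy: "x \<in> carrier free_group" "y \<in> carrier free_group"
        "s = tens_class x" "t = tens_class y" by (auto simp: carrier_tens_ab)
      moreover have "x + y \<in> carrier free_group" using xy keys_add[of x y] by auto
      moreover have "h (x + y) = h x \<oplus>\<^bsub>M\<^esub> h y" using h.hom_mult[OF xy(1,2)] by simp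
      ultimately show "m (s \<oplus>\<^bsub>tens_ab A V W\<^esub> t) = m s \<oplus>\<^bsub>M\<^esub> m t"
        by (simp add: add_tens_class m del: carrier_free_Abelian_group_iff)
    next
      fix s assume "s \<in> carrier (tens_ab A V W)"
      then show "m s \<in> carrier M"
        using h.hom_closed by (auto simp: carrier_tens_ab m simp del: carrier_free_Abelian_group_iff)
    qed
    show "m (ptens A V W v w) = \<beta> v w" if "v \<in> carrier V" "w \<in> carrier W" for v w
      using that by (simp add: ptens_class m h_frag)
  qed
qed

lemma tens_ab_induct:
  assumes "t \<in> carrier (tens_ab A V W)" and pure: "\<And>v w. \<lbrakk>v \<in> carrier V; w \<in> carrier W\<rbrakk> \<Longrightarrow> P (ptens A V W v w)"
    and zero: "P \<zero>\<^bsub>tens_ab A V W\<^esub>"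
    and add: "\<And>s t. \<lbrakk>s \<in> carrier (tens_ab A V W); t \<in> carrier (tens_ab A V W); P s; P t\<rbrakk>
      \<Longrightarrow> P (s \<oplus>\<^bsub>tens_ab A V W\<^esub> t)"
  shows "P t"
proof -
  interpret V: abelian_group V using V by (rule emod_abelian_group)
  interpret T: abelian_group "tens_ab A V W" by (rule abelian_group_tens_ab)
  obtain x where x: "Poly_Mapping.keys x \<subseteq> carrier V \<times> carrier W" "t = tens_class x"
    using assms(1) by (auto simp: carrier_tens_ab)
  \<comment> \<open>Induction in the free abelian group proceeds by differences, so negatives are
    carried along. On a generator this works because the negative of \<open>v \<otimes> w\<close> is
    the pure tensor of \<open>-v\<close> and \<open>w\<close>.\<close>
  have "P (tens_class x) \<and> P (tens_class (- x))"
  proof (rule free_Abelian_group_induct[OF x(1)])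
    show "P (tens_class 0) \<and> P (tens_class (- 0))" using zero by (simp add: zero_tens_ab)
  next
    fix x y
    assume *: "Poly_Mapping.keys x \<subseteq> carrier V \<times> carrier W" "Poly_Mapping.keys y \<subseteq> carrier V \<times> carrier W"
      "P (tens_class x) \<and> P (tens_class (- x))" "P (tens_class y) \<and> P (tens_class (- y))"
    then have "tens_class (x - y) = tens_class x \<oplus>\<^bsub>tens_ab A V W\<^esub> tens_class (- y)"
      "tens_class (- (x - y)) = tens_class y \<oplus>\<^bsub>tens_ab A V W\<^esub> tens_class (- x)"
      by (simp_all add: add_tens_class)
    then show "P (tens_class (x - y)) \<and> P (tens_class (- (x - y)))"
      using * by (simp add: add carrier_tens_ab)
  next
    fix p assume "p \<in> carrier V \<times> carrier W"
    then obtain v w where p: "p = (v, w)" "v \<in> carrier V" "w \<in> carrier W" by auto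
    have add_left: "ptens A V W (v \<oplus>\<^bsub>V\<^esub> v') w = ptens A V W v w \<oplus>\<^bsub>tens_ab A V W\<^esub> ptens A V W v' w"
      if "v \<in> carrier V" "v' \<in> carrier V" for v v'
      using balanced_ptens_ab that p unfolding balanced_def by blast
    have "ptens A V W \<zero>\<^bsub>V\<^esub> w = \<zero>\<^bsub>tens_ab A V W\<^esub>"
      using add_left[of "\<zero>\<^bsub>V\<^esub>" "\<zero>\<^bsub>V\<^esub>"] ptens_closed_ab[of "\<zero>\<^bsub>V\<^esub>" w] p
      by (simp add: T.add.l_cancel_one')
    then have "ptens A V W (\<ominus>\<^bsub>V\<^esub> v) w \<oplus>\<^bsub>tens_ab A V W\<^esub> ptens A V W v w = \<zero>\<^bsub>tens_ab A V W\<^esub>"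
      using add_left[of "\<ominus>\<^bsub>V\<^esub> v" v] p by (simp add: V.l_neg)
    moreover have "tens_class (- frag_of p) \<oplus>\<^bsub>tens_ab A V W\<^esub> ptens A V W v w = \<zero>\<^bsub>tens_ab A V W\<^esub>"
      using p by (simp add: ptens_class add_tens_class zero_tens_ab)
    moreover have "tens_class (- frag_of p) \<in> carrier (tens_ab A V W)"
      using p by (auto simp: carrier_tens_ab)
    ultimately have "tens_class (- frag_of p) = ptens A V W (\<ominus>\<^bsub>V\<^esub> v) w"
      using p ptens_closed_ab T.minus_equality by (metis V.a_inv_closed)
    then show "P (tens_class (frag_of p)) \<and> P (tens_class (- frag_of p))"
      using pure[of v w] pure[of "\<ominus>\<^bsub>V\<^esub> v" w] p by (simp add: ptens_class)
  qed
  then show ?thesis using x by simp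
qed

end

end

lemma additive_map_finsum:
  assumes "abelian_group M" "abelian_group N" "finite I" "\<And>i. i \<in> I \<Longrightarrow> additive_map M N (m i)"
  shows "additive_map M N (\<lambda>x. \<Oplus>\<^bsub>N\<^esub>i\<in>I. m i x)"
proof -
  interpret M: abelian_group M by fact
  interpret N: abelian_group N by fact
  note [simp] = additive_closed[OF assms(4)] additive_add[OF assms(4)]
  show ?thesis
  proof (rule additiveI)
    fix x y assume xy: "x \<in> carrier M" "y \<in> carrier M"
    then have "(\<Oplus>\<^bsub>N\<^esub>i\<in>I. m i (x \<oplus>\<^bsub>M\<^esub> y)) = (\<Oplus>\<^bsub>N\<^esub>i\<in>I. m i x \<oplus>\<^bsub>N\<^esub> m i y)"
      by (intro N.finsum_cong') simp_all
    with xy show "(\<Oplus>\<^bsub>N\<^esub>i\<in>I. m i (x \<oplus>\<^bsub>M\<^esub> y)) = (\<Oplus>\<^bsub>N\<^esub>i\<in>I. m i x) \<oplus>\<^bsub>N\<^esub> (\<Oplus>\<^bsub>N\<^esub>i\<in>I. m i y)"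
      by (simp add: N.finsum_addf Pi_iff)
  qed (simp add: Pi_iff)
qed

text \<open>\<open>T V W\<close> and \<open>tens_ab A V W\<close> are records of different types
  with the same additive group; this and the next two congruences move sums, additive maps and group
  laws between them.\<close>

lemma finsum_record_cong:
  "\<lbrakk>carrier M = carrier N; add M = add N; \<zero>\<^bsub>M\<^esub> = \<zero>\<^bsub>N\<^esub>\<rbrakk> \<Longrightarrow> finsum M g J = finsum N g J"
  by (simp add: finsum_def finprod_def)

lemma additive_map_record_cong:
  "\<lbrakk>carrier M = carrier M'; add M = add M'; carrier N = carrier N'; add N = add N'\<rbrakk>
    \<Longrightarrow> additive_map M N m = additive_map M' N' m"
  by (simp add: additive_map_def)

lemma abelian_group_record_cong:
  assumes "abelian_group M" "carrier N = carrier M" "add N = add M" "\<zero>\<^bsub>N\<^esub> = \<zero>\<^bsub>M\<^esub>"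
  shows "abelian_group N"
  by (rule abelian_groupI) (use abelian_groupE[OF assms(1)] assms(2-4) in auto)

section \<open>The action on the tensor product\<close>

context dual_basis_algebra
begin

abbreviation T where "T \<equiv> tens A I as a"

lemma carrier_tens: "carrier (T V W) = carrier (tens_ab A V W)"
  and add_tens: "add (T V W) = add (tens_ab A V W)"
  and zero_tens: "\<zero>\<^bsub>T V W\<^esub> = \<zero>\<^bsub>tens_ab A V W\<^esub>"
  by (simp_all add: tens_def Let_def)

lemmas tens_record = carrier_tens add_tens zero_tens

lemma abelian_group_tens: "\<lbrakk>left_module E V; left_module E W\<rbrakk> \<Longrightarrow> abelian_group (T V W)"
  by (rule abelian_group_record_cong[OF abelian_group_tens_ab]) (simp_all add: tens_record)

lemma balanced_ptens: "\<lbrakk>left_module E V; left_module E W\<rbrakk> \<Longrightarrow> balanced A V W (T V W) (ptens A V W)"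
  using balanced_ptens_ab by (simp add: balanced_def tens_record)

lemma ptens_closed [simp]:
    "\<lbrakk>left_module E V; left_module E W; v \<in> carrier V; w \<in> carrier W\<rbrakk> \<Longrightarrow> ptens A V W v w \<in> carrier (T V W)"
  and ptens_add_left:
    "\<lbrakk>left_module E V; left_module E W; v \<in> carrier V; v' \<in> carrier V; w \<in> carrier W\<rbrakk>
      \<Longrightarrow> ptens A V W (v \<oplus>\<^bsub>V\<^esub> v') w = ptens A V W v w \<oplus>\<^bsub>T V W\<^esub> ptens A V W v' w"
  and ptens_add_right:
    "\<lbrakk>left_module E V; left_module E W; v \<in> carrier V; w \<in> carrier W; w' \<in> carrier W\<rbrakk>
      \<Longrightarrow> ptens A V W v (w \<oplus>\<^bsub>W\<^esub> w') = ptens A V W v w \<oplus>\<^bsub>T V W\<^esub> ptens A V W v w'"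
  and ptens_ract:
    "\<lbrakk>left_module E V; left_module E W; v \<in> carrier V; b \<in> carrier A; w \<in> carrier W\<rbrakk>
      \<Longrightarrow> ptens A V W (ract A V v b) w = ptens A V W v (lact A W b w)"
  using balanced_ptens[of V W] unfolding balanced_def by blast+

text \<open>For invariant \<open>v\<close> left and right multiplication agree, so a coefficient on
  the left of \<open>v\<close> crosses the tensor sign.\<close>

lemma ptens_lact_invs:
  "\<lbrakk>left_module E V; left_module E W; v \<in> invs V; b \<in> carrier A; w \<in> carrier W\<rbrakk>
      \<Longrightarrow> ptens A V W (lact A V b v) w = ptens A V W v (lact A W b w)"
  using ptens_ract[of V W v b w] by (simp add: ract_invs)

lemma ptens_additive_left:
    "\<lbrakk>left_module E V; left_module E W; w \<in> carrier W\<rbrakk> \<Longrightarrow> additive_map V (T V W) (\<lambda>v. ptens A V W v w)"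
  and ptens_additive_right:
    "\<lbrakk>left_module E V; left_module E W; v \<in> carrier V\<rbrakk> \<Longrightarrow> additive_map W (T V W) (ptens A V W v)"
  by (auto intro!: additiveI simp: ptens_add_left ptens_add_right)

lemma lact_additive: "\<lbrakk>left_module E V; b \<in> carrier A\<rbrakk> \<Longrightarrow> additive_map V V (lact A V b)"
  and ract_additive: "\<lbrakk>left_module E V; b \<in> carrier A\<rbrakk> \<Longrightarrow> additive_map V V (\<lambda>v. ract A V v b)"
  and lact_additive_scalar: "\<lbrakk>left_module E V; v \<in> carrier V\<rbrakk> \<Longrightarrow> additive_map A V (\<lambda>b. lact A V b v)"
  and ract_additive_scalar: "\<lbrakk>left_module E V; v \<in> carrier V\<rbrakk> \<Longrightarrow> additive_map A V (ract A V v)"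
  by (auto intro!: additiveI simp: lact_add ract_add add_lact add_ract)

lemma tens_lift:
  assumes "left_module E V" "left_module E W" "abelian_group M" "balanced A V W M \<beta>"
  obtains m where "additive_map (T V W) M m"
    and "\<And>v w. \<lbrakk>v \<in> carrier V; w \<in> carrier W\<rbrakk> \<Longrightarrow> m (ptens A V W v w) = \<beta> v w"
proof -
  obtain m where "additive_map (tens_ab A V W) M m"
    and m: "\<And>v w. \<lbrakk>v \<in> carrier V; w \<in> carrier W\<rbrakk> \<Longrightarrow> m (ptens A V W v w) = \<beta> v w"
    using tens_ab_lift[OF assms] by metis
  then have "additive_map (T V W) M m" by (simp add: additive_map_def tens_record)
  then show ?thesis using m by (rule that)
qed

lemma tens_additive_eqI_pure:
  assumes V: "left_module E V" and W: "left_module E W" and N: "abelian_group N"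
    and m: "additive_map (T V W) N m" and n: "additive_map (T V W) N n"
    and eq: "\<And>v w. \<lbrakk>v \<in> carrier V; w \<in> carrier W\<rbrakk> \<Longrightarrow> m (ptens A V W v w) = n (ptens A V W v w)"
    and t: "t \<in> carrier (T V W)"
  shows "m t = n t"
proof (rule tens_ab_induct[OF V W])
  show "t \<in> carrier (tens_ab A V W)" using t by (simp add: tens_record)
  show "m \<zero>\<^bsub>tens_ab A V W\<^esub> = n \<zero>\<^bsub>tens_ab A V W\<^esub>"
    using additive_zero[OF abelian_group_tens[OF V W] N m] additive_zero[OF abelian_group_tens[OF V W] N n]
    by (simp add: tens_record)
  show "m (s \<oplus>\<^bsub>tens_ab A V W\<^esub> t) = n (s \<oplus>\<^bsub>tens_ab A V W\<^esub> t)"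
    if "s \<in> carrier (tens_ab A V W)" "t \<in> carrier (tens_ab A V W)" "m s = n s" "m t = n t" for s t
    using that additive_add[OF m, of s t] additive_add[OF n, of s t] by (simp add: tens_record)
qed (rule eq)

text \<open>Coefficients of the left factor cross to the right one, so a single coefficient remains.
  As the maps are only additive, this applies while the action on \<open>T V W\<close> is still
  under construction.\<close>

lemma tens_additive_eqI:
  assumes V: "left_module E V" and W: "left_module E W" and N: "abelian_group N"
    and G: "generates V G" and H: "generates W H"
    and m: "additive_map (T V W) N m" and n: "additive_map (T V W) N n"
    and eq: "\<And>v w b. \<lbrakk>v \<in> G; w \<in> H; b \<in> carrier A\<rbrakk>
      \<Longrightarrow> m (ptens A V W v (lact A W b w)) = n (ptens A V W v (lact A W b w))"
    and t: "t \<in> carrier (T V W)"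
  shows "m t = n t"
proof (rule tens_additive_eqI_pure[OF V W N m n _ t])
  have eq': "m (ptens A V W v w) = n (ptens A V W v w)" if v: "v \<in> G" and w: "w \<in> carrier W" for v w
  proof -
    have "v \<in> carrier V" using generates_invs[OF G v] by simp
    note ad = ptens_additive_right[OF V W this]
    show ?thesis
      by (rule additive_eqI[OF W N H additive_comp[OF ad m] additive_comp[OF ad n] _ w]) (rule eq[OF v])
  qed
  fix v w assume v: "v \<in> carrier V" and w: "w \<in> carrier W"
  note ad = ptens_additive_left[OF V W w]
  show "m (ptens A V W v w) = n (ptens A V W v w)"
  proof (rule additive_eqI[OF V N G additive_comp[OF ad m] additive_comp[OF ad n] _ v])
    fix b g assume bg: "b \<in> carrier A" "g \<in> G"
    with V W w generates_invs[OF G] eq'[of g "lact A W b w"]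
    show "m (ptens A V W (lact A V b g) w) = n (ptens A V W (lact A V b g) w)"
      by (simp add: ptens_lact_invs)
  qed
qed

text \<open>The right side of the action formula, kept apart from the action: that it defines a map
  on \<open>T V W\<close> has still to be shown.\<close>

definition tens_act_pure ::
  "('u \<Rightarrow> 'u, 'u) module \<Rightarrow> ('u \<Rightarrow> 'u, 'u) module \<Rightarrow> ('u \<Rightarrow> 'u) \<Rightarrow> 'u \<Rightarrow> 'u \<Rightarrow> 'u"
  where "tens_act_pure V W f v w =
    (\<Oplus>\<^bsub>T V W\<^esub>i\<in>I. ptens A V W (fd i \<odot>\<^bsub>V\<^esub> v) (pre_left A f (a i) \<odot>\<^bsub>W\<^esub> w))"

lemma pre_left_closed [simp]: "\<lbrakk>f \<in> carrier E; b \<in> carrier A\<rbrakk> \<Longrightarrow> pre_left A f b \<in> carrier E"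
  and pre_right_closed [simp]: "\<lbrakk>f \<in> carrier E; b \<in> carrier A\<rbrakk> \<Longrightarrow> pre_right A f b \<in> carrier E"
  by (simp_all add: pre_left_eq pre_right_eq)

lemma pre_left_act: "\<lbrakk>left_module E V; f \<in> carrier E; b \<in> carrier A; v \<in> carrier V\<rbrakk>
    \<Longrightarrow> pre_left A f b \<odot>\<^bsub>V\<^esub> v = f \<odot>\<^bsub>V\<^esub> lact A V b v"
  and pre_right_act: "\<lbrakk>left_module E V; f \<in> carrier E; b \<in> carrier A; v \<in> carrier V\<rbrakk>
    \<Longrightarrow> pre_right A f b \<odot>\<^bsub>V\<^esub> v = f \<odot>\<^bsub>V\<^esub> ract A V v b"
  by (simp_all add: pre_left_eq pre_right_eq lact_def ract_def emod_act_act)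

text \<open>Multiplication by a scalar multiple of 1 commutes with every \<open>f\<close> in
  \<open>E\<close>, by \<open>K\<close>-linearity of \<open>f\<close>.\<close>

lemma lact_scalar_act:
  assumes "left_module E V" "f \<in> carrier E" "s \<in> carrier K" "v \<in> carrier V"
  shows "lact A V (s \<odot>\<^bsub>A\<^esub> \<one>\<^bsub>A\<^esub>) (f \<odot>\<^bsub>V\<^esub> v) = f \<odot>\<^bsub>V\<^esub> lact A V (s \<odot>\<^bsub>A\<^esub> \<one>\<^bsub>A\<^esub>) v"
proof -
  have "F_pure A (s \<odot>\<^bsub>A\<^esub> \<one>\<^bsub>A\<^esub>) \<one>\<^bsub>A\<^esub> \<otimes>\<^bsub>E\<^esub> f = f \<otimes>\<^bsub>E\<^esub> F_pure A (s \<odot>\<^bsub>A\<^esub> \<one>\<^bsub>A\<^esub>) \<one>\<^bsub>A\<^esub>"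
    using assms by (intro E_eqI) (simp_all add: smult_mult_left E_smult)
  then show ?thesis using assms by (simp add: lact_def emod_act_act)
qed

lemma dual_one_lact:
  "\<lbrakk>left_module E V; v \<in> invs V; i \<in> I; b \<in> carrier A\<rbrakk>
    \<Longrightarrow> fd i \<odot>\<^bsub>V\<^esub> lact A V b v = lact A V (as i b \<odot>\<^bsub>A\<^esub> \<one>\<^bsub>A\<^esub>) v"
  by (simp add: act_lact_invs)

text \<open>\<open>fd i\<close> sends \<open>b v\<close> to \<open>as i b\<close> times
  \<open>v\<close>. This scalar crosses to the right factor and joins \<open>a i\<close>; by
  additivity the dual basis identity then collapses the sum to \<open>b\<close>.\<close>

lemma tens_act_pure_lact:
  assumes V: "left_module E V" and W: "left_module E W" and f: "f \<in> carrier E"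
    and v: "v \<in> invs V" and b: "b \<in> carrier A" and w: "w \<in> carrier W"
  shows "tens_act_pure V W f (lact A V b v) w = ptens A V W v (f \<odot>\<^bsub>W\<^esub> lact A W b w)"
proof -
  note simps = V W f v b w
  let ?m = "\<lambda>c. ptens A V W v (f \<odot>\<^bsub>W\<^esub> lact A W c w)"
  have "tens_act_pure V W f (lact A V b v) w = (\<Oplus>\<^bsub>T V W\<^esub>i\<in>I. ?m (as i b \<odot>\<^bsub>A\<^esub> a i))"
    unfolding tens_act_pure_def
  proof (rule abelian_monoid.finsum_cong')
    show "abelian_monoid (T V W)" using abelian_group_tens[OF V W] by (simp add: abelian_group_def)
    fix i assume i: "i \<in> I"
    have "as i b \<odot>\<^bsub>A\<^esub> \<one>\<^bsub>A\<^esub> \<otimes>\<^bsub>A\<^esub> a i = as i b \<odot>\<^bsub>A\<^esub> a i"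
      using i b by (simp add: smult_mult_left)
    with i simps show "ptens A V W (fd i \<odot>\<^bsub>V\<^esub> lact A V b v) (pre_left A f (a i) \<odot>\<^bsub>W\<^esub> w) = ?m (as i b \<odot>\<^bsub>A\<^esub> a i)"
      by (simp add: dual_one_lact ptens_lact_invs pre_left_act lact_scalar_act lact_lact)
  qed (use simps in simp_all)
  also have "\<dots> = ?m (\<Oplus>\<^bsub>A\<^esub>i\<in>I. as i b \<odot>\<^bsub>A\<^esub> a i)"
    by (rule additive_finsum[symmetric, OF M.abelian_group_axioms abelian_group_tens[OF V W]
          additive_comp[OF additive_comp[OF lact_additive_scalar[OF W w] emod_act_additive[OF W f]]
            ptens_additive_right[OF V W]]])
      (use simps in simp_all)
  finally show ?thesis using b by (simp add: dual_basis)
qed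

lemma tens_act_pure_additive_left:
  assumes "left_module E V" "left_module E W" "f \<in> carrier E" "w \<in> carrier W"
  shows "additive_map V (T V W) (\<lambda>v. tens_act_pure V W f v w)"
  unfolding tens_act_pure_def
  by (rule additive_map_finsum[OF emod_abelian_group[OF assms(1)]
        abelian_group_tens[OF assms(1,2)] finite_I additive_comp[OF emod_act_additive ptens_additive_left]])
    (use assms in simp_all)

lemma tens_act_pure_additive_right:
  assumes "left_module E V" "left_module E W" "f \<in> carrier E" "v \<in> carrier V"
  shows "additive_map W (T V W) (tens_act_pure V W f v)"
  unfolding tens_act_pure_def
  by (rule additive_map_finsum[OF emod_abelian_group[OF assms(2)]
        abelian_group_tens[OF assms(1,2)] finite_I additive_comp[OF emod_act_additive ptens_additive_right]])
    (use assms in simp_all)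

lemma balanced_tens_act_pure:
  assumes V: "left_module E V" and W: "left_module E W" and f: "f \<in> carrier E"
  shows "balanced A V W (T V W) (tens_act_pure V W f)"
  unfolding balanced_def
proof (intro conjI ballI)
  note left = tens_act_pure_additive_left[OF V W f]
  note right = tens_act_pure_additive_right[OF V W f]
  fix v w assume v: "v \<in> carrier V" and w: "w \<in> carrier W"
  show "tens_act_pure V W f v w \<in> carrier (T V W)" using additive_closed[OF left[OF w] v] .
  show "tens_act_pure V W f (v \<oplus>\<^bsub>V\<^esub> v') w = tens_act_pure V W f v w \<oplus>\<^bsub>T V W\<^esub> tens_act_pure V W f v' w"
    if "v' \<in> carrier V" for v'
    using additive_add[OF left[OF w] v that] .
  show "tens_act_pure V W f v (w \<oplus>\<^bsub>W\<^esub> w') = tens_act_pure V W f v w \<oplus>\<^bsub>T V W\<^esub> tens_act_pure V W f v w'"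
    if "w' \<in> carrier W" for w'
    using additive_add[OF right[OF v] w that] .
  \<comment> \<open>For \<open>v = c g\<close> with \<open>g\<close> invariant,
    \<open>v b = (c b) g\<close>, so both sides are the tensor of \<open>g\<close> with
    \<open>f\<close> applied to \<open>c b w\<close>.\<close>
  show "tens_act_pure V W f (ract A V v b) w = tens_act_pure V W f v (lact A W b w)" if b: "b \<in> carrier A" for b
  proof (rule additive_eqI[OF V abelian_group_tens[OF V W] invs_generates[OF V]
        additive_comp[OF ract_additive[OF V b] left[OF w]] left[OF lact_closed[OF W b w]] _ v])
    fix c g assume "c \<in> carrier A" "g \<in> invs V"
    with V W f b w show "tens_act_pure V W f (ract A V (lact A V c g) b) w
        = tens_act_pure V W f (lact A V c g) (lact A W b w)"
      by (simp add: ract_lact ract_invs lact_lact tens_act_pure_lact)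
  qed
qed

text \<open>Discharges the definite description in \<open>tens\<close>: existence is the universal
  property applied to the balanced formula, uniqueness holds because pure tensors span
  additively.\<close>

lemma tens_smult:
  assumes V: "left_module E V" and W: "left_module E W" and f: "f \<in> carrier E"
  shows tens_act_additive: "additive_map (T V W) (T V W) (\<lambda>t. f \<odot>\<^bsub>T V W\<^esub> t)"
    and tens_act_ptens: "\<lbrakk>v \<in> carrier V; w \<in> carrier W\<rbrakk>
      \<Longrightarrow> f \<odot>\<^bsub>T V W\<^esub> ptens A V W v w = tens_act_pure V W f v w"
proof -
  let ?Q = "\<lambda>h. h \<in> extensional (carrier (T V W)) \<and> additive_map (T V W) (T V W) h \<and>
        (\<forall>v \<in> carrier V. \<forall>w \<in> carrier W. h (ptens A V W v w) = tens_act_pure V W f v w)"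
  \<comment> \<open>The definition speaks about \<open>tens_ab\<close>, since it cannot refer to the
    module being defined; \<open>hom_eq\<close> and \<open>sum_eq\<close> restate it over
    \<open>T V W\<close>.\<close>
  have hom_eq: "h \<in> hom (add_monoid (tens_ab A V W)) (add_monoid (tens_ab A V W))
      \<longleftrightarrow> additive_map (T V W) (T V W) h" for h
    unfolding hom_add_monoid_iff by (rule additive_map_record_cong) (simp_all only: tens_record)
  have sum_eq: "finsum (tens_ab A V W) g J = finsum (T V W) g J" for g :: "'i \<Rightarrow> 'u" and J
    by (rule finsum_record_cong) (simp_all only: tens_record)
  have "smult (T V W) f = (THE h. h \<in> extensional (carrier (tens_ab A V W))
        \<inter> hom (add_monoid (tens_ab A V W)) (add_monoid (tens_ab A V W)) \<and>
      (\<forall>v \<in> carrier V. \<forall>w \<in> carrier W. h (ptens A V W v w) = (\<Oplus>\<^bsub>tens_ab A V W\<^esub>i\<in>I.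
        ptens A V W (fd i \<odot>\<^bsub>V\<^esub> v) (pre_left A f (a i) \<odot>\<^bsub>W\<^esub> w))))"
    by (simp only: tens_def Let_def module.simps)
  then have smult: "smult (T V W) f = (THE h. ?Q h)"
    unfolding Int_iff hom_eq sum_eq conj_assoc tens_act_pure_def carrier_tens .
  obtain m where m: "additive_map (T V W) (T V W) m"
    "\<And>v w. \<lbrakk>v \<in> carrier V; w \<in> carrier W\<rbrakk> \<Longrightarrow> m (ptens A V W v w) = tens_act_pure V W f v w"
    using tens_lift[OF V W abelian_group_tens[OF V W] balanced_tens_act_pure[OF V W f]] by metis
  have ex: "?Q (restrict m (carrier (T V W)))"
    using m abelian_groupE(1)[OF abelian_group_tens[OF V W]] V W
    by (simp add: additive_map_def Pi_iff)
  have unique: "h = restrict m (carrier (T V W))" if h: "?Q h" for h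
  proof (rule extensionalityI)
    show "h t = restrict m (carrier (T V W)) t" if t: "t \<in> carrier (T V W)" for t
      using tens_additive_eqI_pure[OF V W abelian_group_tens[OF V W] _ _ _ t, of h m] h m t by simp
  qed (use h in simp_all)
  have eq: "smult (T V W) f = restrict m (carrier (T V W))"
    unfolding smult using ex unique by (rule the_equality)
  have "?Q (smult (T V W) f)" unfolding eq by (rule ex)
  then show "additive_map (T V W) (T V W) (\<lambda>t. f \<odot>\<^bsub>T V W\<^esub> t)"
    and "\<lbrakk>v \<in> carrier V; w \<in> carrier W\<rbrakk> \<Longrightarrow> f \<odot>\<^bsub>T V W\<^esub> ptens A V W v w = tens_act_pure V W f v w"
    by simp_all
qed


lemma tens_act_ptens_invs:
  assumes "left_module E V" "left_module E W" "f \<in> carrier E" "v \<in> invs V" "w \<in> carrier W"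
  shows "f \<odot>\<^bsub>T V W\<^esub> ptens A V W v w = ptens A V W v (f \<odot>\<^bsub>W\<^esub> w)"
  using tens_act_pure_lact[of V W f v "\<one>\<^bsub>A\<^esub>" w] assms by (simp add: tens_act_ptens)

text \<open>The laws in the ring argument compare additive maps in \<open>t\<close>. On
  \<open>v \<otimes> b w\<close> with \<open>v\<close> invariant the action touches only the right
  factor, so each becomes the same law in \<open>W\<close>.\<close>

lemma emod_tens [simp]:
  assumes V: "left_module E V" and W: "left_module E W"
  shows "left_module E (T V W)"
proof (intro left_module.intro left_module_axioms.intro ring_E abelian_group_tens[OF assms])
  note ab = abelian_group_tens[OF assms]
  note act = tens_act_additive[OF assms]
  note gen = invs_generates
  fix f g t assume f: "f \<in> carrier E" and g: "g \<in> carrier E" and t: "t \<in> carrier (T V W)"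
  have "additive_map (T V W) (T V W) (\<lambda>t. f \<odot>\<^bsub>T V W\<^esub> t \<oplus>\<^bsub>T V W\<^esub> g \<odot>\<^bsub>T V W\<^esub> t)"
  proof -
    interpret T: abelian_group "T V W" by (rule ab)
    show ?thesis
      by (rule additiveI)
        (simp_all add: additive_closed[OF act] additive_add[OF act] f g T.a_ac)
  qed
  from tens_additive_eqI[OF V W ab gen gen act[OF E_add_closed[OF f g]] this _ t]
  show "(f \<oplus>\<^bsub>E\<^esub> g) \<odot>\<^bsub>T V W\<^esub> t = f \<odot>\<^bsub>T V W\<^esub> t \<oplus>\<^bsub>T V W\<^esub> g \<odot>\<^bsub>T V W\<^esub> t"
    by (simp add: V W f g tens_act_ptens_invs emod_add_act ptens_add_right)
  from tens_additive_eqI[OF V W ab gen gen act[OF E_mult_closed[OF f g]] additive_comp[OF act[OF g] act[OF f]] _ t]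
  show "(f \<otimes>\<^bsub>E\<^esub> g) \<odot>\<^bsub>T V W\<^esub> t = f \<odot>\<^bsub>T V W\<^esub> (g \<odot>\<^bsub>T V W\<^esub> t)"
    by (simp add: V W f g tens_act_ptens_invs emod_act_act)
next
  note ab = abelian_group_tens[OF assms]
  note act = tens_act_additive[OF assms]
  fix t assume t: "t \<in> carrier (T V W)"
  have "additive_map (T V W) (T V W) (\<lambda>t. t)" by (simp add: additiveI)
  from tens_additive_eqI[OF V W ab invs_generates invs_generates act[OF E_one_closed] this _ t]
  show "\<one>\<^bsub>E\<^esub> \<odot>\<^bsub>T V W\<^esub> t = t"
    by (simp add: V W tens_act_ptens_invs)
qed (simp_all add: additive_closed[OF tens_act_additive[OF assms]] additive_add[OF tens_act_additive[OF assms]])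

text \<open>Together with \<open>ract_ptens\<close>: the bimodule structure derived from the
  \<open>E\<close>-action is the usual one on a tensor product over \<open>A\<close>. With
  \<open>v = c g\<close>, the left action reaches the right factor as \<open>b c w\<close> and
  returns across the invariant \<open>g\<close>.\<close>

lemma lact_ptens:
  assumes V: "left_module E V" and W: "left_module E W"
    and b: "b \<in> carrier A" and v: "v \<in> carrier V" and w: "w \<in> carrier W"
  shows "lact A (T V W) b (ptens A V W v w) = ptens A V W (lact A V b v) w"
proof -
  note T = emod_tens[OF V W]
  note pt = ptens_additive_left[OF V W w]
  show ?thesis
  proof (rule additive_eqI[OF V abelian_group_tens[OF V W] invs_generates[OF V]
        additive_comp[OF pt lact_additive[OF T b]] additive_comp[OF lact_additive[OF V b] pt] _ v])
    fix c g assume "c \<in> carrier A" "g \<in> invs V"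
    with V W b w show "lact A (T V W) b (ptens A V W (lact A V c g) w) = ptens A V W (lact A V b (lact A V c g)) w"
      by (simp add: ptens_lact_invs lact_lact lact_def[of A "T V W"] tens_act_ptens_invs)
        (simp add: lact_lact flip: lact_def)
  qed
qed

lemma ract_ptens:
  assumes V: "left_module E V" and W: "left_module E W"
    and b: "b \<in> carrier A" and v: "v \<in> carrier V" and w: "w \<in> carrier W"
  shows "ract A (T V W) (ptens A V W v w) b = ptens A V W v (ract A W w b)"
proof -
  note T = emod_tens[OF V W]
  show ?thesis
  proof (rule additive_eqI[OF V abelian_group_tens[OF V W] invs_generates[OF V]
        additive_comp[OF ptens_additive_left[OF V W w] ract_additive[OF T b]]
        ptens_additive_left[OF V W ract_closed[OF W b w]] _ v])
    fix c g assume "c \<in> carrier A" "g \<in> invs V"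
    with V W b w show "ract A (T V W) (ptens A V W (lact A V c g) w) b = ptens A V W (lact A V c g) (ract A W w b)"
      by (simp add: ptens_lact_invs ract_def[of A "T V W"] tens_act_ptens_invs)
        (simp add: ract_lact flip: ract_def)
  qed
qed

lemma ptens_invs [simp]:
  assumes "left_module E V" "left_module E W" "v \<in> invs V" "w \<in> invs W"
  shows "ptens A V W v w \<in> invs (T V W)"
  using assms by (intro invsI) (simp_all add: tens_act_ptens_invs invs_act lact_ptens ptens_lact_invs)

text \<open>A coefficient on the right factor crosses to the left one, which is invariant, and from
  there becomes a coefficient of the tensor. Variable \<open>G\<close> and \<open>H\<close> allow
  iteration to three and four factors.\<close>

lemma tens_generates:
  assumes V: "left_module E V" and W: "left_module E W" and G: "generates V G" and H: "generates W H"
  shows "generates (T V W) {ptens A V W v w | v w. v \<in> G \<and> w \<in> H}"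
proof (rule generatesI)
  show "{ptens A V W v w | v w. v \<in> G \<and> w \<in> H} \<subseteq> invs (T V W)"
    using V W generates_invs[OF G] generates_invs[OF H] by auto
  fix P t
  assume t: "t \<in> carrier (T V W)" and zero: "P \<zero>\<^bsub>T V W\<^esub>"
    and add: "\<And>x y. \<lbrakk>x \<in> carrier (T V W); y \<in> carrier (T V W); P x; P y\<rbrakk> \<Longrightarrow> P (x \<oplus>\<^bsub>T V W\<^esub> y)"
    and pure: "\<And>b g. \<lbrakk>b \<in> carrier A; g \<in> {ptens A V W v w | v w. v \<in> G \<and> w \<in> H}\<rbrakk> \<Longrightarrow> P (lact A (T V W) b g)"
  note ab = emod_abelian_group[OF V] emod_abelian_group[OF W] abelian_group_tens[OF V W]
  \<comment> \<open>The left factor is a generator here, so that coefficients of \<open>w\<close>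
    can pass it; a general left factor is reduced to this case in \<open>2\<close>.\<close>
  have 1: "P (ptens A V W v w)" if v: "v \<in> G" and w: "w \<in> carrier W" for v w
  proof (rule generates_induct[OF H w])
    have v': "v \<in> invs V" using generates_invs[OF G v] .
    note pt = ptens_additive_right[OF V W invs_closed[OF v']]
    show "P (ptens A V W v \<zero>\<^bsub>W\<^esub>)" using additive_zero[OF ab(2,3) pt] zero by simp
    show "P (ptens A V W v (x \<oplus>\<^bsub>W\<^esub> y))"
      if "x \<in> carrier W" "y \<in> carrier W" "P (ptens A V W v x)" "P (ptens A V W v y)" for x y
      using that V W v' by (simp add: additive_add[OF pt] add)
    show "P (ptens A V W v (lact A W b h))" if "b \<in> carrier A" "h \<in> H" for b h
      using pure[of b "ptens A V W v h"] that v V W v' generates_invs[OF H]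
      by (auto simp: lact_ptens ptens_lact_invs)
  qed
  have 2: "P (ptens A V W v w)" if v: "v \<in> carrier V" and w: "w \<in> carrier W" for v w
  proof (rule generates_induct[OF G v])
    note pt = ptens_additive_left[OF V W w]
    show "P (ptens A V W \<zero>\<^bsub>V\<^esub> w)" using additive_zero[OF ab(1,3) pt] zero by simp
    show "P (ptens A V W (x \<oplus>\<^bsub>V\<^esub> y) w)"
      if "x \<in> carrier V" "y \<in> carrier V" "P (ptens A V W x w)" "P (ptens A V W y w)" for x y
      using that V W w by (simp add: ptens_add_left add)
    show "P (ptens A V W (lact A V b g) w)" if "b \<in> carrier A" "g \<in> G" for b g
      using 1[of g "lact A W b w"] that V W w generates_invs[OF G] by (simp add: ptens_lact_invs)
  qed
  show "P t"
    by (rule tens_ab_induct[OF V W]) (use t zero add 2 in \<open>simp_all add: tens_record\<close>)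
qed

lemma tens_mod_homs_eqI:
  fixes N :: "('u \<Rightarrow> 'u, 'u) module"
  assumes V: "left_module E V" and W: "left_module E W" and N: "left_module E N"
    and G: "generates V G" and H: "generates W H"
    and mn: "m \<in> mod_homs E (T V W) N" "n \<in> mod_homs E (T V W) N"
    and eq: "\<And>v w. \<lbrakk>v \<in> G; w \<in> H\<rbrakk> \<Longrightarrow> m (ptens A V W v w) = n (ptens A V W v w)"
  shows "m = n"
  by (rule mod_homs_eqI[OF emod_tens[OF V W] N tens_generates[OF V W G H] mn]) (auto simp: eq)

text \<open>The conclusion has the form of the definite descriptions that define the structure maps.
  Balancing concerns all elements, while invariance and left linearity are checked on generators
  only.\<close>

lemma tens_hom_ex1:
  fixes N :: "('u \<Rightarrow> 'u, 'u) module"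
  assumes V: "left_module E V" and W: "left_module E W" and N: "left_module E N"
    and G: "generates V G" and H: "generates W H" and \<beta>: "balanced A V W N \<beta>"
    and inv: "\<And>v w. \<lbrakk>v \<in> G; w \<in> H\<rbrakk> \<Longrightarrow> \<beta> v w \<in> invs N"
    and lin: "\<And>b v w. \<lbrakk>b \<in> carrier A; v \<in> G; w \<in> H\<rbrakk> \<Longrightarrow> \<beta> (lact A V b v) w = lact A N b (\<beta> v w)"
  shows "\<exists>!m. m \<in> mod_homs E (T V W) N \<and>
    (\<forall>v \<in> carrier V. \<forall>w \<in> carrier W. m (ptens A V W v w) = \<beta> v w)"
proof -
  obtain m where m: "additive_map (T V W) N m"
    and pure: "\<And>v w. \<lbrakk>v \<in> carrier V; w \<in> carrier W\<rbrakk> \<Longrightarrow> m (ptens A V W v w) = \<beta> v w"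
    using tens_lift[OF V W emod_abelian_group[OF N] \<beta>] by metis
  have "restrict m (carrier (T V W)) \<in> mod_homs E (T V W) N"
    by (rule mod_homsI[OF emod_tens[OF V W] N tens_generates[OF V W G H] m])
      (use V W generates_invs[OF G] generates_invs[OF H] in \<open>auto simp: pure inv lin lact_ptens\<close>)
  moreover have "m = n" if "m \<in> mod_homs E (T V W) N \<and> (\<forall>v \<in> carrier V. \<forall>w \<in> carrier W. m (ptens A V W v w) = \<beta> v w)"
      "n \<in> mod_homs E (T V W) N \<and> (\<forall>v \<in> carrier V. \<forall>w \<in> carrier W. n (ptens A V W v w) = \<beta> v w)" for m n
    by (rule tens_mod_homs_eqI[OF V W N invs_generates[OF V] invs_generates[OF W]]) (use that in auto)
  ultimately show ?thesis
    by (intro ex1I[of _ "restrict m (carrier (T V W))"]) (use V W pure in auto)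
qed

text \<open>Expand the left factor as \<open>c g\<close>. Then \<open>f(-a_j)\<close> sends it to
  \<open>f(c a_j) g\<close>; the coefficient crosses to the invariant \<open>f_j w\<close>, where it
  becomes \<open>f\<close> applied to \<open>c a_j f_j w\<close>, and summing over \<open>j\<close>
  restores \<open>w\<close>.\<close>

lemma tens_act_ptens_right:
  assumes V: "left_module E V" and W: "left_module E W" and f: "f \<in> carrier E"
    and v: "v \<in> carrier V" and w: "w \<in> carrier W"
  shows "f \<odot>\<^bsub>T V W\<^esub> ptens A V W v w
    = (\<Oplus>\<^bsub>T V W\<^esub>j\<in>I. ptens A V W (pre_right A f (a j) \<odot>\<^bsub>V\<^esub> v) (fd j \<odot>\<^bsub>W\<^esub> w))"
proof -
  note ab = emod_abelian_group[OF V] abelian_group_tens[OF V W]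
  have sum: "additive_map V (T V W)
      (\<lambda>v. \<Oplus>\<^bsub>T V W\<^esub>j\<in>I. ptens A V W (pre_right A f (a j) \<odot>\<^bsub>V\<^esub> v) (fd j \<odot>\<^bsub>W\<^esub> w))"
    by (rule additive_map_finsum[OF ab finite_I additive_comp[OF emod_act_additive ptens_additive_left]])
      (use V W f w in simp_all)
  show ?thesis
  proof (rule additive_eqI[OF V ab(2) invs_generates[OF V]
        additive_comp[OF ptens_additive_left[OF V W w] tens_act_additive[OF V W f]] sum _ v])
    fix c g assume c: "c \<in> carrier A" and g: "g \<in> invs V"
    let ?m = "\<lambda>w. ptens A V W g (f \<odot>\<^bsub>W\<^esub> lact A W c w)"
    have pr: "pre_right A f (a j) c = f (c \<otimes>\<^bsub>A\<^esub> a j)" for j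
      using c by (simp add: pre_right_def)
    have m: "additive_map W (T V W) ?m"
      by (rule additive_comp[OF additive_comp[OF lact_additive[OF W c] emod_act_additive[OF W f]]
            ptens_additive_right[OF V W invs_closed[OF g]]])
    have "(\<Oplus>\<^bsub>T V W\<^esub>j\<in>I. ptens A V W (pre_right A f (a j) \<odot>\<^bsub>V\<^esub> lact A V c g) (fd j \<odot>\<^bsub>W\<^esub> w))
        = (\<Oplus>\<^bsub>T V W\<^esub>j\<in>I. ?m (lact A W (a j) (fd j \<odot>\<^bsub>W\<^esub> w)))"
      using V W f w c g
      by (intro emod_finsum_cong emod_tens)
        (simp_all add: pr pre_right_act ract_lact ract_invs lact_lact act_lact_invs ptens_lact_invs
          dual_one_act_invs)
    also have "\<dots> = ?m (\<Oplus>\<^bsub>W\<^esub>j\<in>I. lact A W (a j) (fd j \<odot>\<^bsub>W\<^esub> w))"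
      using V W w by (intro additive_finsum[OF emod_abelian_group ab(2) m, symmetric]) simp_all
    finally show "f \<odot>\<^bsub>T V W\<^esub> ptens A V W (lact A V c g) w
      = (\<Oplus>\<^bsub>T V W\<^esub>j\<in>I. ptens A V W (pre_right A f (a j) \<odot>\<^bsub>V\<^esub> lact A V c g) (fd j \<odot>\<^bsub>W\<^esub> w))"
      using V W f w c g by (simp add: sum_dual_one_act ptens_lact_invs tens_act_ptens_invs)
  qed
qed

section \<open>Structure maps\<close>


abbreviation U where "U \<equiv> unit_module A"

lemma unit_module_sel [simp]:
  "carrier U = carrier A" "add U = add A" "\<zero>\<^bsub>U\<^esub> = \<zero>\<^bsub>A\<^esub>" "f \<odot>\<^bsub>U\<^esub> b = f b"
  by (simp_all add: unit_module_def)

lemma emod_unit [simp]: "left_module E U"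
proof (intro left_module.intro left_module_axioms.intro ring_E)
  show "abelian_group U"
    by (rule abelian_group_record_cong[OF M.abelian_group_axioms]) simp_all
qed (simp_all add: E_add)

lemma lact_unit [simp]: "\<lbrakk>b \<in> carrier A; c \<in> carrier A\<rbrakk> \<Longrightarrow> lact A U b c = b \<otimes>\<^bsub>A\<^esub> c"
  and ract_unit [simp]: "\<lbrakk>b \<in> carrier A; c \<in> carrier A\<rbrakk> \<Longrightarrow> ract A U b c = b \<otimes>\<^bsub>A\<^esub> c"
  by (simp_all add: lact_def ract_def)

lemma one_invs [simp]: "\<one>\<^bsub>A\<^esub> \<in> invs U"
  by (rule invsI) simp_all

text \<open>Every \<open>b\<close> in \<open>A\<close> is \<open>b\<close> times 1, so linear maps
  out of a tensor product with the unit object can be compared at 1 alone.\<close>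

lemma unit_generates: "generates U {\<one>\<^bsub>A\<^esub>}"
proof (rule generatesI)
  fix P v
  assume "v \<in> carrier U" "\<And>b g. \<lbrakk>b \<in> carrier A; g \<in> {\<one>\<^bsub>A\<^esub>}\<rbrakk> \<Longrightarrow> P (lact A U b g)"
  from this(2)[of v "\<one>\<^bsub>A\<^esub>"] this(1) show "P v" by simp
qed simp

section \<open>Composition, and comparison on iterated tensor products\<close>

lemma id_mod_homs [simp]: "left_module E V \<Longrightarrow> (\<lambda>x\<in>carrier V. x) \<in> mod_homs E V V"
  by (simp add: mod_homs_iff additive_map_def)

lemma compose_mod_homs:
  fixes X Y Z :: "('u \<Rightarrow> 'u, 'u) module"
  assumes "left_module E X" "m \<in> mod_homs E X Y" "n \<in> mod_homs E Y Z"
  shows "compose (carrier X) n m \<in> mod_homs E X Z"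
proof -
  have "additive_map X Z (compose (carrier X) n m)"
    using additive_comp[OF mod_homs_additive[OF assms(2)] mod_homs_additive[OF assms(3)]] assms(1)
    by (simp add: additive_map_def compose_def Pi_iff)
  moreover have "compose (carrier X) n m (f \<odot>\<^bsub>X\<^esub> x) = f \<odot>\<^bsub>Z\<^esub> compose (carrier X) n m x"
    if "f \<in> carrier E" "x \<in> carrier X" for f x
    using that assms(1) mod_homs_act[OF assms(2) that] mod_homs_act[OF assms(3) that(1)]
      mod_homs_closed[OF assms(2) that(2)]
    by (simp add: compose_def)
  ultimately show ?thesis by (simp add: mod_homs_iff)
qed

text \<open>Iterated pure tensors of invariants generate again, by \<open>tens_generates\<close>;
  the coherence laws on three factors are tested in this form.\<close>

lemma tens3_mod_homs_eqI:
  fixes N :: "('u \<Rightarrow> 'u, 'u) module"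
  assumes "left_module E V" "left_module E W" "left_module E X" "left_module E N"
    and "m \<in> mod_homs E (T (T V W) X) N" "n \<in> mod_homs E (T (T V W) X) N"
    and "\<And>v w x. \<lbrakk>v \<in> invs V; w \<in> invs W; x \<in> invs X\<rbrakk>
      \<Longrightarrow> m (ptens A (T V W) X (ptens A V W v w) x) = n (ptens A (T V W) X (ptens A V W v w) x)"
  shows "m = n"
  by (rule tens_mod_homs_eqI[OF emod_tens[OF assms(1,2)] assms(3,4)
        tens_generates[OF assms(1,2) invs_generates[OF assms(1)] invs_generates[OF assms(2)]]
        invs_generates[OF assms(3)] assms(5,6)])
    (auto simp: assms(7))

text \<open>The right bracketing is the domain of the second hexagon.\<close>

lemma tens3_mod_homs_eqI':
  fixes N :: "('u \<Rightarrow> 'u, 'u) module"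
  assumes "left_module E V" "left_module E W" "left_module E X" "left_module E N"
    and "m \<in> mod_homs E (T V (T W X)) N" "n \<in> mod_homs E (T V (T W X)) N"
    and "\<And>v w x. \<lbrakk>v \<in> invs V; w \<in> invs W; x \<in> invs X\<rbrakk>
      \<Longrightarrow> m (ptens A V (T W X) v (ptens A W X w x)) = n (ptens A V (T W X) v (ptens A W X w x))"
  shows "m = n"
  by (rule tens_mod_homs_eqI[OF assms(1) emod_tens[OF assms(2,3)] assms(4)
        invs_generates[OF assms(1)]
        tens_generates[OF assms(2,3) invs_generates[OF assms(2)] invs_generates[OF assms(3)]] assms(5,6)])
    (auto simp: assms(7))

lemma tens4_mod_homs_eqI:
  fixes N :: "('u \<Rightarrow> 'u, 'u) module"
  assumes "left_module E V" "left_module E W" "left_module E X" "left_module E Y" "left_module E N"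
    and "m \<in> mod_homs E (T (T (T V W) X) Y) N" "n \<in> mod_homs E (T (T (T V W) X) Y) N"
    and "\<And>v w x y. \<lbrakk>v \<in> invs V; w \<in> invs W; x \<in> invs X; y \<in> invs Y\<rbrakk>
      \<Longrightarrow> m (ptens A (T (T V W) X) Y (ptens A (T V W) X (ptens A V W v w) x) y)
        = n (ptens A (T (T V W) X) Y (ptens A (T V W) X (ptens A V W v w) x) y)"
  shows "m = n"
  by (rule tens_mod_homs_eqI[OF emod_tens[OF emod_tens[OF assms(1,2)] assms(3)] assms(4,5)
        tens_generates[OF emod_tens[OF assms(1,2)] assms(3)
          tens_generates[OF assms(1,2) invs_generates[OF assms(1)] invs_generates[OF assms(2)]]
          invs_generates[OF assms(3)]]
        invs_generates[OF assms(4)] assms(6,7)])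
    (auto simp: assms(8))

text \<open>The function inside \<open>tens_arr\<close>, named so that it can be handled apart from
  source and target; the other \<open>_map\<close> constants have the same purpose.\<close>

definition tens_map where "tens_map V W V' W' g h = (THE m. m \<in> mod_homs E (T V W) (T V' W') \<and>
  (\<forall>v \<in> carrier V. \<forall>w \<in> carrier W. m (ptens A V W v w) = ptens A V' W' (g v) (h w)))"

text \<open>The formula is balanced since \<open>g\<close> commutes with the right action and
  \<open>h\<close> with the left one, and it preserves invariants because both maps do.\<close>

lemma tens_map:
  assumes V: "left_module E V" and W: "left_module E W" and V': "left_module E V'" and W': "left_module E W'"
    and g: "g \<in> mod_homs E V V'" and h: "h \<in> mod_homs E W W'"
  shows tens_map_hom [simp]: "tens_map V W V' W' g h \<in> mod_homs E (T V W) (T V' W')"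
    and tens_map_ptens [simp]: "\<lbrakk>v \<in> carrier V; w \<in> carrier W\<rbrakk>
      \<Longrightarrow> tens_map V W V' W' g h (ptens A V W v w) = ptens A V' W' (g v) (h w)"
proof -
  note [simp] = V W V' W' mod_homs_closed[OF g] mod_homs_closed[OF h] mod_homs_lact[OF g] mod_homs_lact[OF h]
    mod_homs_ract[OF g] mod_homs_invs[OF g] mod_homs_invs[OF h]
    additive_add[OF mod_homs_additive[OF g]] additive_add[OF mod_homs_additive[OF h]]
  have "\<exists>!m. m \<in> mod_homs E (T V W) (T V' W') \<and>
      (\<forall>v \<in> carrier V. \<forall>w \<in> carrier W. m (ptens A V W v w) = ptens A V' W' (g v) (h w))"
    by (rule tens_hom_ex1[OF V W emod_tens[OF V' W'] invs_generates[OF V] invs_generates[OF W]])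
      (simp_all add: balanced_def ptens_add_left ptens_add_right ptens_ract lact_ptens)
  from theI'[OF this] show "tens_map V W V' W' g h \<in> mod_homs E (T V W) (T V' W')"
    and "\<lbrakk>v \<in> carrier V; w \<in> carrier W\<rbrakk>
      \<Longrightarrow> tens_map V W V' W' g h (ptens A V W v w) = ptens A V' W' (g v) (h w)"
    unfolding tens_map_def by blast+
qed

section \<open>The unit constraints\<close>

definition lunit_map where "lunit_map V = (THE m. m \<in> mod_homs E (T U V) V \<and>
  (\<forall>b \<in> carrier A. \<forall>v \<in> carrier V. m (ptens A U V b v) = lact A V b v))"

lemma lunit_map:
  assumes V: "left_module E V"
  shows lunit_map_hom [simp]: "lunit_map V \<in> mod_homs E (T U V) V"
    and lunit_map_ptens [simp]: "\<lbrakk>b \<in> carrier A; v \<in> carrier V\<rbrakk> \<Longrightarrow> lunit_map V (ptens A U V b v) = lact A V b v"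
proof -
  have "\<exists>!m. m \<in> mod_homs E (T U V) V \<and>
      (\<forall>b \<in> carrier U. \<forall>v \<in> carrier V. m (ptens A U V b v) = lact A V b v)"
    by (rule tens_hom_ex1[OF emod_unit V V unit_generates invs_generates[OF V]])
      (use V in \<open>simp_all add: balanced_def add_lact lact_add lact_lact\<close>)
  from theI'[OF this] show "lunit_map V \<in> mod_homs E (T U V) V"
    and "\<lbrakk>b \<in> carrier A; v \<in> carrier V\<rbrakk> \<Longrightarrow> lunit_map V (ptens A U V b v) = lact A V b v"
    unfolding lunit_map_def unit_module_sel by blast+
qed

definition runit_map where "runit_map V = (THE m. m \<in> mod_homs E (T V U) V \<and>
  (\<forall>v \<in> carrier V. \<forall>b \<in> carrier A. m (ptens A V U v b) = ract A V v b))"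

lemma runit_map:
  assumes V: "left_module E V"
  shows runit_map_hom [simp]: "runit_map V \<in> mod_homs E (T V U) V"
    and runit_map_ptens [simp]: "\<lbrakk>v \<in> carrier V; b \<in> carrier A\<rbrakk> \<Longrightarrow> runit_map V (ptens A V U v b) = ract A V v b"
proof -
  have "\<exists>!m. m \<in> mod_homs E (T V U) V \<and>
      (\<forall>v \<in> carrier V. \<forall>b \<in> carrier U. m (ptens A V U v b) = ract A V v b)"
    by (rule tens_hom_ex1[OF V emod_unit V invs_generates[OF V] unit_generates])
      (use V in \<open>simp_all add: balanced_def add_ract ract_add ract_ract\<close>)
  from theI'[OF this] show "runit_map V \<in> mod_homs E (T V U) V"
    and "\<lbrakk>v \<in> carrier V; b \<in> carrier A\<rbrakk> \<Longrightarrow> runit_map V (ptens A V U v b) = ract A V v b"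
    unfolding runit_map_def unit_module_sel by blast+
qed

definition lunit_inv where "lunit_inv V = (\<lambda>v\<in>carrier V. ptens A U V \<one>\<^bsub>A\<^esub> v)"
definition runit_inv where "runit_inv V = (\<lambda>v\<in>carrier V. ptens A V U v \<one>\<^bsub>A\<^esub>)"

lemma lunit_inv_apply [simp]: "v \<in> carrier V \<Longrightarrow> lunit_inv V v = ptens A U V \<one>\<^bsub>A\<^esub> v"
  and runit_inv_apply [simp]: "v \<in> carrier V \<Longrightarrow> runit_inv V v = ptens A V U v \<one>\<^bsub>A\<^esub>"
  by (simp_all add: lunit_inv_def runit_inv_def)

text \<open>\<open>b v\<close> goes to \<open>1 \<otimes> b v\<close>, which equals
  \<open>b \<otimes> v\<close> because 1 is invariant; this is left linearity.\<close>

lemma lunit_inv_hom [simp]: "left_module E V \<Longrightarrow> lunit_inv V \<in> mod_homs E V (T U V)"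
  unfolding lunit_inv_def
  by (rule mod_homsI[OF _ _ invs_generates ptens_additive_right])
    (simp_all add: lact_ptens ptens_lact_invs[of U V "\<one>\<^bsub>A\<^esub>", symmetric])

lemma runit_inv_hom [simp]: "left_module E V \<Longrightarrow> runit_inv V \<in> mod_homs E V (T V U)"
  unfolding runit_inv_def
  by (rule mod_homsI[OF _ _ invs_generates ptens_additive_left]) (simp_all add: lact_ptens)

section \<open>The braiding\<close>

definition braid_pure where "braid_pure V W v w =
  (\<Oplus>\<^bsub>T W V\<^esub>i\<in>I. ptens A W V (fd i \<odot>\<^bsub>W\<^esub> w) (ract A V v (a i)))"

lemma braid_pure_additive_left:
  assumes "left_module E V" "left_module E W" "w \<in> carrier W"
  shows "additive_map V (T W V) (\<lambda>v. braid_pure V W v w)"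
  unfolding braid_pure_def
  by (rule additive_map_finsum[OF emod_abelian_group[OF assms(1)] abelian_group_tens[OF assms(2,1)]
        finite_I additive_comp[OF ract_additive ptens_additive_right]])
    (use assms in simp_all)

lemma braid_pure_additive_right:
  assumes "left_module E V" "left_module E W" "v \<in> carrier V"
  shows "additive_map W (T W V) (braid_pure V W v)"
  unfolding braid_pure_def
  by (rule additive_map_finsum[OF emod_abelian_group[OF assms(2)] abelian_group_tens[OF assms(2,1)]
        finite_I additive_comp[OF emod_act_additive ptens_additive_left]])
    (use assms in simp_all)

lemma lact_scalar_ract:
  assumes V: "left_module E V" and "s \<in> carrier K" "b \<in> carrier A" "v \<in> carrier V"
  shows "lact A V (s \<odot>\<^bsub>A\<^esub> \<one>\<^bsub>A\<^esub>) (ract A V v b) = ract A V v (s \<odot>\<^bsub>A\<^esub> b)"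
proof -
  have "F_pure A (s \<odot>\<^bsub>A\<^esub> \<one>\<^bsub>A\<^esub>) \<one>\<^bsub>A\<^esub> \<otimes>\<^bsub>E\<^esub> F_pure A \<one>\<^bsub>A\<^esub> b = F_pure A \<one>\<^bsub>A\<^esub> (s \<odot>\<^bsub>A\<^esub> b)"
    using assms by (intro E_eqI) (simp_all add: smult_mult_left smult_mult_right)
  then show ?thesis using assms by (simp add: lact_def ract_def emod_act_act)
qed

text \<open>\<open>fd i\<close> turns \<open>b w\<close> into \<open>as i b\<close> times
  \<open>w\<close>; the scalar crosses and joins \<open>a i\<close> on the right of
  \<open>v\<close>, where the sum is \<open>b\<close> again.\<close>

lemma braid_pure_lact:
  assumes V: "left_module E V" and W: "left_module E W"
    and v: "v \<in> carrier V" and b: "b \<in> carrier A" and w: "w \<in> invs W"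
  shows "braid_pure V W v (lact A W b w) = ptens A W V w (ract A V v b)"
proof -
  let ?m = "\<lambda>c. ptens A W V w (ract A V v c)"
  have "braid_pure V W v (lact A W b w) = (\<Oplus>\<^bsub>T W V\<^esub>i\<in>I. ?m (as i b \<odot>\<^bsub>A\<^esub> a i))"
    unfolding braid_pure_def using assms
    by (intro emod_finsum_cong emod_tens) (simp_all add: dual_one_lact ptens_lact_invs lact_scalar_ract)
  also have "\<dots> = ?m (\<Oplus>\<^bsub>A\<^esub>i\<in>I. as i b \<odot>\<^bsub>A\<^esub> a i)"
    by (rule additive_finsum[symmetric, OF M.abelian_group_axioms abelian_group_tens[OF W V]
          additive_comp[OF ract_additive_scalar[OF V v] ptens_additive_right[OF W V]]])
      (use assms in simp_all)
  finally show ?thesis using b by (simp add: dual_basis)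
qed

lemma braid_pure_invs:
  "\<lbrakk>left_module E V; left_module E W; v \<in> carrier V; w \<in> invs W\<rbrakk> \<Longrightarrow> braid_pure V W v w = ptens A W V w v"
  using braid_pure_lact[of V W v "\<one>\<^bsub>A\<^esub>" w] by simp

lemma balanced_braid_pure:
  assumes V: "left_module E V" and W: "left_module E W"
  shows "balanced A V W (T W V) (braid_pure V W)"
  unfolding balanced_def
proof (intro conjI ballI)
  note left = braid_pure_additive_left[OF V W]
  note right = braid_pure_additive_right[OF V W]
  fix v w assume v: "v \<in> carrier V" and w: "w \<in> carrier W"
  show "braid_pure V W v w \<in> carrier (T W V)" using additive_closed[OF left[OF w] v] .
  show "braid_pure V W (v \<oplus>\<^bsub>V\<^esub> v') w = braid_pure V W v w \<oplus>\<^bsub>T W V\<^esub> braid_pure V W v' w"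
    if "v' \<in> carrier V" for v'
    using additive_add[OF left[OF w] v that] .
  show "braid_pure V W v (w \<oplus>\<^bsub>W\<^esub> w') = braid_pure V W v w \<oplus>\<^bsub>T W V\<^esub> braid_pure V W v w'"
    if "w' \<in> carrier W" for w'
    using additive_add[OF right[OF v] w that] .
  \<comment> \<open>For \<open>w = c g\<close> with \<open>g\<close> invariant both sides are
    \<open>g \<otimes> v b c\<close>.\<close>
  show "braid_pure V W (ract A V v b) w = braid_pure V W v (lact A W b w)" if b: "b \<in> carrier A" for b
  proof (rule additive_eqI[OF W abelian_group_tens[OF W V] invs_generates[OF W]
        right[OF ract_closed[OF V b v]] additive_comp[OF lact_additive[OF W b] right[OF v]] _ w])
    fix c g assume "c \<in> carrier A" "g \<in> invs W"
    with V W b v show "braid_pure V W (ract A V v b) (lact A W c g) = braid_pure V W v (lact A W b (lact A W c g))"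
      by (simp add: lact_lact braid_pure_lact ract_ract)
  qed
qed

definition braid_map where "braid_map V W = (THE m. m \<in> mod_homs E (T V W) (T W V) \<and>
  (\<forall>v \<in> carrier V. \<forall>w \<in> carrier W. m (ptens A V W v w) = braid_pure V W v w))"

text \<open>\<open>braid_map_invs\<close> asks for invariance of the second factor alone; the
  asymmetry comes from the formula, which expands only \<open>w\<close>.\<close>

lemma braid_map:
  assumes V: "left_module E V" and W: "left_module E W"
  shows braid_map_hom [simp]: "braid_map V W \<in> mod_homs E (T V W) (T W V)"
    and braid_map_ptens: "\<lbrakk>v \<in> carrier V; w \<in> carrier W\<rbrakk>
      \<Longrightarrow> braid_map V W (ptens A V W v w) = braid_pure V W v w"
    and braid_map_invs [simp]: "\<lbrakk>v \<in> carrier V; w \<in> invs W\<rbrakk>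
      \<Longrightarrow> braid_map V W (ptens A V W v w) = ptens A W V w v"
proof -
  have "\<exists>!m. m \<in> mod_homs E (T V W) (T W V) \<and>
      (\<forall>v \<in> carrier V. \<forall>w \<in> carrier W. m (ptens A V W v w) = braid_pure V W v w)"
    by (rule tens_hom_ex1[OF V W emod_tens[OF W V] invs_generates[OF V] invs_generates[OF W]
          balanced_braid_pure[OF V W]])
      (use V W in \<open>simp_all add: braid_pure_invs lact_ptens ptens_lact_invs\<close>)
  from theI'[OF this] show 1: "braid_map V W \<in> mod_homs E (T V W) (T W V)"
    and 2: "\<lbrakk>v \<in> carrier V; w \<in> carrier W\<rbrakk> \<Longrightarrow> braid_map V W (ptens A V W v w) = braid_pure V W v w" for v w
    unfolding braid_map_def by blast+
  then show "\<lbrakk>v \<in> carrier V; w \<in> invs W\<rbrakk> \<Longrightarrow> braid_map V W (ptens A V W v w) = ptens A W V w v"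
    using V W by (simp add: braid_pure_invs)
qed

section \<open>The associativity constraint and its inverse\<close>

definition assoc_map where "assoc_map X V W = (THE m. m \<in> mod_homs E (T (T X V) W) (T X (T V W)) \<and>
  (\<forall>x \<in> carrier X. \<forall>v \<in> carrier V. \<forall>w \<in> carrier W.
    m (ptens A (T X V) W (ptens A X V x v) w) = ptens A X (T V W) x (ptens A V W v w)))"

text \<open>The source is an iterated tensor product, but values are prescribed on triple tensors
  only. So the universal property is used twice: for fixed \<open>w\<close> in the pair
  \<open>x\<close>, \<open>v\<close>, and then in the pair \<open>t\<close>,
  \<open>w\<close>.\<close>

lemma assoc_map:
  assumes X: "left_module E X" and V: "left_module E V" and W: "left_module E W"
  shows assoc_map_hom [simp]: "assoc_map X V W \<in> mod_homs E (T (T X V) W) (T X (T V W))"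
    and assoc_map_ptens [simp]: "\<lbrakk>x \<in> carrier X; v \<in> carrier V; w \<in> carrier W\<rbrakk>
      \<Longrightarrow> assoc_map X V W (ptens A (T X V) W (ptens A X V x v) w) = ptens A X (T V W) x (ptens A V W v w)"
proof -
  note [simp] = X V W
  let ?N = "T X (T V W)"
  note ab = abelian_group_tens[OF X emod_tens[OF V W]]
  \<comment> \<open>For each \<open>w\<close> an additive map with the right values is chosen; the
    choice itself says nothing about the dependence on \<open>w\<close>.\<close>
  define \<mu> where "\<mu> w = (SOME m. additive_map (T X V) ?N m \<and>
    (\<forall>x \<in> carrier X. \<forall>v \<in> carrier V. m (ptens A X V x v) = ptens A X (T V W) x (ptens A V W v w)))" for w
  have "\<exists>m. additive_map (T X V) ?N m \<and>
      (\<forall>x \<in> carrier X. \<forall>v \<in> carrier V. m (ptens A X V x v) = ptens A X (T V W) x (ptens A V W v w))"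
    if w: "w \<in> carrier W" for w
  proof -
    have "balanced A X V ?N (\<lambda>x v. ptens A X (T V W) x (ptens A V W v w))"
      using w by (simp add: balanced_def ptens_add_left ptens_add_right ptens_ract lact_ptens)
    then show ?thesis using tens_lift[OF X V ab] by metis
  qed
  from someI_ex[OF this]
  have \<mu>: "additive_map (T X V) ?N (\<mu> w)"
    and \<mu>_ptens: "\<lbrakk>x \<in> carrier X; v \<in> carrier V\<rbrakk> \<Longrightarrow> \<mu> w (ptens A X V x v) = ptens A X (T V W) x (ptens A V W v w)"
    if "w \<in> carrier W" for w x v
    using that unfolding \<mu>_def by blast+
  have "balanced A (T X V) W ?N (\<lambda>t w. \<mu> w t)"
    unfolding balanced_def
  proof (intro conjI ballI)
    interpret N: abelian_group ?N by (rule ab)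
    fix t w assume t: "t \<in> carrier (T X V)" and w: "w \<in> carrier W"
    show "\<mu> w t \<in> carrier ?N" by (rule additive_closed[OF \<mu>[OF w] t])
    show "\<mu> w (t \<oplus>\<^bsub>T X V\<^esub> t') = \<mu> w t \<oplus>\<^bsub>?N\<^esub> \<mu> w t'" if "t' \<in> carrier (T X V)" for t'
      by (rule additive_add[OF \<mu>[OF w] t that])
    \<comment> \<open>Additivity and balancing in \<open>w\<close> come from uniqueness: both sides
      are additive in \<open>t\<close> and agree on pure tensors.\<close>
    show "\<mu> (w \<oplus>\<^bsub>W\<^esub> w') t = \<mu> w t \<oplus>\<^bsub>?N\<^esub> \<mu> w' t" if w': "w' \<in> carrier W" for w'
    proof (rule tens_additive_eqI_pure[OF X V ab \<mu> _ _ t])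
      show "w \<oplus>\<^bsub>W\<^esub> w' \<in> carrier W" using w w' by simp
      show "additive_map (T X V) ?N (\<lambda>t. \<mu> w t \<oplus>\<^bsub>?N\<^esub> \<mu> w' t)"
        using w w' by (intro additiveI) (simp_all add: additive_closed[OF \<mu>] additive_add[OF \<mu>] N.a_ac)
    qed (use w w' in \<open>simp_all add: \<mu>_ptens ptens_add_right\<close>)
    show "\<mu> w (ract A (T X V) t b) = \<mu> (lact A W b w) t" if b: "b \<in> carrier A" for b
    proof (rule tens_additive_eqI_pure[OF X V ab additive_comp[OF ract_additive[OF emod_tens[OF X V] b] \<mu>[OF w]] \<mu> _ t])
      show "lact A W b w \<in> carrier W" using b w by simp
    qed (use w b in \<open>simp_all add: ract_ptens \<mu>_ptens ptens_ract\<close>)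
  qed
  note ex1 = tens_hom_ex1[OF emod_tens[OF X V] W emod_tens[OF X emod_tens[OF V W]]
      tens_generates[OF X V invs_generates[OF X] invs_generates[OF V]] invs_generates[OF W] this]
  have "\<exists>!m. m \<in> mod_homs E (T (T X V) W) ?N \<and>
      (\<forall>t \<in> carrier (T X V). \<forall>w \<in> carrier W. m (ptens A (T X V) W t w) = \<mu> w t)"
    by (rule ex1) (auto simp: \<mu>_ptens lact_ptens)
  then obtain m where m: "m \<in> mod_homs E (T (T X V) W) ?N"
    "\<And>t w. \<lbrakk>t \<in> carrier (T X V); w \<in> carrier W\<rbrakk> \<Longrightarrow> m (ptens A (T X V) W t w) = \<mu> w t"
    by blast
  have "\<exists>!m. m \<in> mod_homs E (T (T X V) W) ?N \<and> (\<forall>x \<in> carrier X. \<forall>v \<in> carrier V. \<forall>w \<in> carrier W.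
      m (ptens A (T X V) W (ptens A X V x v) w) = ptens A X (T V W) x (ptens A V W v w))"
  proof (rule ex1I[of _ m])
    fix n
    assume "n \<in> mod_homs E (T (T X V) W) ?N \<and> (\<forall>x \<in> carrier X. \<forall>v \<in> carrier V. \<forall>w \<in> carrier W.
      n (ptens A (T X V) W (ptens A X V x v) w) = ptens A X (T V W) x (ptens A V W v w))"
    then show "n = m"
      by (intro tens3_mod_homs_eqI[OF X V W _ _ m(1)]) (simp_all add: m(2) \<mu>_ptens)
  qed (simp add: m \<mu>_ptens)
  from theI'[OF this] show "assoc_map X V W \<in> mod_homs E (T (T X V) W) ?N"
    and "\<lbrakk>x \<in> carrier X; v \<in> carrier V; w \<in> carrier W\<rbrakk>
      \<Longrightarrow> assoc_map X V W (ptens A (T X V) W (ptens A X V x v) w) = ptens A X (T V W) x (ptens A V W v w)"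
    unfolding assoc_map_def by blast+
qed

text \<open>As the braidings are invertible, \<open>x \<otimes> (v \<otimes> w) \<mapsto> (x \<otimes> v) \<otimes> w\<close> can be composed from
  associativity in the other direction and braidings, with no further appeal to the universal property.\<close>

definition assoc_inv where "assoc_inv X V W =
  (\<lambda>t\<in>carrier (T X (T V W)).
    tens_map (T V X) W (T X V) W (braid_map V X) (\<lambda>w\<in>carrier W. w) (braid_map W (T V X)
      (assoc_map W V X (tens_map (T V W) X (T W V) X (braid_map V W) (\<lambda>x\<in>carrier X. x)
        (braid_map X (T V W) t)))))"

lemma assoc_inv:
  assumes X: "left_module E X" and V: "left_module E V" and W: "left_module E W"
  shows assoc_inv_hom [simp]: "assoc_inv X V W \<in> mod_homs E (T X (T V W)) (T (T X V) W)"
    and assoc_inv_ptens [simp]: "\<lbrakk>x \<in> invs X; v \<in> invs V; w \<in> invs W\<rbrakk>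
      \<Longrightarrow> assoc_inv X V W (ptens A X (T V W) x (ptens A V W v w)) = ptens A (T X V) W (ptens A X V x v) w"
proof -
  note [simp] = X V W
  \<comment> \<open>On invariants every braiding is a flip, so the steps are \<open>x(vw)\<close>,
    \<open>(vw)x\<close>, \<open>(wv)x\<close>, \<open>w(vx)\<close>, \<open>(vx)w\<close>,
    \<open>(xv)w\<close>.\<close>
  show ptens: "assoc_inv X V W (ptens A X (T V W) x (ptens A V W v w)) = ptens A (T X V) W (ptens A X V x v) w"
    if "x \<in> invs X" "v \<in> invs V" "w \<in> invs W" for x v w
    using that by (simp add: assoc_inv_def)
  have "assoc_inv X V W = compose (carrier (T X (T V W)))
      (tens_map (T V X) W (T X V) W (braid_map V X) (\<lambda>w\<in>carrier W. w))
      (compose (carrier (T X (T V W))) (braid_map W (T V X))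
        (compose (carrier (T X (T V W))) (assoc_map W V X)
          (compose (carrier (T X (T V W)))
            (tens_map (T V W) X (T W V) X (braid_map V W) (\<lambda>x\<in>carrier X. x)) (braid_map X (T V W)))))"
    by (auto simp: assoc_inv_def compose_def)
  \<comment> \<open>The rotated rules start from the outer factor, whose source fixes the module in
    the middle.\<close>
  also have "\<dots> \<in> mod_homs E (T X (T V W)) (T (T X V) W)"
    by (rule compose_mod_homs compose_mod_homs[rotated, OF _ tens_map_hom]
        compose_mod_homs[rotated, OF _ braid_map_hom] compose_mod_homs[rotated, OF _ assoc_map_hom]
        braid_map_hom id_mod_homs emod_tens X V W)+
  finally show "assoc_inv X V W \<in> mod_homs E (T X (T V W)) (T (T X V) W)" .
qed

end

section \<open>The braided monoidal category\<close>

lemma (in category) inverse_arrows_unique: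
  assumes "inverse_arrows C f g" "inverse_arrows C f h"
  shows "g = h"
proof -
  have f: "f \<in> Homs C (Src C f) (Tgt C f)" and g: "g \<in> Homs C (Tgt C f) (Src C f)"
    and h: "h \<in> Homs C (Tgt C f) (Src C f)"
    using assms by (auto simp: inverse_arrows_def Homs_def)
  have "g = g \<bullet> (f \<bullet> h)"
    using assms Cmp_Idt_right[OF g] by (simp add: inverse_arrows_def)
  also have "\<dots> = (g \<bullet> f) \<bullet> h" using Cmp_assoc[OF h f g] by simp
  also have "\<dots> = h" using assms Cmp_Idt_left[OF h] by (simp add: inverse_arrows_def)
  finally show ?thesis .
qed

text \<open>Replaces the definite description in the second hexagon by an explicit inverse.\<close>

lemma (in category) inv_arrow_eqI: "inverse_arrows C f g \<Longrightarrow> inv_arrow C f = g"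
  unfolding inv_arrow_def by (rule the_equality) (auto intro: inverse_arrows_unique)

context dual_basis_algebra
begin

abbreviation C where "C \<equiv> EndMod K A I as a"

text \<open>Matches the definite descriptions in the record with the named maps, so that each axiom
  becomes an equation between functions with known values on pure tensors.\<close>

lemma EndMod_sel [simp]:
  "Obj C = {V. left_module E V}"
  "Arr C = {(V, h, W). left_module E V \<and> left_module E W \<and> h \<in> mod_homs E V W}"
  "Src C (V, h, W) = V" "Tgt C (V, h, W) = W"
  "Idt C V = (V, \<lambda>x\<in>carrier V. x, V)"
  "(V', g, W') \<bullet>\<^bsub>C\<^esub> (V, h, W) = (V, compose (carrier V) g h, W')"
  "V \<boxtimes>\<^bsub>C\<^esub> W = T V W" "UnitO C = U"
  "(V, g, V') \<star>\<^bsub>C\<^esub> (W, h, W') = (T V W, tens_map V W V' W' g h, T V' W')"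
  "Assoc C X V W = (T (T X V) W, assoc_map X V W, T X (T V W))"
  "LUnit C V = (T U V, lunit_map V, V)" "RUnit C V = (T V U, runit_map V, V)"
  "Braid C V W = (T V W, braid_map V W, T W V)"
  by (simp_all add: EndMod_def tens_arr_def tens_map_def assoc_arr_def assoc_map_def lunit_arr_def
      lunit_map_def Let_def runit_arr_def runit_map_def braid_arr_def braid_map_def braid_pure_def)

lemma Homs_EndMod [simp]:
  "f \<in> Homs C V W \<longleftrightarrow> (\<exists>h. f = (V, h, W) \<and> left_module E V \<and> left_module E W \<and> h \<in> mod_homs E V W)"
  by (cases f) (auto simp: Homs_def)

text \<open>Both composites are \<open>E\<close>-linear, so it suffices that they fix generators; a
  linear candidate for the inverse has to be computed on invariants only.\<close>

lemma inverse_arrows_EndMod: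
  assumes "left_module E V" "left_module E W" "m \<in> mod_homs E V W" "n \<in> mod_homs E W V"
    and "generates V G" "generates W H"
    and "\<And>v. v \<in> G \<Longrightarrow> n (m v) = v" "\<And>w. w \<in> H \<Longrightarrow> m (n w) = w"
  shows "inverse_arrows C (V, m, W) (W, n, V)"
proof -
  have "compose (carrier V) n m = (\<lambda>v\<in>carrier V. v)"
    by (rule mod_homs_eqI[OF assms(1,1,5) compose_mod_homs[OF assms(1,3,4)] id_mod_homs[OF assms(1)]])
      (use generates_invs[OF assms(5)] in \<open>simp add: compose_def assms(7)\<close>)
  moreover have "compose (carrier W) m n = (\<lambda>w\<in>carrier W. w)"
    by (rule mod_homs_eqI[OF assms(2,2,6) compose_mod_homs[OF assms(2,4,3)] id_mod_homs[OF assms(2)]])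
      (use generates_invs[OF assms(6)] in \<open>simp add: compose_def assms(8)\<close>)
  ultimately show ?thesis using assms(1-4) by (simp add: inverse_arrows_def)
qed

lemma inverse_arrows_assoc:
  assumes X: "left_module E X" and V: "left_module E V" and W: "left_module E W"
  shows "inverse_arrows C (Assoc C X V W) (T X (T V W), assoc_inv X V W, T (T X V) W)"
proof -
  note gen = invs_generates[OF X] invs_generates[OF V] invs_generates[OF W]
  show ?thesis
    unfolding EndMod_sel
    by (rule inverse_arrows_EndMod[OF _ _ _ _
          tens_generates[OF emod_tens[OF X V] W tens_generates[OF X V gen(1,2)] gen(3)]
          tens_generates[OF X emod_tens[OF V W] gen(1) tens_generates[OF V W gen(2,3)]]])
      (use X V W in auto)
qed

lemma invs_unit: "b \<in> invs U \<Longrightarrow> b \<in> carrier A"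
  using invs_closed[of b U] by simp

lemma tens_map_id:
  assumes V: "left_module E V" and W: "left_module E W"
  shows "tens_map V W V W (\<lambda>x\<in>carrier V. x) (\<lambda>x\<in>carrier W. x) = (\<lambda>x\<in>carrier (T V W). x)"
  by (rule tens_mod_homs_eqI[OF V W emod_tens[OF V W] invs_generates[OF V] invs_generates[OF W]])
    (use V W in simp_all)

lemma category_EndMod: "category C"
proof
  show "Idt C X \<in> Homs C X X" if "X \<in> Obj C" for X
    using that by simp
  show "g \<bullet>\<^bsub>C\<^esub> f \<in> Homs C X Z" if "f \<in> Homs C X Y" "g \<in> Homs C Y Z" for f g X Y Z
    using that by (auto intro: compose_mod_homs)
  show "Idt C Y \<bullet>\<^bsub>C\<^esub> f = f" if hyps: "f \<in> Homs C X Y" for f X Y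
  proof -
    obtain h where h: "f = (X, h, Y)" "h \<in> mod_homs E X Y" using hyps by auto
    have "compose (carrier X) (\<lambda>x\<in>carrier Y. x) h = h"
      by (rule extensionalityI[OF compose_extensional mod_homs_extensional[OF h(2)]])
        (simp add: compose_def mod_homs_closed[OF h(2)])
    with h show ?thesis by simp
  qed
  show "f \<bullet>\<^bsub>C\<^esub> Idt C X = f" if hyps: "f \<in> Homs C X Y" for f X Y
  proof -
    obtain h where h: "f = (X, h, Y)" "h \<in> mod_homs E X Y" using hyps by auto
    have "compose (carrier X) h (\<lambda>x\<in>carrier X. x) = h"
      by (rule extensionalityI[OF compose_extensional mod_homs_extensional[OF h(2)]])
        (simp add: compose_def)
    with h show ?thesis by simp
  qed
  show "(h \<bullet>\<^bsub>C\<^esub> g) \<bullet>\<^bsub>C\<^esub> f = h \<bullet>\<^bsub>C\<^esub> (g \<bullet>\<^bsub>C\<^esub> f)"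
    if fgh: "f \<in> Homs C W X" "g \<in> Homs C X Y" "h \<in> Homs C Y Z" for f g h W X Y Z
  proof -
    obtain f' g' h' where "f = (W, f', X)" "g = (X, g', Y)" "h = (Y, h', Z)" "f' \<in> mod_homs E W X"
      using fgh by auto
    then show ?thesis
      by (auto simp: compose_def mod_homs_closed[of f' W X] intro!: restrict_ext)
  qed
qed auto

lemma monoidal_category_EndMod: "monoidal_category C"
proof (intro monoidal_category.intro category_EndMod monoidal_category_axioms.intro)
  show "X \<boxtimes>\<^bsub>C\<^esub> Y \<in> Obj C" if "X \<in> Obj C" "Y \<in> Obj C" for X Y
    using that by simp
  show "f \<star>\<^bsub>C\<^esub> g \<in> Homs C (X \<boxtimes>\<^bsub>C\<^esub> Y) (X' \<boxtimes>\<^bsub>C\<^esub> Y')"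
    if "f \<in> Homs C X X'" "g \<in> Homs C Y Y'" for f g X X' Y Y'
    using that by auto
  show "Idt C X \<star>\<^bsub>C\<^esub> Idt C Y = Idt C (X \<boxtimes>\<^bsub>C\<^esub> Y)" if "X \<in> Obj C" "Y \<in> Obj C" for X Y
    using that by (simp add: tens_map_id)
  show "(f' \<bullet>\<^bsub>C\<^esub> f) \<star>\<^bsub>C\<^esub> (g' \<bullet>\<^bsub>C\<^esub> g) = (f' \<star>\<^bsub>C\<^esub> g') \<bullet>\<^bsub>C\<^esub> (f \<star>\<^bsub>C\<^esub> g)"
    if hyps: "f \<in> Homs C X X'" "f' \<in> Homs C X' X''" "g \<in> Homs C Y Y'" "g' \<in> Homs C Y' Y''"
    for f f' g g' X X' X'' Y Y' Y''
  proof -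
    obtain k k' l l' where eqs: "f = (X, k, X')" "f' = (X', k', X'')" "g = (Y, l, Y')" "g' = (Y', l', Y'')"
      and [simp]: "left_module E X" "left_module E X'" "left_module E X''"
        "left_module E Y" "left_module E Y'" "left_module E Y''"
      and k: "k \<in> mod_homs E X X'" and k': "k' \<in> mod_homs E X' X''"
      and l: "l \<in> mod_homs E Y Y'" and l': "l' \<in> mod_homs E Y' Y''"
      using hyps by auto
    \<comment> \<open>Membership of the composites is also supplied with \<open>compose\<close>
      unfolded, because unfolding exposes them inside \<open>tens_map\<close>.\<close>
    note [simp] = k k' l l' mod_homs_closed[OF k] mod_homs_closed[OF l]
      compose_mod_homs[OF _ k k', unfolded compose_def] compose_mod_homs[OF _ l l', unfolded compose_def]
    have "tens_map X Y X'' Y'' (compose (carrier X) k' k) (compose (carrier Y) l' l)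
        = compose (carrier (T X Y)) (tens_map X' Y' X'' Y'' k' l') (tens_map X Y X' Y' k l)"
      by (rule tens_mod_homs_eqI[OF _ _ _ invs_generates invs_generates _
            compose_mod_homs[OF _ tens_map_hom[of X Y X' Y'] tens_map_hom]])
        (simp_all add: compose_def)
    then show ?thesis by (simp add: eqs)
  qed
  show "UnitO C \<in> Obj C" by simp
  show "Assoc C X Y Z \<in> Homs C ((X \<boxtimes>\<^bsub>C\<^esub> Y) \<boxtimes>\<^bsub>C\<^esub> Z) (X \<boxtimes>\<^bsub>C\<^esub> (Y \<boxtimes>\<^bsub>C\<^esub> Z))"
    if "X \<in> Obj C" "Y \<in> Obj C" "Z \<in> Obj C" for X Y Z
    using that by simp
  show "iso_arrow C (Assoc C X Y Z)" if "X \<in> Obj C" "Y \<in> Obj C" "Z \<in> Obj C" for X Y Z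
    using that inverse_arrows_assoc[of X Y Z] unfolding iso_arrow_def by auto
  show "Assoc C X' Y' Z' \<bullet>\<^bsub>C\<^esub> ((f \<star>\<^bsub>C\<^esub> g) \<star>\<^bsub>C\<^esub> h) = (f \<star>\<^bsub>C\<^esub> (g \<star>\<^bsub>C\<^esub> h)) \<bullet>\<^bsub>C\<^esub> Assoc C X Y Z"
    if hyps: "f \<in> Homs C X X'" "g \<in> Homs C Y Y'" "h \<in> Homs C Z Z'" for f g h X X' Y Y' Z Z'
  proof -
    obtain k l m where eqs: "f = (X, k, X')" "g = (Y, l, Y')" "h = (Z, m, Z')"
      and [simp]: "left_module E X" "left_module E X'" "left_module E Y" "left_module E Y'"
        "left_module E Z" "left_module E Z'"
      and k: "k \<in> mod_homs E X X'" and l: "l \<in> mod_homs E Y Y'" and m: "m \<in> mod_homs E Z Z'"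
      using hyps by auto
    note [simp] = k l m mod_homs_closed[OF k] mod_homs_closed[OF l] mod_homs_closed[OF m]
    have "compose (carrier (T (T X Y) Z)) (assoc_map X' Y' Z')
          (tens_map (T X Y) Z (T X' Y') Z' (tens_map X Y X' Y' k l) m)
        = compose (carrier (T (T X Y) Z)) (tens_map X (T Y Z) X' (T Y' Z') k (tens_map Y Z Y' Z' l m))
          (assoc_map X Y Z)"
      by (rule tens3_mod_homs_eqI[OF _ _ _ _ compose_mod_homs[OF _ tens_map_hom assoc_map_hom]
            compose_mod_homs[OF _ assoc_map_hom tens_map_hom]])
        (simp_all add: compose_def)
    then show ?thesis by (simp add: eqs)
  qed
  show "LUnit C X \<in> Homs C (UnitO C \<boxtimes>\<^bsub>C\<^esub> X) X" if "X \<in> Obj C" for X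
    using that by simp
  show "RUnit C X \<in> Homs C (X \<boxtimes>\<^bsub>C\<^esub> UnitO C) X" if "X \<in> Obj C" for X
    using that by simp
  show "iso_arrow C (LUnit C X)" if "X \<in> Obj C" for X
  proof -
    have X: "left_module E X" using that by simp
    \<comment> \<open>The generators of the source are the \<open>1 \<otimes> v\<close>, on which
      the two maps visibly undo each other.\<close>
    have "inverse_arrows C (LUnit C X) (X, lunit_inv X, T U X)"
      unfolding EndMod_sel
      by (rule inverse_arrows_EndMod[OF _ _ _ _
            tens_generates[OF emod_unit X unit_generates invs_generates[OF X]] invs_generates[OF X]])
        (use X in auto)
    then show ?thesis by (auto simp: iso_arrow_def)
  qed
  show "iso_arrow C (RUnit C X)" if "X \<in> Obj C" for X
  proof -
    have X: "left_module E X" using that by simp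
    have "inverse_arrows C (RUnit C X) (X, runit_inv X, T X U)"
      unfolding EndMod_sel
      by (rule inverse_arrows_EndMod[OF _ _ _ _
            tens_generates[OF X emod_unit invs_generates[OF X] unit_generates] invs_generates[OF X]])
        (use X in auto)
    then show ?thesis by (auto simp: iso_arrow_def)
  qed
  show "LUnit C Y \<bullet>\<^bsub>C\<^esub> (Idt C (UnitO C) \<star>\<^bsub>C\<^esub> f) = f \<bullet>\<^bsub>C\<^esub> LUnit C X" if hyps: "f \<in> Homs C X Y" for f X Y
  proof -
    obtain k where eqs: "f = (X, k, Y)" and [simp]: "left_module E X" "left_module E Y"
      and k: "k \<in> mod_homs E X Y"
      using hyps by auto
    note [simp] = k mod_homs_closed[OF k] mod_homs_lact[OF k]
    have "compose (carrier (T U X)) (lunit_map Y) (tens_map U X U Y (\<lambda>x\<in>carrier U. x) k)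
        = compose (carrier (T U X)) k (lunit_map X)"
      by (rule tens_mod_homs_eqI[OF _ _ _ unit_generates invs_generates
            compose_mod_homs[OF _ tens_map_hom lunit_map_hom] compose_mod_homs[OF _ lunit_map_hom k]])
        (use id_mod_homs[OF emod_unit] in \<open>simp_all add: compose_def\<close>)
    then show ?thesis by (simp add: eqs)
  qed
  show "RUnit C Y \<bullet>\<^bsub>C\<^esub> (f \<star>\<^bsub>C\<^esub> Idt C (UnitO C)) = f \<bullet>\<^bsub>C\<^esub> RUnit C X" if hyps: "f \<in> Homs C X Y" for f X Y
  proof -
    obtain k where eqs: "f = (X, k, Y)" and [simp]: "left_module E X" "left_module E Y"
      and k: "k \<in> mod_homs E X Y"
      using hyps by auto
    note [simp] = k mod_homs_closed[OF k] mod_homs_ract[OF k]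
    have "compose (carrier (T X U)) (runit_map Y) (tens_map X U Y U k (\<lambda>x\<in>carrier U. x))
        = compose (carrier (T X U)) k (runit_map X)"
      by (rule tens_mod_homs_eqI[OF _ _ _ invs_generates unit_generates
            compose_mod_homs[OF _ tens_map_hom runit_map_hom] compose_mod_homs[OF _ runit_map_hom k]])
        (use id_mod_homs[OF emod_unit] in \<open>simp_all add: compose_def\<close>)
    then show ?thesis by (simp add: eqs)
  qed
  show "Assoc C W X (Y \<boxtimes>\<^bsub>C\<^esub> Z) \<bullet>\<^bsub>C\<^esub> Assoc C (W \<boxtimes>\<^bsub>C\<^esub> X) Y Z
      = (Idt C W \<star>\<^bsub>C\<^esub> Assoc C X Y Z) \<bullet>\<^bsub>C\<^esub> Assoc C W (X \<boxtimes>\<^bsub>C\<^esub> Y) Z \<bullet>\<^bsub>C\<^esub> (Assoc C W X Y \<star>\<^bsub>C\<^esub> Idt C Z)"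
    if "W \<in> Obj C" "X \<in> Obj C" "Y \<in> Obj C" "Z \<in> Obj C" for W X Y Z
  proof -
    have [simp]: "left_module E W" "left_module E X" "left_module E Y" "left_module E Z"
      using that by simp_all
    \<comment> \<open>Both paths send \<open>((w x) y) z\<close> to
      \<open>w (x (y z))\<close>.\<close>
    have "compose (carrier (T (T (T W X) Y) Z)) (assoc_map W X (T Y Z)) (assoc_map (T W X) Y Z)
        = compose (carrier (T (T (T W X) Y) Z))
            (tens_map W (T (T X Y) Z) W (T X (T Y Z)) (\<lambda>x\<in>carrier W. x) (assoc_map X Y Z))
            (compose (carrier (T (T (T W X) Y) Z)) (assoc_map W (T X Y) Z)
              (tens_map (T (T W X) Y) Z (T W (T X Y)) Z (assoc_map W X Y) (\<lambda>x\<in>carrier Z. x)))"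
      by (rule tens4_mod_homs_eqI[OF _ _ _ _ _ compose_mod_homs[OF _ assoc_map_hom assoc_map_hom]
            compose_mod_homs[OF _ compose_mod_homs[OF _ tens_map_hom assoc_map_hom] tens_map_hom]])
        (simp_all add: compose_def)
    then show ?thesis by simp
  qed
  show "(Idt C X \<star>\<^bsub>C\<^esub> LUnit C Y) \<bullet>\<^bsub>C\<^esub> Assoc C X (UnitO C) Y = RUnit C X \<star>\<^bsub>C\<^esub> Idt C Y"
    if "X \<in> Obj C" "Y \<in> Obj C" for X Y
  proof -
    have [simp]: "left_module E X" "left_module E Y" using that by simp_all
    \<comment> \<open>On \<open>(x \<otimes> b) \<otimes> y\<close> this is the balancing relation
      \<open>x \<otimes> b y = x b \<otimes> y\<close>.\<close>
    have "compose (carrier (T (T X U) Y)) (tens_map X (T U Y) X Y (\<lambda>x\<in>carrier X. x) (lunit_map Y))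
          (assoc_map X U Y)
        = tens_map (T X U) Y X Y (runit_map X) (\<lambda>x\<in>carrier Y. x)"
      by (rule tens3_mod_homs_eqI[OF _ _ _ _ compose_mod_homs[OF _ assoc_map_hom tens_map_hom] tens_map_hom])
        (simp_all add: compose_def ptens_ract invs_unit)
    then show ?thesis by simp
  qed
qed

lemma braided_monoidal_category_EndMod: "braided_monoidal_category C"
proof -
  interpret monoidal_category C by (rule monoidal_category_EndMod)
  show ?thesis
  proof
    show "Braid C X Y \<in> Homs C (X \<boxtimes>\<^bsub>C\<^esub> Y) (Y \<boxtimes>\<^bsub>C\<^esub> X)" if "X \<in> Obj C" "Y \<in> Obj C" for X Y
      using that by simp
    show "iso_arrow C (Braid C X Y)" if "X \<in> Obj C" "Y \<in> Obj C" for X Y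
    proof -
      have X: "left_module E X" and Y: "left_module E Y" using that by simp_all
      \<comment> \<open>On invariants both braidings are flips and undo each other; the braiding is
        thus a symmetry.\<close>
      have "inverse_arrows C (Braid C X Y) (Braid C Y X)"
        unfolding EndMod_sel
        by (rule inverse_arrows_EndMod[OF _ _ _ _
              tens_generates[OF X Y invs_generates[OF X] invs_generates[OF Y]]
              tens_generates[OF Y X invs_generates[OF Y] invs_generates[OF X]]])
          (use X Y in auto)
      then show ?thesis by (auto simp: iso_arrow_def)
    qed
    show "Braid C X' Y' \<bullet>\<^bsub>C\<^esub> (f \<star>\<^bsub>C\<^esub> g) = (g \<star>\<^bsub>C\<^esub> f) \<bullet>\<^bsub>C\<^esub> Braid C X Y"
      if hyps: "f \<in> Homs C X X'" "g \<in> Homs C Y Y'" for f g X X' Y Y'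
    proof -
      obtain k l where eqs: "f = (X, k, X')" "g = (Y, l, Y')"
        and [simp]: "left_module E X" "left_module E X'" "left_module E Y" "left_module E Y'"
        and k: "k \<in> mod_homs E X X'" and l: "l \<in> mod_homs E Y Y'"
        using hyps by auto
      \<comment> \<open>The braiding flips as soon as the second factor is invariant, so
        \<open>l\<close> has to preserve invariants while \<open>k\<close> enters through
        closure.\<close>
      note [simp] = k l mod_homs_closed[OF k] mod_homs_invs[OF l]
      have "compose (carrier (T X Y)) (braid_map X' Y') (tens_map X Y X' Y' k l)
          = compose (carrier (T X Y)) (tens_map Y X Y' X' l k) (braid_map X Y)"
        by (rule tens_mod_homs_eqI[OF _ _ _ invs_generates invs_generates
              compose_mod_homs[OF _ tens_map_hom braid_map_hom]
              compose_mod_homs[OF _ braid_map_hom tens_map_hom]])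
          (simp_all add: compose_def)
      then show ?thesis by (simp add: eqs)
    qed
    show "Assoc C Y Z X \<bullet>\<^bsub>C\<^esub> Braid C X (Y \<boxtimes>\<^bsub>C\<^esub> Z) \<bullet>\<^bsub>C\<^esub> Assoc C X Y Z
        = (Idt C Y \<star>\<^bsub>C\<^esub> Braid C X Z) \<bullet>\<^bsub>C\<^esub> Assoc C Y X Z \<bullet>\<^bsub>C\<^esub> (Braid C X Y \<star>\<^bsub>C\<^esub> Idt C Z)"
      if "X \<in> Obj C" "Y \<in> Obj C" "Z \<in> Obj C" for X Y Z
    proof -
      have [simp]: "left_module E X" "left_module E Y" "left_module E Z" using that by simp_all
      \<comment> \<open>Both paths end in \<open>y \<otimes> (z \<otimes> x)\<close>; the braiding
        past \<open>y \<otimes> z\<close> is a flip because tensors of invariants are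
        invariant.\<close>
      have "compose (carrier (T (T X Y) Z)) (assoc_map Y Z X)
            (compose (carrier (T (T X Y) Z)) (braid_map X (T Y Z)) (assoc_map X Y Z))
          = compose (carrier (T (T X Y) Z)) (tens_map Y (T X Z) Y (T Z X) (\<lambda>y\<in>carrier Y. y) (braid_map X Z))
              (compose (carrier (T (T X Y) Z)) (assoc_map Y X Z)
                (tens_map (T X Y) Z (T Y X) Z (braid_map X Y) (\<lambda>z\<in>carrier Z. z)))"
        by (rule tens3_mod_homs_eqI[OF _ _ _ _
              compose_mod_homs[OF _ compose_mod_homs[OF _ assoc_map_hom braid_map_hom] assoc_map_hom]
              compose_mod_homs[OF _ compose_mod_homs[OF _ tens_map_hom assoc_map_hom] tens_map_hom]])
          (simp_all add: compose_def)
      then show ?thesis by simp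
    qed
    show "inv_arrow C (Assoc C Z X Y) \<bullet>\<^bsub>C\<^esub> Braid C (X \<boxtimes>\<^bsub>C\<^esub> Y) Z \<bullet>\<^bsub>C\<^esub> inv_arrow C (Assoc C X Y Z)
        = (Braid C X Z \<star>\<^bsub>C\<^esub> Idt C Y) \<bullet>\<^bsub>C\<^esub> inv_arrow C (Assoc C X Z Y) \<bullet>\<^bsub>C\<^esub> (Idt C X \<star>\<^bsub>C\<^esub> Braid C Y Z)"
      if "X \<in> Obj C" "Y \<in> Obj C" "Z \<in> Obj C" for X Y Z
    proof -
      have [simp]: "left_module E X" "left_module E Y" "left_module E Z" using that by simp_all
      \<comment> \<open>Uniqueness of inverses identifies each \<open>inv_arrow\<close> here with
        \<open>assoc_inv\<close>, whose values on invariants are known.\<close>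
      note [simp] = inv_arrow_eqI[OF inverse_arrows_assoc, unfolded EndMod_sel]
      \<comment> \<open>Both paths end in \<open>(z \<otimes> x) \<otimes> y\<close>.\<close>
      have "compose (carrier (T X (T Y Z))) (assoc_inv Z X Y)
            (compose (carrier (T X (T Y Z))) (braid_map (T X Y) Z) (assoc_inv X Y Z))
          = compose (carrier (T X (T Y Z))) (tens_map (T X Z) Y (T Z X) Y (braid_map X Z) (\<lambda>y\<in>carrier Y. y))
              (compose (carrier (T X (T Y Z))) (assoc_inv X Z Y)
                (tens_map X (T Y Z) X (T Z Y) (\<lambda>x\<in>carrier X. x) (braid_map Y Z)))"
        by (rule tens3_mod_homs_eqI'[OF _ _ _ _
              compose_mod_homs[OF _ compose_mod_homs[OF _ assoc_inv_hom braid_map_hom] assoc_inv_hom]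
              compose_mod_homs[OF _ compose_mod_homs[OF _ tens_map_hom assoc_inv_hom] tens_map_hom]])
          (simp_all add: compose_def)
      then show ?thesis by simp
    qed
  qed
qed

end

theorem proposition3p1:
  fixes K :: "('k, 'x) ring_scheme"
    and A :: "('k, 'u::infinite, 'y) module_scheme"
    and I :: "'i set" and as :: "'i \<Rightarrow> 'u \<Rightarrow> 'k" and a :: "'i \<Rightarrow> 'u"
  assumes "cring K" and "k_algebra K A" and "finite_dual_basis K A I as a"
  shows "let E = End_ring K A; C = EndMod K A I as a; f\<^sub>d = dual_one A as in
    braided_monoidal_category C \<and>
    (\<forall>V \<in> Obj C. bimodule K A V (lact A V) (ract A V)) \<and>
    (\<forall>V \<in> Obj C. \<forall>W \<in> Obj C. \<forall>f \<in> carrier E. \<forall>v \<in> carrier V. \<forall>w \<in> carrier W.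
      f \<odot>\<^bsub>V \<boxtimes>\<^bsub>C\<^esub> W\<^esub> ptens A V W v w
        = (\<Oplus>\<^bsub>V \<boxtimes>\<^bsub>C\<^esub> W\<^esub>i\<in>I. ptens A V W (f\<^sub>d i \<odot>\<^bsub>V\<^esub> v) (pre_left A f (a i) \<odot>\<^bsub>W\<^esub> w)) \<and>
      f \<odot>\<^bsub>V \<boxtimes>\<^bsub>C\<^esub> W\<^esub> ptens A V W v w
        = (\<Oplus>\<^bsub>V \<boxtimes>\<^bsub>C\<^esub> W\<^esub>j\<in>I. ptens A V W (pre_right A f (a j) \<odot>\<^bsub>V\<^esub> v) (f\<^sub>d j \<odot>\<^bsub>W\<^esub> w))) \<and>
    (carrier (UnitO C) = carrier A \<and>
      (\<forall>f \<in> carrier E. \<forall>b \<in> carrier A. f \<odot>\<^bsub>UnitO C\<^esub> b = f b)) \<and>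
    (\<forall>V \<in> Obj C. \<forall>W \<in> Obj C. \<forall>V' \<in> Obj C. \<forall>W' \<in> Obj C.
      \<forall>g \<in> Homs C V V'. \<forall>h \<in> Homs C W W'. \<forall>v \<in> carrier V. \<forall>w \<in> carrier W.
      arr_fun (g \<star>\<^bsub>C\<^esub> h) (ptens A V W v w) = ptens A V' W' (arr_fun g v) (arr_fun h w)) \<and>
    (\<forall>U \<in> Obj C. \<forall>V \<in> Obj C. \<forall>W \<in> Obj C.
      \<forall>u \<in> carrier U. \<forall>v \<in> carrier V. \<forall>w \<in> carrier W.
      arr_fun (Assoc C U V W) (ptens A (U \<boxtimes>\<^bsub>C\<^esub> V) W (ptens A U V u v) w)
        = ptens A U (V \<boxtimes>\<^bsub>C\<^esub> W) u (ptens A V W v w)) \<and>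
    (\<forall>V \<in> Obj C. \<forall>b \<in> carrier A. \<forall>v \<in> carrier V.
      arr_fun (LUnit C V) (ptens A (UnitO C) V b v) = lact A V b v \<and>
      arr_fun (RUnit C V) (ptens A V (UnitO C) v b) = ract A V v b) \<and>
    (\<forall>V \<in> Obj C. \<forall>W \<in> Obj C. \<forall>v \<in> carrier V. \<forall>w \<in> carrier W.
      arr_fun (Braid C V W) (ptens A V W v w)
        = (\<Oplus>\<^bsub>W \<boxtimes>\<^bsub>C\<^esub> V\<^esub>i\<in>I. ptens A W V (f\<^sub>d i \<odot>\<^bsub>W\<^esub> w) (ract A V v (a i))))"
proof -
  interpret dual_basis_algebra K A I as a
    using assms(2,3) by (simp add: dual_basis_algebra_def dual_basis_algebra_axioms_def)
  show ?thesis
    unfolding Let_def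
  proof (intro conjI ballI)
    show "braided_monoidal_category (EndMod K A I as a)" by (rule braided_monoidal_category_EndMod)
  \<comment> \<open>The first action formula is the one defining the action, the second is
    \<open>tens_act_ptens_right\<close>; sums are folded back into \<open>tens_act_pure\<close> and
    \<open>braid_pure\<close>, in whose terms the values are known.\<close>
  qed (auto simp: bimodule_emod tens_act_ptens tens_act_pure_def[symmetric] tens_act_ptens_right[symmetric]
      arr_fun_def braid_map_ptens braid_pure_def[symmetric])
qed

end
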